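(* Let $N\ge 1$. For each $M\in E$, the nonzero elements of the diagonal of $M^2$ (ordinary matrix square) come in equal pairs; that is, there is a link pattern $\pi$ of size $N$ such that $(M^2)_{ii}=(M^2)_{\pi(i)\pi(i)}$ for all $i$, and in addition $(M^2)_{ii}=0$ if $\pi(i)=i$. Conversely, for each link pattern $\pi$, the open subscheme $$\{M\in E : (M^2)_{ii}=(M^2)_{jj}\text{ if and only if } j\in\{i,\pi(i)\}\}$$ of $E$ is nonempty, irreducible, and of dimension $\lfloor N^2/2\rfloor$.
   Context: Let $N=2n+r$ be a positive integer with $r\in\{0,1\}$. A sequence $(i_1,\dots,i_k)\in\{1,\dots,N\}^k$ is cyclically ordered, written $\circlearrowleft(i_1\le\dots\le i_k)$, if for some $j$ the rotated sequence $(i_j,\dots,i_k,i_1,\dots,i_{j-1})$ is weakly increasing, with the additional condition that all the $i$'s are equal if $i_1=i_k$. On $M_N(\mathbb C)$ define the (associative) product $(P\bullet Q)_{ik}=\sum_{j:\ \circlearrowleft(i\le j\le k)}P_{ij}Q_{jk}$. The Brauer loop scheme $E\subseteq M_N(\mathbb C)$ is the scheme defined by the equations $M\bullet M=0$ and $M_{ii}=0$ for $i=1,\dots,N$. A link pattern (of size $N$) is an involution of $\{1,\dots,N\}$ with exactly $r$ fixed points. *)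

theory Defs
  imports
    "HOL-Analysis.Abstract_Topology"
    "HOL-Library.Extended_Nat"
    "Jordan_Normal_Form.Matrix"
begin

section \<open>The Zariski topology on complex square matrices\<close>

inductive poly_fun :: "nat \<Rightarrow> (complex mat \<Rightarrow> complex) \<Rightarrow> bool" for N where
  const: "poly_fun N (\<lambda>M. c)"
| entry: "i < N \<Longrightarrow> j < N \<Longrightarrow> poly_fun N (\<lambda>M. M $$ (i, j))"
| add: "poly_fun N f \<Longrightarrow> poly_fun N g \<Longrightarrow> poly_fun N (\<lambda>M. f M + g M)"
| mult: "poly_fun N f \<Longrightarrow> poly_fun N g \<Longrightarrow> poly_fun N (\<lambda>M. f M * g M)"

definition zero_locus :: "nat \<Rightarrow> (complex mat \<Rightarrow> complex) set \<Rightarrow> complex mat set" where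
  "zero_locus N F = {M \<in> carrier_mat N N. \<forall>f\<in>F. f M = 0}"

definition zariski :: "nat \<Rightarrow> complex mat topology" where
  "zariski N = topology (\<lambda>U. \<exists>F. (\<forall>f\<in>F. poly_fun N f) \<and> U = carrier_mat N N - zero_locus N F)"

lemma istopology_zariski:
  "istopology (\<lambda>U. \<exists>F. (\<forall>f\<in>F. poly_fun N f) \<and> U = carrier_mat N N - zero_locus N F)"
  (is "istopology ?P")
  unfolding istopology_def
proof (intro conjI allI impI)
  fix S T assume "?P S" "?P T"
  then obtain F G where F: "\<forall>f\<in>F. poly_fun N f" "S = carrier_mat N N - zero_locus N F"
    and G: "\<forall>f\<in>G. poly_fun N f" "T = carrier_mat N N - zero_locus N G" by blast
  let ?H = "(\<lambda>(f, g) M. f M * g M) ` (F \<times> G)"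
  have "\<forall>h\<in>?H. poly_fun N h" using F G by (auto intro: poly_fun.mult)
  moreover have "S \<inter> T = carrier_mat N N - zero_locus N ?H"
    unfolding F G zero_locus_def by fastforce
  ultimately show "?P (S \<inter> T)" by blast
next
  fix K assume "\<forall>S\<in>K. ?P S"
  then obtain F where F: "\<And>S. S \<in> K \<Longrightarrow> (\<forall>f\<in>F S. poly_fun N f) \<and> S = carrier_mat N N - zero_locus N (F S)"
    by metis
  have "\<Union>K = (\<Union>S\<in>K. carrier_mat N N - zero_locus N (F S))" using F by blast
  also have "\<dots> = carrier_mat N N - zero_locus N (\<Union>(F ` K))"
    unfolding zero_locus_def by blast
  finally show "?P (\<Union>K)" using F by (intro exI[of _ "\<Union>(F ` K)"]) blast
qed

lemma openin_zariski:
  "openin (zariski N) U \<longleftrightarrow>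
    (\<exists>F. (\<forall>f\<in>F. poly_fun N f) \<and> U = carrier_mat N N - zero_locus N F)"
  unfolding zariski_def using istopology_zariski by (simp add: topology_inverse')

lemma topspace_zariski: "topspace (zariski N) = carrier_mat N N"
proof
  show "topspace (zariski N) \<subseteq> carrier_mat N N"
    unfolding topspace_def by (auto simp: openin_zariski)
  have "openin (zariski N) (carrier_mat N N)"
    unfolding openin_zariski
    by (intro exI[of _ "{\<lambda>M. 1}"]) (auto simp: zero_locus_def intro: poly_fun.const)
  then show "carrier_mat N N \<subseteq> topspace (zariski N)" by (rule openin_subset)
qed

lemma closedin_zariski:
  "closedin (zariski N) S \<longleftrightarrow> (\<exists>F. (\<forall>f\<in>F. poly_fun N f) \<and> S = zero_locus N F)"
  unfolding closedin_def openin_zariski topspace_zariski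
proof (intro iffI; elim conjE exE)
  fix F assume S: "S \<subseteq> carrier_mat N N" and F: "\<forall>f\<in>F. poly_fun N f"
    and "carrier_mat N N - S = carrier_mat N N - zero_locus N F"
  moreover have "zero_locus N F \<subseteq> carrier_mat N N" by (auto simp: zero_locus_def)
  ultimately have "S = zero_locus N F" by blast
  with F show "\<exists>F. (\<forall>f\<in>F. poly_fun N f) \<and> S = zero_locus N F" by blast
next
  fix F assume "\<forall>f\<in>F. poly_fun N f" "S = zero_locus N F"
  then show "S \<subseteq> carrier_mat N N \<and>
      (\<exists>F. (\<forall>f\<in>F. poly_fun N f) \<and> carrier_mat N N - S = carrier_mat N N - zero_locus N F)"
    by (auto simp: zero_locus_def)
qed

section \<open>Irreducibility and Krull dimension of topological spaces\<close>

definition irreducible_space :: "'a topology \<Rightarrow> bool" where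
  "irreducible_space X \<longleftrightarrow> topspace X \<noteq> {} \<and>
    (\<forall>A B. closedin X A \<and> closedin X B \<and> topspace X = A \<union> B \<longrightarrow> A = topspace X \<or> B = topspace X)"

text \<open>Supremum of the lengths \<open>n\<close> of chains \<open>Z 0 \<subset> \<dots> \<subset> Z n\<close> of irreducible closed subsets.
  The empty space gets dimension \<open>0\<close>, so nonemptiness has to be stated separately.\<close>

definition krull_dim :: "'a topology \<Rightarrow> enat" where
  "krull_dim X = Sup {enat n | n. \<exists>Z :: nat \<Rightarrow> 'a set.
     (\<forall>i\<le>n. closedin X (Z i) \<and> irreducible_space (subtopology X (Z i))) \<and>
     (\<forall>i<n. Z i \<subset> Z (Suc i))}"

section \<open>The Brauer loop scheme\<close>

text \<open>Rows and columns are indexed by \<open>0, \<dots>, N - 1\<close>, so all indices are shifted down by one.\<close>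

definition cyclically_ordered :: "nat list \<Rightarrow> bool" where
  "cyclically_ordered is \<longleftrightarrow>
    (\<exists>m<length is. sorted (rotate m is)) \<and>
    (hd is = last is \<longrightarrow> (\<forall>x\<in>set is. x = hd is))"

definition brauer_prod :: "nat \<Rightarrow> complex mat \<Rightarrow> complex mat \<Rightarrow> complex mat" where
  "brauer_prod N P Q =
    mat N N (\<lambda>(i, k). \<Sum>j | j < N \<and> cyclically_ordered [i, j, k]. P $$ (i, j) * Q $$ (j, k))"

text \<open>The complex points of the scheme. With the topology induced by \<open>zariski N\<close> they are the closed
  points of a scheme of finite type over the complex numbers; openness, irreducibility and
  dimension of locally closed subschemes can be read off from them.\<close>

definition brauer_loop_scheme :: "nat \<Rightarrow> complex mat set" where
  "brauer_loop_scheme N =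
    {M \<in> carrier_mat N N. brauer_prod N M M = 0\<^sub>m N N \<and> (\<forall>i<N. M $$ (i, i) = 0)}"

text \<open>Only the values of \<open>\<pi>\<close> on \<open>{..<N}\<close> matter.\<close>

definition link_pattern :: "nat \<Rightarrow> (nat \<Rightarrow> nat) \<Rightarrow> bool" where
  "link_pattern N \<pi> \<longleftrightarrow> (\<forall>i<N. \<pi> i < N \<and> \<pi> (\<pi> i) = i) \<and> card {i. i < N \<and> \<pi> i = i} = N mod 2"

definition link_pattern_locus :: "nat \<Rightarrow> (nat \<Rightarrow> nat) \<Rightarrow> complex mat set" where
  "link_pattern_locus N \<pi> = {M \<in> brauer_loop_scheme N.
     \<forall>i<N. \<forall>j<N. (M * M) $$ (i, i) = (M * M) $$ (j, j) \<longleftrightarrow> j \<in> {i, \<pi> i}}"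

end

theory Submission
  imports Defs "HOL-Computational_Algebra.Polynomial" "Jordan_Normal_Form.Determinant"
begin

text \<open>A matrix with zero diagonal is unrolled to a strictly upper triangular array \<open>x\<close> over \<open>\<int>\<close> with
  period \<open>N\<close>, whose entries at distance at least \<open>N\<close> from the diagonal are irrelevant. Then \<open>M \<bullet> M = 0\<close>
  says that \<open>x\<^sup>2\<close> starts at distance \<open>N\<close>, and the diagonal of \<open>M\<^sup>2\<close> is its leading part. Conjugation by
  unipotent arrays removes the entries of \<open>x\<close> between indices with different diagonal values. On a class of
  indices with the same nonzero value \<open>c\<close> the square of \<open>x\<close> then has leading part \<open>c\<close>, and comparing the
  orders of vanishing of determinants shows that the class has even size.

  In the locus of \<open>\<pi>\<close> the classes are the chords of \<open>\<pi>\<close>, so each point is conjugate to an array \<open>m\<close>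
  supported on the chords. This parametrizes the locus by an open subset of an affine space, whence
  irreducibility. For the dimension, let the conjugating array \<open>1 + u\<close> run only over a linear complement
  of the centralizer of \<open>m\<close>: this leaves \<open>\<lfloor>N\<^sup>2 / 2\<rfloor>\<close> parameters and still a dense image, and
  polynomials in \<open>d\<close> variables admit at most \<open>d\<close> algebraically independent ones, which bounds chains of
  irreducible closed sets. Conversely, at \<open>u = 0\<close> the derivative of this map is injective, so that the
  closures of the images of coordinate subspaces form a chain of the required length.\<close>

section \<open>Polynomial functions in indexed variables\<close>

text \<open>For \<open>i \<noteq> k\<close> the indices between \<open>i\<close> and
  \<open>k\<close> in cyclic order are those from \<open>i\<close> to the next copy of
  \<open>k\<close> on the unrolled circle. So the equations of the scheme and the diagonal of the
  ordinary square are entries of one product of arrays, at distance below \<open>N\<close> and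
  exactly \<open>N\<close>. Two precisions are kept apart: a matrix determines its array modulo
  distance \<open>N\<close>, but since the diagonal vanishes it determines the square modulo
  distance \<open>N + 1\<close>. The square starts at distance \<open>N\<close>, so unipotent
  conjugation leaves its entries there unchanged. The full parametrization has \<open>N * N\<close>
  parameters and large fibres. Instead of a theorem on dimensions of fibres, an explicit slice is
  used. The involution \<open>mirror\<close> of index pairs exchanges the matrix entries chosen as
  coordinates with the remaining ones, except the diagonal entry at the fixed point of
  \<open>\<pi>\<close>; this yields one coordinate for every two entries. The same slice serves both
  bounds: its image is dense, and in these coordinates the derivative at a chord array is
  invertible.\<close>

inductive polynomial_in :: "'i set \<Rightarrow> (('i \<Rightarrow> complex) \<Rightarrow> complex) \<Rightarrow> bool" for I where
  const: "polynomial_in I (\<lambda>x. c)"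
| var: "i \<in> I \<Longrightarrow> polynomial_in I (\<lambda>x. x i)"
| add: "polynomial_in I f \<Longrightarrow> polynomial_in I g \<Longrightarrow> polynomial_in I (\<lambda>x. f x + g x)"
| mult: "polynomial_in I f \<Longrightarrow> polynomial_in I g \<Longrightarrow> polynomial_in I (\<lambda>x. f x * g x)"

lemma polynomial_in_sum:
  "(\<And>a. a \<in> A \<Longrightarrow> polynomial_in I (f a)) \<Longrightarrow> polynomial_in I (\<lambda>x. \<Sum>a\<in>A. f a x)"
  by (induction A rule: infinite_finite_induct) (auto intro: polynomial_in.intros)

lemma polynomial_in_prod:
  "(\<And>a. a \<in> A \<Longrightarrow> polynomial_in I (f a)) \<Longrightarrow> polynomial_in I (\<lambda>x. \<Prod>a\<in>A. f a x)"
  by (induction A rule: infinite_finite_induct) (auto intro: polynomial_in.intros)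

lemma polynomial_in_power:
  "polynomial_in I f \<Longrightarrow> polynomial_in I (\<lambda>x. f x ^ n)"
  by (induction n) (auto intro: polynomial_in.intros)

lemma polynomial_in_uminus:
  "polynomial_in I f \<Longrightarrow> polynomial_in I (\<lambda>x. - f x)"
  using polynomial_in.mult[OF polynomial_in.const[of I "-1"]] by simp

lemma polynomial_in_diff:
  "polynomial_in I f \<Longrightarrow> polynomial_in I g \<Longrightarrow> polynomial_in I (\<lambda>x. f x - g x)"
  using polynomial_in.add[OF _ polynomial_in_uminus[of I g], of f] by simp

lemma polynomial_in_compose:
  assumes "polynomial_in I f" "\<And>i. i \<in> I \<Longrightarrow> polynomial_in J (\<lambda>y. g y i)"
  shows "polynomial_in J (\<lambda>y. f (g y))"
  using assms(1) by induction (auto intro: polynomial_in.intros assms(2))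

lemma polynomial_in_cong:
  assumes "polynomial_in I f" "\<And>i. i \<in> I \<Longrightarrow> x i = y i"
  shows "f x = f y"
  using assms(1) by induction (auto simp: assms(2))

lemma polynomial_in_tendsto:
  assumes "polynomial_in I f" "\<And>i. i \<in> I \<Longrightarrow> ((\<lambda>t. z t i) \<longlongrightarrow> y i) F"
  shows "((\<lambda>t. f (z t)) \<longlongrightarrow> f y) F"
  using assms(1) by induction (auto intro: tendsto_intros assms(2))

text \<open>Special cases: the
  expansion with respect to one variable, the expansion into homogeneous parts, restriction to a
  line.\<close>

lemma polynomial_in_substitute:
  assumes f: "polynomial_in I f"
    and G: "\<And>i k. i \<in> I \<Longrightarrow> polynomial_in K (\<lambda>y. coeff (G i y) k)"
    and deg: "\<And>i y. i \<in> I \<Longrightarrow> degree (G i y) \<le> d"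
  obtains Q n where "\<And>k. polynomial_in K (\<lambda>y. coeff (Q y) k)" "\<And>y. degree (Q y) \<le> n"
    "\<And>y t. f (\<lambda>i. poly (G i y) t) = poly (Q y) t"
proof -
  have "\<exists>Q n. (\<forall>k. polynomial_in K (\<lambda>y. coeff (Q y) k)) \<and> (\<forall>y. degree (Q y) \<le> n) \<and>
    (\<forall>y t. f (\<lambda>i. poly (G i y) t) = poly (Q y) t)"
    using f
  proof induction
    case (const c)
    show ?case
      by (intro exI[of _ "\<lambda>y. [:c:]"] exI[of _ 0]) (auto simp: coeff_pCons split: nat.split intro: polynomial_in.const)
  next
    case (var i)
    with G deg show ?case by (intro exI[of _ "G i"] exI[of _ d]) auto
  next
    case (add f g)
    then obtain Q n R m where Q: "\<forall>k. polynomial_in K (\<lambda>y. coeff (Q y) k)" "\<forall>y. degree (Q y) \<le> n"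
        "\<forall>y t. f (\<lambda>i. poly (G i y) t) = poly (Q y) t"
      and R: "\<forall>k. polynomial_in K (\<lambda>y. coeff (R y) k)" "\<forall>y. degree (R y) \<le> m"
        "\<forall>y t. g (\<lambda>i. poly (G i y) t) = poly (R y) t"
      by blast
    show ?case
    proof (intro exI[of _ "\<lambda>y. Q y + R y"] exI[of _ "max n m"] conjI allI)
      fix y show "degree (Q y + R y) \<le> max n m"
        using Q(2) R(2) by (meson degree_add_le max.cobounded1 max.cobounded2 order.trans)
    qed (use Q R in \<open>auto intro: polynomial_in.add\<close>)
  next
    case (mult f g)
    then obtain Q n R m where Q: "\<forall>k. polynomial_in K (\<lambda>y. coeff (Q y) k)" "\<forall>y. degree (Q y) \<le> n"
        "\<forall>y t. f (\<lambda>i. poly (G i y) t) = poly (Q y) t"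
      and R: "\<forall>k. polynomial_in K (\<lambda>y. coeff (R y) k)" "\<forall>y. degree (R y) \<le> m"
        "\<forall>y t. g (\<lambda>i. poly (G i y) t) = poly (R y) t"
      by blast
    show ?case
    proof (intro exI[of _ "\<lambda>y. Q y * R y"] exI[of _ "n + m"] conjI allI)
      fix y show "degree (Q y * R y) \<le> n + m"
        using Q(2) R(2) by (meson add_mono degree_mult_le order.trans)
    next
      fix k show "polynomial_in K (\<lambda>y. coeff (Q y * R y) k)"
        unfolding coeff_mult using Q(1) R(1) by (intro polynomial_in_sum polynomial_in.mult) auto
    qed (use Q R in auto)
  qed
  then show ?thesis using that by blast
qed

lemma poly_eq_sum_atMost:
  fixes p :: "'a :: comm_semiring_1 poly"
  assumes "degree p \<le> n"
  shows "poly p t = (\<Sum>j\<le>n. coeff p j * t ^ j)"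
  unfolding poly_altdef by (rule sum.mono_neutral_left) (use assms in \<open>auto simp: coeff_eq_0\<close>)

lemma polynomial_in_coeff_linear:
  assumes "polynomial_in K a" "polynomial_in K b"
  shows "polynomial_in K (\<lambda>y. coeff [:a y, b y:] k)"
proof (cases k)
  case (Suc j)
  then show ?thesis using assms by (cases j) (auto intro: polynomial_in.const)
qed (use assms in simp)

text \<open>On the line through a point where \<open>f\<close> is non-zero and a point where
  \<open>g\<close> is non-zero, both become polynomials in one variable, whose product is zero only
  if one of them is.\<close>

lemma polynomial_in_no_zero_divisors:
  assumes f: "polynomial_in I f" and g: "polynomial_in I g" and fg: "\<And>x. f x * g x = 0"
  shows "(\<forall>x. f x = 0) \<or> (\<forall>x. g x = 0)"
proof (rule ccontr)
  assume "\<not> ?thesis"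
  then obtain x y where xy: "f x \<noteq> 0" "g y \<noteq> 0" by blast
  have line: "\<exists>P. \<forall>t. h (\<lambda>i. poly [:x i, y i - x i:] t) = poly P t" if "polynomial_in I h" for h
  proof (rule polynomial_in_substitute[OF that, of I "\<lambda>i z. [:x i, y i - x i:]" 1])
    show "polynomial_in I (\<lambda>z. coeff [:x i, y i - x i:] k)" for i k
      by (intro polynomial_in.const)
  qed (auto intro!: exI)
  obtain P Q where P: "\<And>t. f (\<lambda>i. poly [:x i, y i - x i:] t) = poly P t"
    and Q: "\<And>t. g (\<lambda>i. poly [:x i, y i - x i:] t) = poly Q t"
    using line[OF f] line[OF g] by blast
  have "poly (P * Q) t = 0" for t by (simp add: P[symmetric] Q[symmetric] fg del: poly_pCons)
  then have "P * Q = 0" using poly_all_0_iff_0 by blast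
  moreover have "poly P 0 = f x" "poly Q 1 = g y"
    using P[of 0] Q[of 1] by simp_all
  ultimately show False using xy by auto
qed

text \<open>A polynomial that vanishes along enough curves through one point, namely one for each tangent
  direction, is zero: look at its homogeneous part of lowest degree.\<close>

lemma polynomial_in_zero_of_curves:
  assumes f: "polynomial_in I f"
    and curves: "\<And>y. \<exists>\<gamma>. (\<forall>i\<in>I. \<gamma> 0 i = c i \<and> ((\<lambda>t. \<gamma> t i) has_field_derivative y i) (at 0)) \<and>
      (\<forall>\<^sub>F t in at (0::complex). f (\<gamma> t) = 0)"
  shows "f x = 0"
proof (rule ccontr)
  assume fx: "f x \<noteq> 0"
  obtain Q n where Q: "\<And>k. polynomial_in I (\<lambda>y. coeff (Q y) k)" "\<And>y. degree (Q y) \<le> n"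
    "\<And>y t. f (\<lambda>i. poly [:c i, y i:] t) = poly (Q y) t"
  proof (rule polynomial_in_substitute[OF f, of I "\<lambda>i y. [:c i, y i:]" 1])
    fix i k assume "i \<in> I"
    then show "polynomial_in I (\<lambda>y. coeff [:c i, y i:] k)"
      by (intro polynomial_in_coeff_linear polynomial_in.intros)
  qed auto
  have "poly (Q (\<lambda>i. x i - c i)) 1 = f x" using Q(3)[of "\<lambda>i. x i - c i" 1] by simp
  then have "Q (\<lambda>i. x i - c i) \<noteq> 0" using fx by force
  then have ex: "\<exists>k y. coeff (Q y) k \<noteq> 0" by (metis leading_coeff_0_iff)
  \<comment> \<open>The lowest degree in which the expansion of \<open>f\<close> around
    \<open>c\<close> has a non-zero homogeneous part.\<close>
  define k where "k = (LEAST k. \<exists>y. coeff (Q y) k \<noteq> 0)"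
  obtain y where y: "coeff (Q y) k \<noteq> 0" unfolding k_def using LeastI_ex[OF ex] by blast
  have low: "coeff (Q z) j = 0" if "j < k" for j z
    using not_less_Least[of j "\<lambda>k. \<exists>y. coeff (Q y) k \<noteq> 0"] that unfolding k_def by blast
  obtain \<gamma> where \<gamma>: "\<And>i. i \<in> I \<Longrightarrow> \<gamma> 0 i = c i"
      "\<And>i. i \<in> I \<Longrightarrow> ((\<lambda>t. \<gamma> t i) has_field_derivative y i) (at 0)"
      "\<forall>\<^sub>F t in at (0::complex). f (\<gamma> t) = 0" using curves[of y] by blast
  \<comment> \<open>\<open>\<gamma> t\<close> lies on the line through \<open>c\<close> in the
    direction \<open>z t\<close>, which tends to \<open>y\<close>. So the expansion along lines
    applies to the curve.\<close>
  define z where "z = (\<lambda>t i. (\<gamma> t i - c i) / t)"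
  have z: "((\<lambda>t. z t i) \<longlongrightarrow> y i) (at 0)" if "i \<in> I" for i
    using \<gamma>(2)[OF that] unfolding has_field_derivative_iff z_def by (simp add: \<gamma>(1)[OF that])
  have Qk: "((\<lambda>t. coeff (Q (z t)) j) \<longlongrightarrow> coeff (Q y) j) (at 0)" for j
    by (rule polynomial_in_tendsto[OF Q(1)]) (use z in auto)
  \<comment> \<open>The value of \<open>f\<close> on the curve divided by \<open>t ^ k\<close>; only
    the part of degree \<open>k\<close> survives in the limit.\<close>
  let ?S = "\<lambda>t. \<Sum>j\<in>{k..n}. coeff (Q (z t)) j * t ^ (j - k)"
  have "(?S \<longlongrightarrow> (\<Sum>j\<in>{k..n}. coeff (Q y) j * 0 ^ (j - k))) (at 0)"
    by (intro tendsto_intros Qk)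
  moreover have "(\<Sum>j\<in>{k..n}. coeff (Q y) j * 0 ^ (j - k)) = coeff (Q y) k"
  proof -
    have "k \<le> n" using y Q(2)[of y] by (meson le_degree order.trans)
    then have "(\<Sum>j\<in>{k..n}. coeff (Q y) j * 0 ^ (j - k)) = (\<Sum>j\<in>{k}. coeff (Q y) j * 0 ^ (j - k))"
      by (intro sum.mono_neutral_right) auto
    then show ?thesis by simp
  qed
  moreover have ne: "\<forall>\<^sub>F t in at (0::complex). t \<noteq> 0" by (simp add: eventually_at_filter)
  have "\<forall>\<^sub>F t in at 0. ?S t = 0"
    using \<gamma>(3) ne
  proof (eventually_elim)
    fix t :: complex assume 1: "f (\<gamma> t) = 0" and t: "t \<noteq> 0"
    have "f (\<lambda>i. poly [:c i, z t i:] t) = f (\<gamma> t)"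
      by (rule polynomial_in_cong[OF f]) (use t in \<open>simp add: z_def\<close>)
    then have "0 = poly (Q (z t)) t" using 1 Q(3) by simp
    also have "\<dots> = (\<Sum>j\<le>n. coeff (Q (z t)) j * t ^ j)"
      by (rule poly_eq_sum_atMost) (rule Q(2))
    also have "\<dots> = (\<Sum>j\<in>{k..n}. coeff (Q (z t)) j * t ^ j)"
      by (rule sum.mono_neutral_right) (auto simp: low not_le)
    also have "\<dots> = t ^ k * ?S t"
      by (auto simp: sum_distrib_left power_add[symmetric] intro!: sum.cong)
    finally show "?S t = 0" using t by simp
  qed
  ultimately have "((\<lambda>t. 0) \<longlongrightarrow> coeff (Q y) k) (at (0::complex))"
    using tendsto_cong by force
  then show False using y by (simp add: tendsto_const_iff)
qed

section \<open>Algebraic dependence of polynomials\<close>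

text \<open>Elimination by induction on the equations: an equation with a non-zero coefficient at
  \<open>x0\<close> is solved for that unknown, which leaves one equation and one unknown
  fewer.\<close>

lemma underdetermined_system_nontrivial_solution:
  fixes A :: "'e \<Rightarrow> 'x \<Rightarrow> 'a :: field"
  assumes "finite E" "finite X" "card E < card X"
  shows "\<exists>c. (\<exists>x\<in>X. c x \<noteq> 0) \<and> (\<forall>e\<in>E. (\<Sum>x\<in>X. c x * A e x) = 0)"
  using assms
proof (induction E arbitrary: X A rule: finite_induct)
  case empty
  then obtain x where "x \<in> X" by (metis card.empty card_gt_0_iff ex_in_conv)
  then show ?case by (intro exI[of _ "\<lambda>_. 1"]) auto
next
  case (insert e E)
  show ?case
  proof (cases "\<forall>x\<in>X. A e x = 0")
    case True
    with insert.IH[of X A] insert.prems insert.hyps show ?thesis by auto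
  next
    case False
    then obtain x0 where x0: "x0 \<in> X" "A e x0 \<noteq> 0" by blast
    let ?X = "X - {x0}"
    have "card E < card ?X" using insert x0 by simp
    with insert.IH[of ?X "\<lambda>e' x. A e' x - A e' x0 * A e x / A e x0"] insert.prems
    obtain c where c: "\<exists>x\<in>?X. c x \<noteq> 0"
      "\<And>e'. e' \<in> E \<Longrightarrow> (\<Sum>x\<in>?X. c x * (A e' x - A e' x0 * A e x / A e x0)) = 0" by auto
    define s where "s = (\<Sum>x\<in>?X. c x * A e x)"
    let ?c = "c(x0 := - s / A e x0)"
    have sum: "(\<Sum>x\<in>X. ?c x * A e' x) = - s / A e x0 * A e' x0 + (\<Sum>x\<in>?X. c x * A e' x)" for e'
      using x0 insert.prems by (simp add: sum.remove[of X x0])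
    have "(\<Sum>x\<in>X. ?c x * A e' x) = 0" if "e' \<in> E" for e'
    proof -
      have "(\<Sum>x\<in>?X. c x * A e' x) - A e' x0 / A e x0 * s = 0"
        using c(2)[OF that] unfolding s_def
        by (simp add: sum_subtractf sum_distrib_left algebra_simps)
      then show ?thesis unfolding sum by (simp add: algebra_simps)
    qed
    moreover have "(\<Sum>x\<in>X. ?c x * A e x) = 0" unfolding sum using x0 s_def by simp
    moreover have "\<exists>x\<in>X. ?c x \<noteq> 0" using c(1) by auto
    ultimately show ?thesis by (intro exI[of _ ?c]) blast
  qed
qed

text \<open>The bound is on the exponent of each single variable, so that monomials are indexed by a
  product set and counted by a power.\<close>

inductive degree_bounded :: "'i set \<Rightarrow> nat \<Rightarrow> (('i \<Rightarrow> complex) \<Rightarrow> complex) \<Rightarrow> bool" for I m where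
  monomial: "(\<And>i. i \<in> I \<Longrightarrow> e i \<le> m) \<Longrightarrow> degree_bounded I m (\<lambda>x. c * (\<Prod>i\<in>I. x i ^ e i))"
| add: "degree_bounded I m f \<Longrightarrow> degree_bounded I m g \<Longrightarrow> degree_bounded I m (\<lambda>x. f x + g x)"

lemma degree_bounded_mono:
  assumes "degree_bounded I m f" "m \<le> n"
  shows "degree_bounded I n f"
  using assms(1) by induction (auto intro!: degree_bounded.intros intro: order.trans[OF _ assms(2)])

lemma degree_bounded_const: "degree_bounded I m (\<lambda>x. c)"
  using degree_bounded.monomial[of I "\<lambda>_. 0" m c] by simp

lemma degree_bounded_mult:
  assumes "degree_bounded I m f" "degree_bounded I n g"
  shows "degree_bounded I (m + n) (\<lambda>x. f x * g x)"
  using assms(1)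
proof induction
  case (monomial e c)
  show ?case using assms(2)
  proof induction
    case (monomial e' c')
    have "(\<lambda>x. c * (\<Prod>i\<in>I. x i ^ e i) * (c' * (\<Prod>i\<in>I. x i ^ e' i))) =
        (\<lambda>x. (c * c') * (\<Prod>i\<in>I. x i ^ (e i + e' i)))"
      by (simp add: power_add prod.distrib algebra_simps)
    moreover have "degree_bounded I (m + n) (\<lambda>x. (c * c') * (\<Prod>i\<in>I. x i ^ (e i + e' i)))"
      using monomial \<open>\<And>i. i \<in> I \<Longrightarrow> e i \<le> m\<close> by (intro degree_bounded.monomial add_mono)
    ultimately show ?case by simp
  qed (auto simp: distrib_left intro: degree_bounded.add)
qed (auto simp: distrib_right intro: degree_bounded.add)

lemma degree_bounded_power:
  assumes "degree_bounded I m f"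
  shows "degree_bounded I (k * m) (\<lambda>x. f x ^ k)"
  by (induction k) (auto intro: degree_bounded_const degree_bounded_mult[OF assms])

lemma degree_bounded_prod:
  assumes "finite J" "\<And>j. j \<in> J \<Longrightarrow> degree_bounded I (m j) (f j)"
  shows "degree_bounded I (\<Sum>j\<in>J. m j) (\<lambda>x. \<Prod>j\<in>J. f j x)"
  using assms by (induction J) (auto intro: degree_bounded_const degree_bounded_mult)

lemma polynomial_in_imp_degree_bounded:
  assumes "polynomial_in I f" "finite I"
  shows "\<exists>m. degree_bounded I m f"
  using assms(1)
proof induction
  case (const c)
  then show ?case using degree_bounded_const by blast
next
  case (var i)
  have "(\<Prod>k\<in>I. x k ^ (if k = i then 1 else 0)) = (\<Prod>k\<in>I. if k = i then x k else 1)"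
    for x :: "'a \<Rightarrow> complex" by (rule prod.cong) auto
  then have "(\<lambda>x. x i :: complex) = (\<lambda>x. 1 * (\<Prod>k\<in>I. x k ^ (if k = i then 1 else 0)))"
    using var assms(2) by simp
  moreover have "degree_bounded I 1 (\<lambda>x. 1 * (\<Prod>k\<in>I. x k ^ (if k = i then 1 else 0)))"
    by (rule degree_bounded.monomial) simp
  ultimately show ?case by metis
next
  case (add f g)
  then obtain m n where "degree_bounded I m f" "degree_bounded I n g" by blast
  then have "degree_bounded I (max m n) f" "degree_bounded I (max m n) g"
    by (auto intro: degree_bounded_mono)
  then show ?case using degree_bounded.add by blast
next
  case (mult f g)
  then show ?case using degree_bounded_mult by blast
qed

lemma degree_bounded_coefficients:
  assumes "degree_bounded I m f" "finite I"
  shows "\<exists>c. \<forall>x. f x = (\<Sum>e\<in>PiE I (\<lambda>_. {..m}). c e * (\<Prod>i\<in>I. x i ^ e i))"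
  using assms(1)
proof induction
  case (monomial e c)
  let ?e = "restrict e I" and ?E = "PiE I (\<lambda>_. {..m})"
  have "?e \<in> ?E" using monomial by auto
  moreover have "finite ?E" using assms(2) by (intro finite_PiE) auto
  moreover have "(\<Prod>i\<in>I. x i ^ ?e i) = (\<Prod>i\<in>I. x i ^ e i)" for x :: "'a \<Rightarrow> complex"
    by (rule prod.cong) auto
  ultimately have "c * (\<Prod>i\<in>I. x i ^ e i) =
      (\<Sum>e\<in>?E. (if e = ?e then c else 0) * (\<Prod>i\<in>I. x i ^ e i))" for x
    by (simp add: if_distrib[of "\<lambda>z. z * _"] sum.delta cong: if_cong)
  then show ?case by (intro exI[of _ "\<lambda>e. if e = ?e then c else 0"] allI)
next
  case (add f g)
  then obtain c d where
    "\<forall>x. f x = (\<Sum>e\<in>PiE I (\<lambda>_. {..m}). c e * (\<Prod>i\<in>I. x i ^ e i))"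
    "\<forall>x. g x = (\<Sum>e\<in>PiE I (\<lambda>_. {..m}). d e * (\<Prod>i\<in>I. x i ^ e i))" by blast
  then show ?case
    by (intro exI[of _ "\<lambda>e. c e + d e"]) (simp add: sum.distrib distrib_right)
qed

text \<open>Induction on the variables: for fixed values of the others the sum is a polynomial in
  \<open>y j\<close> that vanishes everywhere, so its coefficients \<open>q k y\<close> are
  zero.\<close>

lemma monomials_linearly_independent:
  assumes "finite J" "\<And>y. (\<Sum>e\<in>PiE J (\<lambda>_. {..D}). c e * (\<Prod>j\<in>J. y j ^ e j)) = (0 :: complex)"
    "e \<in> PiE J (\<lambda>_. {..D})"
  shows "c e = 0"
  using assms
proof (induction J arbitrary: c e rule: finite_induct)
  case empty
  then show ?case by simp
next
  case (insert j J)
  let ?E = "PiE J (\<lambda>_. {..D})"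
  define q where "q k y = (\<Sum>e\<in>?E. c (e(j := k)) * (\<Prod>i\<in>J. y i ^ e i))" for k and y :: "'a \<Rightarrow> complex"
  have expand: "(\<Sum>e\<in>PiE (insert j J) (\<lambda>_. {..D}). c e * (\<Prod>i\<in>insert j J. y i ^ e i)) =
      (\<Sum>k\<le>D. q k y * y j ^ k)" for y
  proof -
    have "(\<Sum>e\<in>PiE (insert j J) (\<lambda>_. {..D}). c e * (\<Prod>i\<in>insert j J. y i ^ e i)) =
      (\<Sum>(k, e)\<in>{..D} \<times> ?E. c (e(j := k)) * (\<Prod>i\<in>insert j J. y i ^ (e(j := k)) i))"
      unfolding PiE_insert_eq
      by (subst sum.reindex[OF inj_combinator[OF insert.hyps(2)]]) (simp add: case_prod_unfold)
    also have "\<dots> = (\<Sum>k\<le>D. \<Sum>e\<in>?E. c (e(j := k)) * (\<Prod>i\<in>insert j J. y i ^ (e(j := k)) i))"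
      by (simp add: sum.cartesian_product)
    also have "\<dots> = (\<Sum>k\<le>D. q k y * y j ^ k)"
      unfolding q_def sum_distrib_right
    proof (intro sum.cong refl)
      fix k e
      have "(\<Prod>i\<in>J. y i ^ (e(j := k)) i) = (\<Prod>i\<in>J. y i ^ e i)"
        using insert.hyps by (intro prod.cong) auto
      then show "c (e(j := k)) * (\<Prod>i\<in>insert j J. y i ^ (e(j := k)) i) =
          c (e(j := k)) * (\<Prod>i\<in>J. y i ^ e i) * y j ^ k"
        using insert.hyps by simp
    qed
    finally show ?thesis .
  qed
  have q: "q k y = 0" if "k \<le> D" for k y
  proof -
    let ?p = "\<Sum>k\<le>D. monom (q k y) k"
    have "poly ?p t = 0" for t
    proof -
      have "q k (y(j := t)) = q k y" for k
        unfolding q_def using insert.hyps by (intro sum.cong refl arg_cong2[of _ _ _ _ "(*)"] prod.cong) auto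
      then show ?thesis
        using expand[of "y(j := t)"] insert.prems(1)[of "y(j := t)"] by (simp add: poly_sum poly_monom)
    qed
    then have "?p = 0" using poly_all_0_iff_0 by blast
    then have "coeff ?p k = 0" by simp
    then show ?thesis using that by (simp add: coeff_sum)
  qed
  obtain k e' where e: "e = e'(j := k)" "k \<le> D" "e' \<in> ?E"
    using insert.prems(2) unfolding PiE_insert_eq by auto
  have "c (e'(j := k)) = 0"
    by (rule insert.IH[of "\<lambda>e. c (e(j := k))"]) (use q[OF e(2)] e in \<open>simp_all add: q_def\<close>)
  then show ?case unfolding e(1) .
qed

text \<open>A count of monomials. Those in the \<open>f j\<close> with exponents up to
  \<open>D\<close> number \<open>Suc D ^ card J\<close>, yet all lie in a span whose dimension grows
  only like \<open>D ^ card I\<close>. For large \<open>D\<close> there is a linear relation, whose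
  coefficients form \<open>P\<close>.\<close>

lemma algebraically_dependent:
  assumes fin: "finite I" "finite J" and card: "card I < card J"
    and f: "\<And>j. j \<in> J \<Longrightarrow> polynomial_in I (f j)"
  shows "\<exists>P. polynomial_in J P \<and> (\<exists>y. P y \<noteq> 0) \<and> (\<forall>x. P (\<lambda>j. f j x) = 0)"
proof -
  have "\<exists>m. \<forall>j\<in>J. degree_bounded I (m j) (f j)"
    using polynomial_in_imp_degree_bounded[OF f fin(1)] by metis
  then obtain m' where m': "\<And>j. j \<in> J \<Longrightarrow> degree_bounded I (m' j) (f j)" by blast
  define m where "m = (\<Sum>j\<in>J. m' j)"
  have m: "degree_bounded I m (f j)" if "j \<in> J" for j
    using m'[OF that] by (rule degree_bounded_mono) (use that fin in \<open>auto simp: m_def intro: member_le_sum\<close>)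
  \<comment> \<open>\<open>M\<close> is chosen so that the exponents of the variables stay below
    \<open>M * Suc D\<close>, and \<open>D\<close> so that the resulting factor
    \<open>M ^ card I\<close> is absorbed by one more power of \<open>Suc D\<close>.\<close>
  define M where "M = Suc (card J * m)"
  define D where "D = M ^ card I"
  let ?E = "PiE J (\<lambda>_. {..D})" and ?F = "PiE I (\<lambda>_. {..card J * (D * m)})"
  have bd: "degree_bounded I (card J * (D * m)) (\<lambda>x. \<Prod>j\<in>J. f j x ^ e j)" if "e \<in> ?E" for e
  proof (rule degree_bounded_mono)
    show "degree_bounded I (\<Sum>j\<in>J. e j * m) (\<lambda>x. \<Prod>j\<in>J. f j x ^ e j)"
      using fin m by (intro degree_bounded_prod degree_bounded_power)
    show "(\<Sum>j\<in>J. e j * m) \<le> card J * (D * m)"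
      using sum_bounded_above[of J "\<lambda>j. e j * m" "D * m"] that by (auto simp: PiE_iff)
  qed
  have "\<forall>e\<in>?E. \<exists>c. \<forall>x. (\<Prod>j\<in>J. f j x ^ e j) = (\<Sum>e'\<in>?F. c e' * (\<Prod>i\<in>I. x i ^ e' i))"
    by (intro ballI degree_bounded_coefficients bd fin(1))
  from bchoice[OF this] obtain A where A: "\<And>e x. e \<in> ?E \<Longrightarrow>
      (\<Prod>j\<in>J. f j x ^ e j) = (\<Sum>e'\<in>?F. A e e' * (\<Prod>i\<in>I. x i ^ e' i))"
    by (elim exE) (rule that, simp)
  have "card ?F < card ?E"
  proof -
    have "card ?F = Suc (card J * (D * m)) ^ card I" using fin by (simp add: card_PiE)
    also have "\<dots> \<le> (M * Suc D) ^ card I"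
      by (intro power_mono) (auto simp: M_def algebra_simps)
    also have "\<dots> = D * Suc D ^ card I" unfolding power_mult_distrib D_def[symmetric] ..
    also have "\<dots> < Suc D ^ Suc (card I)" by simp
    also have "\<dots> \<le> Suc D ^ card J" using card by (intro power_increasing) auto
    also have "\<dots> = card ?E" using fin by (simp add: card_PiE)
    finally show ?thesis .
  qed
  then obtain c where c: "\<exists>e\<in>?E. c e \<noteq> 0" "\<forall>e'\<in>?F. (\<Sum>e\<in>?E. c e * A e e') = 0"
    using underdetermined_system_nontrivial_solution[of ?F ?E "\<lambda>e' e. A e e'"] fin
    by (auto intro!: finite_PiE)
  define P where "P y = (\<Sum>e\<in>?E. c e * (\<Prod>j\<in>J. y j ^ e j))" for y
  have "polynomial_in J P"
    unfolding P_def
    by (intro polynomial_in_sum polynomial_in.mult polynomial_in.const polynomial_in_prod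
        polynomial_in_power polynomial_in.var)
  moreover have "\<exists>y. P y \<noteq> 0"
    using monomials_linearly_independent[OF fin(2), where D = D and c = c] c(1) unfolding P_def by blast
  moreover have "P (\<lambda>j. f j x) = 0" for x
  proof -
    have "P (\<lambda>j. f j x) = (\<Sum>e\<in>?E. \<Sum>e'\<in>?F. c e * A e e' * (\<Prod>i\<in>I. x i ^ e' i))"
      unfolding P_def by (simp add: A sum_distrib_left mult.assoc)
    also have "\<dots> = (\<Sum>e'\<in>?F. (\<Sum>e\<in>?E. c e * A e e') * (\<Prod>i\<in>I. x i ^ e' i))"
      by (subst sum.swap) (simp add: sum_distrib_right)
    also have "\<dots> = 0" using c(2) by simp
    finally show ?thesis .
  qed
  ultimately show ?thesis by blast
qed

section \<open>Irreducibility and dimension via polynomial functions\<close>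

lemma poly_fun_compose_polynomial_in:
  assumes "polynomial_in J P" "\<And>j. j \<in> J \<Longrightarrow> poly_fun N (f j)"
  shows "poly_fun N (\<lambda>M. P (\<lambda>j. f j M))"
  using assms(1) by induction (auto intro: poly_fun.intros assms(2))

lemma polynomial_in_compose_poly_fun:
  assumes "poly_fun N f" "\<And>i j. i < N \<Longrightarrow> j < N \<Longrightarrow> polynomial_in I (\<lambda>x. \<phi> x $$ (i, j))"
  shows "polynomial_in I (\<lambda>x. f (\<phi> x))"
  using assms(1) by induction (auto intro: polynomial_in.intros assms(2))

lemma poly_fun_sum: "(\<And>a. a \<in> A \<Longrightarrow> poly_fun N (f a)) \<Longrightarrow> poly_fun N (\<lambda>x. \<Sum>a\<in>A. f a x)"
  by (induction A rule: infinite_finite_induct) (auto intro: poly_fun.intros)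

lemma poly_fun_power: "poly_fun N f \<Longrightarrow> poly_fun N (\<lambda>x. f x ^ n)"
  by (induction n) (auto intro: poly_fun.intros)

text \<open>Irreducibility in terms of functions. Since functions can be pulled back, this form
  passes directly to images of polynomial maps.\<close>

definition zariski_irreducible :: "nat \<Rightarrow> complex mat set \<Rightarrow> bool" where
  "zariski_irreducible N S \<longleftrightarrow> S \<noteq> {} \<and> (\<forall>f g. poly_fun N f \<longrightarrow> poly_fun N g \<longrightarrow>
     (\<forall>M\<in>S. f M * g M = 0) \<longrightarrow> (\<forall>M\<in>S. f M = 0) \<or> (\<forall>M\<in>S. g M = 0))"

lemma zariski_irreducibleD:
  "zariski_irreducible N S \<Longrightarrow> poly_fun N f \<Longrightarrow> poly_fun N g \<Longrightarrow> (\<And>M. M \<in> S \<Longrightarrow> f M * g M = 0) \<Longrightarrow>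
    (\<forall>M\<in>S. f M = 0) \<or> (\<forall>M\<in>S. g M = 0)"
  unfolding zariski_irreducible_def by blast

lemma topspace_subtopology_zariski:
  "S \<subseteq> carrier_mat N N \<Longrightarrow> topspace (subtopology (zariski N) S) = S"
  by (auto simp: topspace_zariski)

lemma irreducible_space_zariski_iff:
  assumes S: "S \<subseteq> carrier_mat N N"
  shows "irreducible_space (subtopology (zariski N) S) \<longleftrightarrow> zariski_irreducible N S"
proof
  assume irr: "irreducible_space (subtopology (zariski N) S)"
  show "zariski_irreducible N S"
    unfolding zariski_irreducible_def
  proof (intro conjI allI impI)
    show "S \<noteq> {}" using irr unfolding irreducible_space_def topspace_subtopology_zariski[OF S] by simp
    fix f g assume fg: "poly_fun N f" "poly_fun N g" "\<forall>M\<in>S. f M * g M = 0"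
    let ?A = "\<lambda>f. zero_locus N {f} \<inter> S"
    have cl: "closedin (subtopology (zariski N) S) (?A h)" if "poly_fun N h" for h
      unfolding closedin_subtopology closedin_zariski
      by (intro exI[of _ "zero_locus N {h}"] conjI exI[of _ "{h}"]) (use that in auto)
    have "S = ?A f \<union> ?A g" using fg(3) S by (auto simp: zero_locus_def)
    have "\<And>A B. closedin (subtopology (zariski N) S) A \<Longrightarrow>
        closedin (subtopology (zariski N) S) B \<Longrightarrow> S = A \<union> B \<Longrightarrow> A = S \<or> B = S"
      using irr unfolding irreducible_space_def topspace_subtopology_zariski[OF S] by simp
    from this[OF cl[OF fg(1)] cl[OF fg(2)]] \<open>S = ?A f \<union> ?A g\<close> have "?A f = S \<or> ?A g = S" .
    then show "(\<forall>M\<in>S. f M = 0) \<or> (\<forall>M\<in>S. g M = 0)" by (auto simp: zero_locus_def)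
  qed
next
  assume irr: "zariski_irreducible N S"
  show "irreducible_space (subtopology (zariski N) S)"
    unfolding irreducible_space_def topspace_subtopology_zariski[OF S]
  proof (intro conjI allI impI; (elim conjE)?)
    show "S \<noteq> {}" using irr by (auto simp: zariski_irreducible_def)
    fix A B assume A: "closedin (subtopology (zariski N) S) A"
      and B: "closedin (subtopology (zariski N) S) B" and AB: "S = A \<union> B"
    obtain F where F: "\<forall>f\<in>F. poly_fun N f" "A = zero_locus N F \<inter> S"
      using A unfolding closedin_subtopology closedin_zariski by auto
    obtain G where G: "\<forall>f\<in>G. poly_fun N f" "B = zero_locus N G \<inter> S"
      using B unfolding closedin_subtopology closedin_zariski by auto
    show "A = S \<or> B = S"
    proof (rule ccontr)
      assume "\<not> ?thesis"
      then obtain M1 M2 where M: "M1 \<in> S" "M1 \<notin> A" "M2 \<in> S" "M2 \<notin> B" using AB by blast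
      \<comment> \<open>A closed set that misses a point lies in the zero set of a single function
        that is non-zero there.\<close>
      obtain f where f: "f \<in> F" "f M1 \<noteq> 0" using M F(2) S by (auto simp: zero_locus_def)
      obtain g where g: "g \<in> G" "g M2 \<noteq> 0" using M G(2) S by (auto simp: zero_locus_def)
      have "f M * g M = 0" if "M \<in> S" for M
      proof -
        have "M \<in> zero_locus N F \<or> M \<in> zero_locus N G" using that AB F(2) G(2) by blast
        then show ?thesis using f(1) g(1) by (auto simp: zero_locus_def)
      qed
      then have "(\<forall>M\<in>S. f M = 0) \<or> (\<forall>M\<in>S. g M = 0)"
        using f(1) g(1) F(1) G(1) by (intro zariski_irreducibleD[OF irr]) auto
      then show False using f(2) g(2) M by blast
    qed
  qed
qed

lemma zariski_irreducible_image:
  assumes \<phi>: "\<And>i j. i < N \<Longrightarrow> j < N \<Longrightarrow> polynomial_in I (\<lambda>x. \<phi> x $$ (i, j))"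
    and h: "polynomial_in I h" "h x0 \<noteq> 0"
  shows "zariski_irreducible N (\<phi> ` {x. h x \<noteq> 0})"
  unfolding zariski_irreducible_def
proof (intro conjI allI impI)
  show "\<phi> ` {x. h x \<noteq> 0} \<noteq> {}" using h by auto
  fix f g assume f: "poly_fun N f" and g: "poly_fun N g" and fg: "\<forall>M\<in>\<phi> ` {x. h x \<noteq> 0}. f M * g M = 0"
  have pf: "polynomial_in I (\<lambda>x. f (\<phi> x))" and pg: "polynomial_in I (\<lambda>x. g (\<phi> x))"
    using f g \<phi> by (auto intro: polynomial_in_compose_poly_fun)
  \<comment> \<open>The factor \<open>h\<close> makes the product vanish outside the open set as
    well, where \<open>f\<close> and \<open>g\<close> are not controlled.\<close>
  have "(h x * f (\<phi> x)) * g (\<phi> x) = 0" for x using fg by auto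
  then have "(\<forall>x. h x * f (\<phi> x) = 0) \<or> (\<forall>x. g (\<phi> x) = 0)"
    by (rule polynomial_in_no_zero_divisors[OF polynomial_in.mult[OF h(1) pf] pg])
  then show "(\<forall>M\<in>\<phi> ` {x. h x \<noteq> 0}. f M = 0) \<or> (\<forall>M\<in>\<phi> ` {x. h x \<noteq> 0}. g M = 0)" by auto
qed

definition algebraically_independent_on ::
    "'j set \<Rightarrow> ('j \<Rightarrow> complex mat \<Rightarrow> complex) \<Rightarrow> complex mat set \<Rightarrow> bool" where
  "algebraically_independent_on J f Z \<longleftrightarrow>
     (\<forall>P. polynomial_in J P \<longrightarrow> (\<forall>M\<in>Z. P (\<lambda>j. f j M) = 0) \<longrightarrow> (\<forall>y. P y = 0))"

text \<open>A polynomial relation between the old functions and \<open>g\<close> on \<open>Z'\<close> can be divided by a power of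
  \<open>g\<close> until its part free of \<open>g\<close> is nonzero; restricted to \<open>Z\<close> it would relate the old functions.\<close>

lemma algebraically_independent_on_extend:
  assumes indep: "algebraically_independent_on J f Z" and f: "\<And>i. i \<in> J \<Longrightarrow> poly_fun N (f i)"
    and sub: "Z \<subseteq> Z'" and irr: "zariski_irreducible N Z'"
    and g: "poly_fun N g" "\<And>M. M \<in> Z \<Longrightarrow> g M = 0" "M0 \<in> Z'" "g M0 \<noteq> 0" and j: "j \<notin> J"
  shows "algebraically_independent_on (insert j J) (f(j := g)) Z'"
  unfolding algebraically_independent_on_def
proof (intro allI impI, rule ccontr)
  fix P y0
  assume P: "polynomial_in (insert j J) P" and zero: "\<forall>M\<in>Z'. P (\<lambda>i. (f(j := g)) i M) = 0"
    and y0: "P y0 \<noteq> 0"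
  let ?G = "\<lambda>i (y :: 'a \<Rightarrow> complex). if i = j then [:0, 1:] else [:y i, 0:]"
  obtain Q n where Q: "\<And>k. polynomial_in J (\<lambda>y. coeff (Q y) k)" "\<And>y. degree (Q y) \<le> n"
    "\<And>y t. P (\<lambda>i. poly (?G i y) t) = poly (Q y) t"
  proof (rule polynomial_in_substitute[OF P, of J ?G 1])
    fix i k assume i: "i \<in> insert j J"
    show "polynomial_in J (\<lambda>y. coeff (?G i y) k)"
    proof (cases "i = j")
      case False
      then have "polynomial_in J (\<lambda>y. coeff [:y i, 0:] k)"
        using i by (intro polynomial_in_coeff_linear polynomial_in.intros) auto
      with False show ?thesis by simp
    qed (simp add: polynomial_in.const)
  qed auto
  have PQ: "P (\<lambda>i. if i = j then t else y i) = poly (Q y) t" for y t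
  proof -
    have "(\<lambda>i. poly (?G i y) t) = (\<lambda>i. if i = j then t else y i)" by auto
    then show ?thesis using Q(3)[of y t] by simp
  qed
  have "Q y0 \<noteq> 0"
  proof
    assume "Q y0 = 0"
    moreover have "(\<lambda>i. if i = j then y0 j else y0 i) = y0" by auto
    ultimately show False using PQ[of "y0 j" y0] y0 by simp
  qed
  then have ex: "\<exists>k y. coeff (Q y) k \<noteq> 0" by (metis leading_coeff_0_iff)
  define k where "k = (LEAST k. \<exists>y. coeff (Q y) k \<noteq> 0)"
  obtain y1 where y1: "coeff (Q y1) k \<noteq> 0" unfolding k_def using LeastI_ex[OF ex] by blast
  have low: "coeff (Q z) i = 0" if "i < k" for i z
    using not_less_Least[of i "\<lambda>k. \<exists>y. coeff (Q y) k \<noteq> 0"] that unfolding k_def by blast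
  define R where "R M = (\<Sum>i\<in>{k..n}. coeff (Q (\<lambda>j. f j M)) i * g M ^ (i - k))" for M
  have coeff: "poly_fun N (\<lambda>M. coeff (Q (\<lambda>j. f j M)) i)" for i
    by (rule poly_fun_compose_polynomial_in[OF Q(1)]) (rule f)
  have R: "poly_fun N R"
    unfolding R_def by (intro poly_fun_sum poly_fun.mult coeff poly_fun_power g(1))
  have "g M ^ k * R M = 0" if "M \<in> Z'" for M
  proof -
    have "(\<lambda>i. (f(j := g)) i M) = (\<lambda>i. if i = j then g M else f i M)" by auto
    then have "0 = poly (Q (\<lambda>j. f j M)) (g M)"
      using zero that PQ[of "g M" "\<lambda>j. f j M"] by auto
    also have "\<dots> = (\<Sum>i\<le>n. coeff (Q (\<lambda>j. f j M)) i * g M ^ i)"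
      by (rule poly_eq_sum_atMost) (rule Q(2))
    also have "\<dots> = (\<Sum>i\<in>{k..n}. coeff (Q (\<lambda>j. f j M)) i * g M ^ i)"
      by (rule sum.mono_neutral_right) (auto simp: low not_le)
    also have "\<dots> = g M ^ k * R M"
      unfolding R_def by (auto simp: sum_distrib_left power_add[symmetric] intro!: sum.cong)
    finally show ?thesis by simp
  qed
  \<comment> \<open>Irreducibility of \<open>Z'\<close> cancels the factor
    \<open>g M ^ k\<close>.\<close>
  then have "(\<forall>M\<in>Z'. g M ^ k = 0) \<or> (\<forall>M\<in>Z'. R M = 0)"
    by (rule zariski_irreducibleD[OF irr poly_fun_power[OF g(1)] R])
  moreover have "\<not> (\<forall>M\<in>Z'. g M ^ k = 0)" using g(3,4) by auto
  ultimately have R0: "R M = 0" if "M \<in> Z'" for M using that by blast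
  have "coeff (Q (\<lambda>j. f j M)) k = 0" if "M \<in> Z" for M
  proof -
    have "R M = (\<Sum>i\<in>{k..n}. if i = k then coeff (Q (\<lambda>j. f j M)) i else 0)"
      unfolding R_def using g(2)[OF that] by (intro sum.cong) auto
    also have "\<dots> = coeff (Q (\<lambda>j. f j M)) k"
      using y1 Q(2)[of y1] le_degree[OF y1] by simp
    finally show ?thesis using R0 sub that by auto
  qed
  then have "coeff (Q y1) k = 0"
    using indep Q(1)[of k] unfolding algebraically_independent_on_def by blast
  then show False using y1 by simp
qed

text \<open>Each step of a chain supplies a function that vanishes on the smaller set but not on the
  larger one. Adding it to those already found preserves algebraic independence, so a chain of
  length \<open>n\<close> yields \<open>n\<close> independent functions on \<open>S\<close>.\<close>

lemma krull_dim_zariski_le: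
  assumes S: "S \<subseteq> carrier_mat N N"
    and bound: "\<And>k f. (\<And>i. i < k \<Longrightarrow> poly_fun N (f i)) \<Longrightarrow>
      algebraically_independent_on {..<k :: nat} f S \<Longrightarrow> k \<le> d"
  shows "krull_dim (subtopology (zariski N) S) \<le> enat d"
  unfolding krull_dim_def
proof (rule Sup_least, clarify)
  fix n and Z :: "nat \<Rightarrow> complex mat set"
  assume Z: "\<forall>i\<le>n. closedin (subtopology (zariski N) S) (Z i) \<and>
      irreducible_space (subtopology (subtopology (zariski N) S) (Z i))"
    and strict: "\<forall>i<n. Z i \<subset> Z (Suc i)"
  have ZS: "Z i \<subseteq> S" if "i \<le> n" for i
    using Z that closedin_subset[of "subtopology (zariski N) S" "Z i"]
    by (simp add: topspace_subtopology_zariski[OF S])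
  have irr: "zariski_irreducible N (Z i)" if "i \<le> n" for i
  proof -
    have "S \<inter> Z i = Z i" using ZS[OF that] by blast
    moreover have "Z i \<subseteq> carrier_mat N N" using ZS[OF that] S by (rule order.trans)
    moreover have "irreducible_space (subtopology (subtopology (zariski N) S) (Z i))"
      using Z that by blast
    ultimately show ?thesis by (simp add: subtopology_subtopology irreducible_space_zariski_iff)
  qed
  have "\<exists>f. (\<forall>i<k. poly_fun N (f i)) \<and> algebraically_independent_on {..<k} f (Z k)" if "k \<le> n" for k
    using that
  proof (induction k)
    case 0
    obtain M where "M \<in> Z 0" using irr[of 0] unfolding zariski_irreducible_def by auto
    have "algebraically_independent_on ({} :: nat set) (\<lambda>_ _. 0) (Z 0)"
      unfolding algebraically_independent_on_def
    proof (intro allI impI)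
      fix P :: "(nat \<Rightarrow> complex) \<Rightarrow> complex" and y
      assume P: "polynomial_in {} P" and "\<forall>M\<in>Z 0. P (\<lambda>j. 0) = 0"
      with \<open>M \<in> Z 0\<close> have "P (\<lambda>j. 0) = 0" by blast
      then show "P y = 0" using polynomial_in_cong[OF P, of y "\<lambda>j. 0"] by simp
    qed
    then show ?case by auto
  next
    case (Suc k)
    then obtain f where f: "\<forall>i<k. poly_fun N (f i)" "algebraically_independent_on {..<k} f (Z k)"
      by auto
    have "closedin (subtopology (zariski N) S) (Z k)" using Z Suc.prems by simp
    then obtain F where F: "\<forall>f\<in>F. poly_fun N f" "Z k = zero_locus N F \<inter> S"
      unfolding closedin_subtopology closedin_zariski by auto
    have lt: "Z k \<subset> Z (Suc k)" using strict Suc.prems by simp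
    then obtain M where M: "M \<in> Z (Suc k)" "M \<notin> Z k" by blast
    then obtain g where g: "g \<in> F" "g M \<noteq> 0"
      using F(2) ZS[OF Suc.prems] S by (auto simp: zero_locus_def)
    have "algebraically_independent_on (insert k {..<k}) (f(k := g)) (Z (Suc k))"
      by (rule algebraically_independent_on_extend[OF f(2), of N _ _ M])
        (use f lt irr[OF Suc.prems] F g M in \<open>auto simp: zero_locus_def\<close>)
    moreover have "\<forall>i<Suc k. poly_fun N ((f(k := g)) i)" using f(1) F(1) g(1) by (auto simp: less_Suc_eq)
    ultimately show ?case unfolding lessThan_Suc by blast
  qed
  from this[of n] obtain f where f: "\<And>i. i < n \<Longrightarrow> poly_fun N (f i)"
    "algebraically_independent_on {..<n} f (Z n)" by auto
  then have "algebraically_independent_on {..<n} f S"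
    using ZS[of n] unfolding algebraically_independent_on_def by blast
  then show "enat n \<le> enat d" using bound f(1) by auto
qed

text \<open>The chain consists of the Zariski closures of the \<open>Y k\<close>.\<close>

lemma krull_dim_zariski_ge:
  assumes S: "S \<subseteq> carrier_mat N N"
    and Y: "\<And>k. k \<le> d \<Longrightarrow> Y k \<subseteq> S" "\<And>k. k \<le> d \<Longrightarrow> zariski_irreducible N (Y k)"
      "\<And>k. k < d \<Longrightarrow> Y k \<subseteq> Y (Suc k)"
    and strict: "\<And>k. k < d \<Longrightarrow> \<exists>h. poly_fun N h \<and> (\<forall>M\<in>Y k. h M = 0) \<and> (\<exists>M\<in>Y (Suc k). h M \<noteq> 0)"
  shows "enat d \<le> krull_dim (subtopology (zariski N) S)"
  unfolding krull_dim_def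
proof (rule Sup_upper, intro CollectI exI conjI allI impI)
  show "enat d = enat d" ..
  define I where "I k = {f. poly_fun N f \<and> (\<forall>M\<in>Y k. f M = 0)}" for k
  let ?Z = "\<lambda>k. zero_locus N (I k) \<inter> S"
  have YZ: "Y k \<subseteq> ?Z k" if "k \<le> d" for k
    using Y(1)[OF that] S by (auto simp: zero_locus_def I_def)
  show "closedin (subtopology (zariski N) S) (?Z k)" for k
    unfolding closedin_subtopology closedin_zariski
    by (intro exI[of _ "zero_locus N (I k)"] conjI exI[of _ "I k"]) (auto simp: I_def)
  {
    fix k assume k: "k \<le> d"
    have "zariski_irreducible N (?Z k)"
      unfolding zariski_irreducible_def
    proof (intro conjI allI impI)
      show "?Z k \<noteq> {}" using YZ[OF k] Y(2)[OF k] by (auto simp: zariski_irreducible_def)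
      fix f g assume fg: "poly_fun N f" "poly_fun N g" "\<forall>M\<in>?Z k. f M * g M = 0"
      have "(\<forall>M\<in>Y k. f M = 0) \<or> (\<forall>M\<in>Y k. g M = 0)"
        by (rule zariski_irreducibleD[OF Y(2)[OF k] fg(1,2)]) (use YZ[OF k] fg(3) in blast)
      then have "f \<in> I k \<or> g \<in> I k" using fg(1,2) by (auto simp: I_def)
      then show "(\<forall>M\<in>?Z k. f M = 0) \<or> (\<forall>M\<in>?Z k. g M = 0)" by (auto simp: zero_locus_def)
    qed
    moreover have "S \<inter> ?Z k = ?Z k" by blast
    moreover have "?Z k \<subseteq> carrier_mat N N" using S by blast
    ultimately show "irreducible_space (subtopology (subtopology (zariski N) S) (?Z k))"
      by (simp add: subtopology_subtopology irreducible_space_zariski_iff)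
  }
  fix k assume k: "k < d"
  obtain h M where h: "h \<in> I k" "M \<in> Y (Suc k)" "h M \<noteq> 0" using strict[OF k] by (auto simp: I_def)
  have "I (Suc k) \<subseteq> I k" using Y(3)[OF k] by (auto simp: I_def)
  then have "?Z k \<subseteq> ?Z (Suc k)" by (auto simp: zero_locus_def)
  moreover have "M \<in> ?Z (Suc k)" using YZ[of "Suc k"] k h(2) by auto
  moreover have "M \<notin> ?Z k" using h by (auto simp: zero_locus_def)
  ultimately show "?Z k \<subset> ?Z (Suc k)" by blast
qed

section \<open>Upper triangular arrays over the integers\<close>

text \<open>Upper triangularity makes the sums in the product finite, so that these infinite arrays
  form a ring. Periodicity is left to a predicate, as the type cannot depend on
  \<open>N\<close>.\<close>

typedef incidence = "{f :: int \<Rightarrow> int \<Rightarrow> complex. \<forall>i j. j < i \<longrightarrow> f i j = 0}"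
  morphisms entry Abs_incidence
  by (intro exI[of _ "\<lambda>_ _. 0"]) simp

setup_lifting type_definition_incidence

lemma incidence_assoc_aux:
  fixes f g h :: "int \<Rightarrow> int \<Rightarrow> complex"
  assumes "\<forall>i j. j < i \<longrightarrow> f i j = 0" "\<forall>i j. j < i \<longrightarrow> g i j = 0" "\<forall>i j. j < i \<longrightarrow> h i j = 0"
  shows "(\<Sum>k\<in>{i..l}. (\<Sum>j\<in>{i..k}. f i j * g j k) * h k l) =
    (\<Sum>j\<in>{i..l}. f i j * (\<Sum>k\<in>{j..l}. g j k * h k l))"
proof -
  have "(\<Sum>k\<in>{i..l}. (\<Sum>j\<in>{i..k}. f i j * g j k) * h k l) =
      (\<Sum>k\<in>{i..l}. (\<Sum>j\<in>{i..l}. f i j * g j k) * h k l)"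
    by (intro sum.cong refl arg_cong2[of _ _ _ _ "(*)"] sum.mono_neutral_left) (use assms in auto)
  also have "\<dots> = (\<Sum>j\<in>{i..l}. \<Sum>k\<in>{i..l}. f i j * g j k * h k l)"
    unfolding sum_distrib_right by (rule sum.swap)
  also have "\<dots> = (\<Sum>j\<in>{i..l}. f i j * (\<Sum>k\<in>{i..l}. g j k * h k l))"
    by (simp add: sum_distrib_left mult.assoc)
  also have "\<dots> = (\<Sum>j\<in>{i..l}. f i j * (\<Sum>k\<in>{j..l}. g j k * h k l))"
    by (intro sum.cong refl arg_cong2[of _ _ _ _ "(*)"] sum.mono_neutral_right) (use assms in auto)
  finally show ?thesis .
qed

instantiation incidence :: ring_1
begin

lift_definition zero_incidence :: incidence is "\<lambda>_ _. 0" by simp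
lift_definition one_incidence :: incidence is "\<lambda>i j. if i = j then 1 else 0" by simp
lift_definition plus_incidence :: "incidence \<Rightarrow> incidence \<Rightarrow> incidence" is "\<lambda>f g i j. f i j + g i j" by simp
lift_definition minus_incidence :: "incidence \<Rightarrow> incidence \<Rightarrow> incidence" is "\<lambda>f g i j. f i j - g i j" by simp
lift_definition uminus_incidence :: "incidence \<Rightarrow> incidence" is "\<lambda>f i j. - f i j" by simp
lift_definition times_incidence :: "incidence \<Rightarrow> incidence \<Rightarrow> incidence" is
  "\<lambda>f g i k. \<Sum>j\<in>{i..k}. f i j * g j k" by simp

instance
proof
  fix a b c :: incidence
  show "a * b * c = a * (b * c)"
    by transfer (intro ext incidence_assoc_aux)
  show "a + b + c = a + (b + c)" "a + b = b + a" "0 + a = a" "- a + a = 0" "a - b = a + - b"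
    by (transfer; auto simp: algebra_simps)+
  show "(a + b) * c = a * c + b * c" "a * (b + c) = a * b + a * c"
    by (transfer; simp add: algebra_simps sum.distrib)+
  have delta: "(\<Sum>j\<in>{i..k}. (if i = j then 1 else 0) * f j) = f i" if "i \<le> k"
    for i k :: int and f :: "int \<Rightarrow> complex"
    using that by (simp add: if_distrib[of "\<lambda>z. z * _"] cong: if_cong)
  have delta': "(\<Sum>j\<in>{i..k}. f j * (if j = k then 1 else 0)) = f k" if "i \<le> k"
    for i k :: int and f :: "int \<Rightarrow> complex"
    using that by (simp add: if_distrib[of "\<lambda>z. _ * z"] cong: if_cong)
  show "1 * a = a"
  proof (transfer, intro ext)
    fix a :: "int \<Rightarrow> int \<Rightarrow> complex" and i k
    assume "\<forall>i j. j < i \<longrightarrow> a i j = 0"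
    then show "(\<Sum>j\<in>{i..k}. (if i = j then 1 else 0) * a j k) = a i k"
      by (cases "i \<le> k") (auto simp: delta)
  qed
  show "a * 1 = a"
  proof (transfer, intro ext)
    fix a :: "int \<Rightarrow> int \<Rightarrow> complex" and i k
    assume "\<forall>i j. j < i \<longrightarrow> a i j = 0"
    then show "(\<Sum>j\<in>{i..k}. a i j * (if j = k then 1 else 0)) = a i k"
      by (cases "i \<le> k") (auto simp: delta')
  qed
  show "(0 :: incidence) \<noteq> 1"
    by transfer (auto simp: fun_eq_iff)
qed

end

lemma entry_0 [simp]: "entry 0 i j = 0" by transfer simp
lemma entry_1: "entry 1 i j = (if i = j then 1 else 0)" by transfer simp
lemma entry_add [simp]: "entry (x + y) i j = entry x i j + entry y i j" by transfer simp
lemma entry_diff [simp]: "entry (x - y) i j = entry x i j - entry y i j" by transfer simp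
lemma entry_uminus [simp]: "entry (- x) i j = - entry x i j" by transfer simp
lemma entry_mult: "entry (x * y) i k = (\<Sum>j\<in>{i..k}. entry x i j * entry y j k)" by transfer simp
lemma entry_lower: "j < i \<Longrightarrow> entry x i j = 0" by transfer simp
lemma entry_sum: "entry (\<Sum>a\<in>A. f a) i j = (\<Sum>a\<in>A. entry (f a) i j)"
  by (induction A rule: infinite_finite_induct) auto
lemma incidence_eqI: "(\<And>i j. entry x i j = entry y i j) \<Longrightarrow> x = y"
  by (simp add: entry_inject[symmetric] fun_eq_iff)

lemma entry_Abs: "(\<And>i j. j < i \<Longrightarrow> f i j = 0) \<Longrightarrow> entry (Abs_incidence f) = f"
  by (rule Abs_incidence_inverse) simp

section \<open>The filtration by distance from the diagonal\<close>

definition vanishes_below :: "int \<Rightarrow> incidence \<Rightarrow> bool" where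
  "vanishes_below n x \<longleftrightarrow> (\<forall>i j. j < i + n \<longrightarrow> entry x i j = 0)"

lemma vanishes_belowD: "vanishes_below n x \<Longrightarrow> j < i + n \<Longrightarrow> entry x i j = 0"
  by (simp add: vanishes_below_def)

lemma vanishes_below_0: "vanishes_below n 0"
  by (simp add: vanishes_below_def)

lemma vanishes_below_nonpos: "n \<le> 0 \<Longrightarrow> vanishes_below n x"
  by (auto simp: vanishes_below_def intro: entry_lower)

lemma vanishes_below_mono: "vanishes_below n x \<Longrightarrow> m \<le> n \<Longrightarrow> vanishes_below m x"
  by (auto simp: vanishes_below_def)

lemma vanishes_below_add: "vanishes_below n x \<Longrightarrow> vanishes_below n y \<Longrightarrow> vanishes_below n (x + y)"
  by (auto simp: vanishes_below_def)

lemma vanishes_below_diff: "vanishes_below n x \<Longrightarrow> vanishes_below n y \<Longrightarrow> vanishes_below n (x - y)"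
  by (auto simp: vanishes_below_def)

lemma vanishes_below_uminus: "vanishes_below n x \<Longrightarrow> vanishes_below n (- x)"
  by (auto simp: vanishes_below_def)

lemma vanishes_below_mult:
  assumes "vanishes_below a x" "vanishes_below b y"
  shows "vanishes_below (a + b) (x * y)"
  unfolding vanishes_below_def entry_mult
proof (intro allI impI sum.neutral ballI)
  fix i k j assume "k < i + (a + b)"
  then show "entry x i j * entry y j k = 0"
    using vanishes_belowD[OF assms(1), of j i] vanishes_belowD[OF assms(2), of k j]
    by (cases "j < i + a") auto
qed

lemma vanishes_below_mult_left: "vanishes_below n x \<Longrightarrow> vanishes_below n (x * y)"
  using vanishes_below_mult[of n x 0 y] by (simp add: vanishes_below_nonpos)

lemma vanishes_below_mult_right: "vanishes_below n y \<Longrightarrow> vanishes_below n (x * y)"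
  using vanishes_below_mult[of 0 x n y] by (simp add: vanishes_below_nonpos)

lemma vanishes_below_conjugate: "vanishes_below n x \<Longrightarrow> vanishes_below n (g * x * h)"
  by (intro vanishes_below_mult_left vanishes_below_mult_right)

lemma vanishes_below_power: "vanishes_below 1 x \<Longrightarrow> vanishes_below (int n) (x ^ n)"
proof (induction n)
  case (Suc n)
  then show ?case using vanishes_below_mult[of 1 x "int n" "x ^ n"] by simp
qed (simp add: vanishes_below_nonpos)

text \<open>Only the middle index \<open>i + a\<close> can contribute: before it the entry of
  \<open>x\<close> vanishes, after it that of \<open>y\<close>.\<close>

lemma entry_mult_leading:
  assumes "vanishes_below a x" "vanishes_below b y" "0 \<le> a" "0 \<le> b"
  shows "entry (x * y) i (i + a + b) = entry x i (i + a) * entry y (i + a) (i + a + b)"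
proof -
  have "(\<Sum>j\<in>{i..i + a + b}. entry x i j * entry y j (i + a + b)) =
      (\<Sum>j\<in>{i + a}. entry x i j * entry y j (i + a + b))"
  proof (rule sum.mono_neutral_right)
    show "\<forall>j\<in>{i..i + a + b} - {i + a}. entry x i j * entry y j (i + a + b) = 0"
    proof
      fix j assume "j \<in> {i..i + a + b} - {i + a}"
      then show "entry x i j * entry y j (i + a + b) = 0"
        using vanishes_belowD[OF assms(1), of j i] vanishes_belowD[OF assms(2), of "i + a + b" j]
        by (cases "j < i + a") auto
    qed
  qed (use assms in auto)
  then show ?thesis by (simp add: entry_mult)
qed

section \<open>Periodic arrays\<close>

definition periodic :: "nat \<Rightarrow> incidence \<Rightarrow> bool" where
  "periodic N x \<longleftrightarrow> (\<forall>i j. entry x (i + int N) (j + int N) = entry x i j)"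

lemma periodicD: "periodic N x \<Longrightarrow> entry x (i + int N) (j + int N) = entry x i j"
  by (simp add: periodic_def)

lemma periodic_0: "periodic N 0" and periodic_1: "periodic N 1"
  by (auto simp: periodic_def entry_1)

lemma periodic_add: "periodic N x \<Longrightarrow> periodic N y \<Longrightarrow> periodic N (x + y)"
  and periodic_diff: "periodic N x \<Longrightarrow> periodic N y \<Longrightarrow> periodic N (x - y)"
  and periodic_uminus: "periodic N x \<Longrightarrow> periodic N (- x)"
  by (auto simp: periodic_def)

lemma periodic_mult:
  assumes "periodic N x" "periodic N y"
  shows "periodic N (x * y)"
  unfolding periodic_def entry_mult
proof (intro allI)
  fix i k
  have "(\<Sum>j\<in>{i + int N..k + int N}. entry x (i + int N) j * entry y j (k + int N)) =
      (\<Sum>j\<in>{i..k}. entry x (i + int N) (j + int N) * entry y (j + int N) (k + int N))"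
    by (rule sum.reindex_bij_witness[of _ "\<lambda>j. j + int N" "\<lambda>j. j - int N"]) auto
  then show "(\<Sum>j\<in>{i + int N..k + int N}. entry x (i + int N) j * entry y j (k + int N)) =
      (\<Sum>j\<in>{i..k}. entry x i j * entry y j k)"
    by (simp add: periodicD[OF assms(1)] periodicD[OF assms(2)])
qed

lemma periodic_power: "periodic N x \<Longrightarrow> periodic N (x ^ n)"
  by (induction n) (auto intro: periodic_1 periodic_mult)

lemma periodic_sum: "(\<And>a. a \<in> A \<Longrightarrow> periodic N (f a)) \<Longrightarrow> periodic N (\<Sum>a\<in>A. f a)"
  by (induction A rule: infinite_finite_induct) (auto intro: periodic_0 periodic_add)

lemma entry_shift:
  assumes "periodic N x"
  shows "entry x (i + q * int N) (j + q * int N) = entry x i j"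
proof -
  have nat: "entry x (i + int n * int N) (j + int n * int N) = entry x i j" for n i j
  proof (induction n)
    case (Suc n)
    then show ?case
      using periodicD[OF assms, of "i + int n * int N" "j + int n * int N"] by (simp add: algebra_simps)
  qed simp
  show ?thesis
  proof (cases "q \<ge> 0")
    case True
    then show ?thesis using nat[of i "nat q" j] by simp
  next
    case False
    then show ?thesis
      using nat[of "i + q * int N" "nat (- q)" "j + q * int N"] by simp
  qed
qed

section \<open>Inverses of unipotent arrays\<close>

lemma geometric_sum_left:
  fixes x :: "'a :: ring_1"
  shows "(1 - x) * (\<Sum>m<n. x ^ m) = 1 - x ^ n"
proof (induction n)
  case (Suc n)
  have "(1 - x) * (\<Sum>m<Suc n. x ^ m) = (1 - x) * (\<Sum>m<n. x ^ m) + (1 - x) * x ^ n"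
    by (simp add: distrib_left)
  then show ?case unfolding Suc by (simp add: left_diff_distrib)
qed simp

lemma geometric_sum_right:
  fixes x :: "'a :: ring_1"
  shows "(\<Sum>m<n. x ^ m) * (1 - x) = 1 - x ^ n"
proof (induction n)
  case (Suc n)
  have "(\<Sum>m<Suc n. x ^ m) * (1 - x) = (\<Sum>m<n. x ^ m) * (1 - x) + x ^ n * (1 - x)"
    by (simp add: distrib_right)
  then show ?case unfolding Suc by (simp add: right_diff_distrib power_commutes)
qed simp

lemma incidence_eqI_vanishes:
  assumes "\<And>n. vanishes_below (int n) (x - y)"
  shows "x = y"
proof (rule incidence_eqI)
  fix i j
  have "entry (x - y) i j = 0"
    by (rule vanishes_belowD[OF assms[of "Suc (nat (j - i))"]]) auto
  then show "entry x i j = entry y i j" by simp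
qed

text \<open>The Neumann series in \<open>- u\<close> is a finite sum at each entry: powers with
  exponent above \<open>j - i\<close> do not reach \<open>(i, j)\<close>.\<close>

lemma unipotent_inverse:
  assumes u: "vanishes_below 1 u"
  obtains h where "(1 + u) * h = 1" "h * (1 + u) = 1" "periodic N u \<Longrightarrow> periodic N h"
    "\<And>n. vanishes_below (int n) (h - (\<Sum>m<n. (- u) ^ m))"
proof -
  let ?S = "\<lambda>n. \<Sum>m<n. (- u) ^ m"
  have u': "vanishes_below (int m) ((- u) ^ m)" for m
    using u by (intro vanishes_below_power vanishes_below_uminus)
  define h where "h = Abs_incidence (\<lambda>i j. entry (?S (Suc (nat (j - i)))) i j)"
  have h: "entry h i j = entry (?S (Suc (nat (j - i)))) i j" for i j
    unfolding h_def by (subst entry_Abs) (auto intro: entry_lower)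
  have S: "vanishes_below (int n) (h - ?S n)" for n
    unfolding vanishes_below_def
  proof (intro allI impI)
    fix i j assume "j < i + int n"
    then have "{..<Suc (nat (j - i))} \<subseteq> {..<n} \<or> n = 0" by auto
    moreover have "entry h i j = 0" if "n = 0"
      using \<open>j < i + int n\<close> that by (simp add: entry_lower)
    moreover have "(\<Sum>m<Suc (nat (j - i)). entry ((- u) ^ m) i j) = (\<Sum>m<n. entry ((- u) ^ m) i j)"
      if "{..<Suc (nat (j - i))} \<subseteq> {..<n}"
      using that by (intro sum.mono_neutral_left) (auto intro!: vanishes_belowD[OF u'])
    ultimately show "entry (h - ?S n) i j = 0" by (auto simp: h entry_sum simp del: sum.lessThan_Suc)
  qed
  have S1: "(1 + u) * ?S n = 1 - (- u) ^ n" "?S n * (1 + u) = 1 - (- u) ^ n" for n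
    using geometric_sum_left[of "- u" n] geometric_sum_right[of "- u" n] by auto
  have "(1 + u) * h = 1"
  proof (rule incidence_eqI_vanishes)
    fix n
    have "(1 + u) * h - 1 = (1 + u) * (h - ?S n) - (- u) ^ n"
      unfolding right_diff_distrib S1 by simp
    then show "vanishes_below (int n) ((1 + u) * h - 1)"
      using S u' by (simp add: vanishes_below_diff vanishes_below_mult_right)
  qed
  moreover have "h * (1 + u) = 1"
  proof (rule incidence_eqI_vanishes)
    fix n
    have "h * (1 + u) - 1 = (h - ?S n) * (1 + u) - (- u) ^ n"
      unfolding left_diff_distrib S1 by simp
    then show "vanishes_below (int n) (h * (1 + u) - 1)"
      using S u' by (simp add: vanishes_below_diff vanishes_below_mult_left)
  qed
  moreover have "periodic N h" if "periodic N u"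
    unfolding periodic_def
  proof (intro allI)
    fix i j
    have "periodic N (?S n)" for n
      using that by (intro periodic_sum periodic_power periodic_uminus)
    then show "entry h (i + int N) (j + int N) = entry h i j"
      unfolding h by (simp add: periodicD del: sum.lessThan_Suc)
  qed
  ultimately show ?thesis using that S by blast
qed

text \<open>\<open>X\<close> is conjugated one superdiagonal at a time. The entries of \<open>X\<close> start at distance \<open>N\<close> from
  the diagonal with \<open>D\<close>; conjugation by \<open>1 + w\<close>, with \<open>w\<close> at distance \<open>l\<close> from the diagonal, adds
  \<open>w i j * (D j - D i)\<close> to the entry \<open>(i, j + N)\<close> at distance \<open>N + l\<close>.\<close>

lemma decouple_diagonal_values:
  assumes X: "periodic N X" "vanishes_below (int N) X" and D: "\<And>i. D i = entry X i (i + int N)"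
  shows "\<exists>g h. g * h = 1 \<and> h * g = 1 \<and> periodic N g \<and> periodic N h \<and> vanishes_below 1 (g - 1) \<and>
    (\<forall>i. entry (g * X * h) i (i + int N) = D i) \<and>
    (\<forall>i j. j < i + int (Suc n) \<longrightarrow> D i \<noteq> D j \<longrightarrow> entry (g * X * h) i (j + int N) = 0)"
proof (induction n)
  case 0
  have "entry X i (j + int N) = 0" if "j < i + 1" "D i \<noteq> D j" for i j
  proof -
    have "j \<noteq> i" using that by auto
    then show ?thesis using that by (intro vanishes_belowD[OF X(2)]) auto
  qed
  then show ?case
    by (intro exI[of _ "1 :: incidence"]) (simp add: periodic_1 vanishes_below_0 D[symmetric])
next
  case (Suc n)
  then obtain g h where g: "g * h = 1" "h * g = 1" "periodic N g" "periodic N h" "vanishes_below 1 (g - 1)"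
    and diag: "\<And>i. entry (g * X * h) i (i + int N) = D i"
    and dec: "\<And>i j. j < i + int (Suc n) \<Longrightarrow> D i \<noteq> D j \<Longrightarrow> entry (g * X * h) i (j + int N) = 0"
    by blast
  define Y where "Y = g * X * h"
  define l where "l = int (Suc n)"
  have l: "0 < l" by (simp add: l_def)
  have Y: "periodic N Y" "vanishes_below (int N) Y"
    unfolding Y_def using X g by (auto intro: periodic_mult vanishes_below_conjugate)
  have Dper: "D (i + int N) = D i" for i
    using periodicD[OF X(1), of i "i + int N"] by (simp add: D)
  define w where "w = Abs_incidence (\<lambda>i j. if j = i + l \<and> D i \<noteq> D j then entry Y i (j + int N) / (D i - D j) else 0)"
  have w: "entry w i j = (if j = i + l \<and> D i \<noteq> D j then entry Y i (j + int N) / (D i - D j) else 0)" for i j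
    unfolding w_def by (subst entry_Abs) (use l in auto)
  have wv: "vanishes_below l w" by (auto simp: vanishes_below_def w)
  then have wv1: "vanishes_below 1 w" by (rule vanishes_below_mono) (use l in simp)
  have wp: "periodic N w"
    unfolding periodic_def
  proof (intro allI)
    fix i j
    have "(j + int N = i + int N + l) = (j = i + l)" by auto
    then show "entry w (i + int N) (j + int N) = entry w i j"
      unfolding w by (simp only: Dper periodicD[OF Y(1)])
  qed
  obtain k where k: "(1 + w) * k = 1" "k * (1 + w) = 1" "periodic N k"
    by (rule unipotent_inverse[OF wv1, where N = N]) (use wp in blast)
  define Z where "Z = (1 + w) * Y * k"
  have Z: "vanishes_below (int N) Z"
    unfolding Z_def using Y(2) by (rule vanishes_below_conjugate)
  \<comment> \<open>The conjugation is used in its intertwining form, which avoids the entries of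
    the inverse \<open>k\<close>.\<close>
  have "Z * (1 + w) = (1 + w) * Y" unfolding Z_def by (simp add: mult.assoc k(2))
  then have "Z + Z * w = Y + w * Y" by (simp add: distrib_left distrib_right)
  then have eq: "Z = Y + w * Y - Z * w" by (rule eq_diff_eq[THEN iffD2])
  have wY: "vanishes_below (l + int N) (w * Y)" "vanishes_below (int N + l) (Z * w)"
    using vanishes_below_mult[OF wv Y(2)] vanishes_below_mult[OF Z wv] by auto
  have low: "entry Z i j = entry Y i j" if "j < i + int N + l" for i j
    using vanishes_belowD[OF wY(1), of j i] vanishes_belowD[OF wY(2), of j i] that
    using arg_cong[OF eq, of "\<lambda>z. entry z i j"] by (simp add: add.assoc add.commute add.left_commute)
  have diagZ: "entry Z i (i + int N) = D i" for i
    using low[of "i + int N" i] diag[of i] l by (simp add: Y_def)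
  have decZ: "entry Z i (j + int N) = 0" if "j < i + int (Suc (Suc n))" "D i \<noteq> D j" for i j
  proof (cases "j < i + l")
    case True
    then show ?thesis using low[of "j + int N" i] dec[of j i] that by (simp add: l_def Y_def)
  next
    case False
    then have j: "j = i + l" using that by (simp add: l_def)
    have "entry (w * Y) i (i + l + int N) = entry w i (i + l) * entry Y (i + l) (i + l + int N)"
      by (rule entry_mult_leading[OF wv Y(2)]) (use l in auto)
    then have 1: "entry (w * Y) i (j + int N) = entry w i j * D j" using diag[of j] by (simp add: j Y_def)
    have "entry (Z * w) i (i + int N + l) = entry Z i (i + int N) * entry w (i + int N) (i + int N + l)"
      by (rule entry_mult_leading[OF Z wv]) (use l in auto)
    then have 2: "entry (Z * w) i (j + int N) = D i * entry w i j"
      using periodicD[OF wp, of i j] diagZ[of i] by (simp add: j algebra_simps)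
    have "entry Z i (j + int N) = entry Y i (j + int N) + entry w i j * D j - D i * entry w i j"
      using arg_cong[OF eq, of "\<lambda>z. entry z i (j + int N)"] unfolding entry_add entry_diff 1 2 .
    also have "\<dots> = entry Y i (j + int N) - entry w i j * (D i - D j)" by (simp add: algebra_simps)
    also have "\<dots> = 0" using that(2) j by (simp add: w)
    finally show ?thesis .
  qed
  have ZX: "Z = ((1 + w) * g) * X * (h * k)" unfolding Z_def Y_def by (simp add: mult.assoc)
  have "(1 + w) * g * (h * k) = (1 + w) * (g * h) * k" "h * k * ((1 + w) * g) = h * (k * (1 + w)) * g"
    by (simp_all only: mult.assoc)
  then have inv: "(1 + w) * g * (h * k) = 1" "h * k * ((1 + w) * g) = 1"
    using g(1,2) k(1,2) by simp_all
  have geq: "(1 + w) * g - 1 = (g - 1) + w * g" by (simp add: algebra_simps)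
  have uni: "vanishes_below 1 ((1 + w) * g - 1)"
    unfolding geq by (rule vanishes_below_add[OF g(5) vanishes_below_mult_left[OF wv1]])
  have per: "periodic N ((1 + w) * g)" "periodic N (h * k)"
    using g k wp by (auto intro!: periodic_mult periodic_add periodic_1)
  show ?case
    by (rule exI[of _ "(1 + w) * g"], rule exI[of _ "h * k"], unfold ZX[symmetric],
        intro conjI allI impI inv uni per diagZ decZ)
qed

text \<open>The conjugate \<open>A\<close> commutes with its square, whose leading coefficients are \<open>D\<close>, so that
  \<open>A i j * (D j - D i) = 0\<close> by induction on the distance of \<open>(i, j)\<close> from the diagonal.\<close>

lemma decouple:
  assumes x: "periodic N x" "vanishes_below (int N) (x * x)"
    and D: "\<And>i. D i = entry (x * x) i (i + int N)"
  obtains g h where "g * h = 1" "h * g = 1" "periodic N g" "periodic N h" "vanishes_below 1 (g - 1)"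
    "\<And>i. entry ((g * x * h) * (g * x * h)) i (i + int N) = D i"
    "\<And>i j. j < i + int N \<Longrightarrow> D i \<noteq> D j \<Longrightarrow> entry (g * x * h) i j = 0"
proof -
  obtain g h where g: "g * h = 1" "h * g = 1" "periodic N g" "periodic N h" "vanishes_below 1 (g - 1)"
    and diag: "\<And>i. entry (g * (x * x) * h) i (i + int N) = D i"
    and dec: "\<And>i j. j < i + int (Suc N) \<Longrightarrow> D i \<noteq> D j \<Longrightarrow> entry (g * (x * x) * h) i (j + int N) = 0"
    \<comment> \<open>An entry of \<open>A\<close> at distance below \<open>N\<close> is compared
      through products that involve \<open>X\<close> only up to distances below
      \<open>2 * N\<close>; hence \<open>N\<close> rounds.\<close>
    using decouple_diagonal_values[OF periodic_mult[OF x(1) x(1)] x(2) D, of N]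
    by blast
  define A where "A = g * x * h"
  define X where "X = g * (x * x) * h"
  have AA: "A * A = X"
  proof -
    have "A * A = g * x * (h * g) * x * h" unfolding A_def by (simp only: mult.assoc)
    then show ?thesis unfolding X_def g(2) by (simp add: mult.assoc)
  qed
  have X: "vanishes_below (int N) X" "periodic N X" and A: "periodic N A"
    unfolding X_def A_def using x g
    by (auto intro!: vanishes_below_conjugate periodic_mult)
  have Dper: "D (i + int N) = D i" for i
    using periodicD[OF periodic_mult[OF x(1) x(1)], of i "i + int N"] by (simp add: D)
  have "entry A i (i + int n) = 0" if "n < N" "D i \<noteq> D (i + int n)" for n i
    using that
  proof (induction n arbitrary: i rule: less_induct)
    case (less n)
    let ?j = "i + int n"
    have "entry (A * X) i (?j + int N) = (\<Sum>l\<in>{i..?j + int N}. entry A i l * entry X l (?j + int N))"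
      by (rule entry_mult)
    \<comment> \<open>For an index \<open>l\<close> between \<open>i\<close> and \<open>?j\<close>,
      either \<open>D l = D ?j\<close>, so \<open>D i \<noteq> D l\<close> and the entry of
      \<open>A\<close> vanishes by induction, or the entry of \<open>X\<close> is already
      decoupled.\<close>
    also have "\<dots> = (\<Sum>l\<in>{?j}. entry A i l * entry X l (?j + int N))"
    proof (rule sum.mono_neutral_right)
      show "\<forall>l\<in>{i..?j + int N} - {?j}. entry A i l * entry X l (?j + int N) = 0"
      proof
        fix l assume l: "l \<in> {i..?j + int N} - {?j}"
        show "entry A i l * entry X l (?j + int N) = 0"
        proof (cases "l < ?j")
          case False
          then have "entry X l (?j + int N) = 0" using l by (intro vanishes_belowD[OF X(1)]) auto
          then show ?thesis by simp
        next
          case True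
          show ?thesis
          proof (cases "D l = D ?j")
            case True
            then have "entry A i (i + int (nat (l - i))) = 0"
              using less.prems l \<open>l < ?j\<close> by (intro less.IH) auto
            then show ?thesis using l by simp
          next
            case False
            then have "entry X l (?j + int N) = 0"
              unfolding X_def using less.prems l by (intro dec) auto
            then show ?thesis by simp
          qed
        qed
      qed
    qed auto
    also have "\<dots> = entry A i ?j * D ?j" using diag[of ?j] by (simp add: X_def)
    finally have 1: "entry (A * X) i (?j + int N) = entry A i ?j * D ?j" .
    have "entry (X * A) i (?j + int N) = (\<Sum>l\<in>{i..?j + int N}. entry X i l * entry A l (?j + int N))"
      by (rule entry_mult)
    also have "\<dots> = (\<Sum>l\<in>{i + int N}. entry X i l * entry A l (?j + int N))"
    proof (rule sum.mono_neutral_right)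
      show "\<forall>l\<in>{i..?j + int N} - {i + int N}. entry X i l * entry A l (?j + int N) = 0"
      proof
        fix l assume l: "l \<in> {i..?j + int N} - {i + int N}"
        show "entry X i l * entry A l (?j + int N) = 0"
        proof (cases "l < i + int N")
          case True
          then show ?thesis using vanishes_belowD[OF X(1), of l i] by simp
        next
          case False
          define m where "m = l - int N"
          have lm: "l = m + int N" and m: "i < m" "m \<le> ?j" using False l by (auto simp: m_def)
          have Alm: "entry A l (?j + int N) = entry A m ?j" using periodicD[OF A, of m ?j] by (simp add: lm)
          show ?thesis
          proof (cases "D i = D m")
            case True
            then have "entry A m (m + int (nat (?j - m))) = 0"
              using m less.prems by (intro less.IH) auto
            then show ?thesis using Alm m by simp
          next
            case False
            then have "entry X i (m + int N) = 0"
              unfolding X_def using less.prems m by (intro dec) auto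
            then show ?thesis using lm by simp
          qed
        qed
      qed
    qed auto
    also have "\<dots> = D i * entry A i ?j" using diag[of i] periodicD[OF A, of i ?j] by (simp add: X_def)
    finally have 2: "entry (X * A) i (?j + int N) = D i * entry A i ?j" .
    have "A * X = X * A" unfolding AA[symmetric] by (simp add: mult.assoc)
    then have "entry A i ?j * (D ?j - D i) = 0" using 1 2 by (simp add: algebra_simps)
    then show ?case using less.prems by simp
  qed
  then have "entry A i j = 0" if "j < i + int N" "D i \<noteq> D j" for i j
  proof (cases "j < i")
    case False
    then have "entry A i (i + int (nat (j - i))) = 0"
      using that by (intro \<open>\<And>n i. n < N \<Longrightarrow> D i \<noteq> D (i + int n) \<Longrightarrow> entry A i (i + int n) = 0\<close>) auto
    then show ?thesis using False by simp
  qed (simp add: entry_lower)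
  then show ?thesis
    using diag unfolding A_def X_def by (intro that[OF g]) (auto simp: AA[unfolded A_def X_def])
qed

section \<open>The Brauer loop scheme in terms of periodic arrays\<close>

text \<open>The target is the first copy of \<open>k\<close> strictly after \<open>i\<close>. For
  \<open>i = k\<close> it is at distance \<open>N\<close>, where the diagonal of the matrix square
  is found.\<close>

definition cyc_entry :: "nat \<Rightarrow> incidence \<Rightarrow> nat \<Rightarrow> nat \<Rightarrow> complex" where
  "cyc_entry N x i k = entry x (int i) (if i < k then int k else int k + int N)"

text \<open>Strict cyclic order, where \<open>i = k\<close> means going once around the circle.\<close>

definition cyc_between :: "nat \<Rightarrow> nat \<Rightarrow> nat \<Rightarrow> bool" where
  "cyc_between i l k \<longleftrightarrow> i < l \<and> l < k \<or> l < k \<and> k \<le> i \<or> k \<le> i \<and> i < l"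

text \<open>The open interval from \<open>i\<close> to the next copy of \<open>k\<close> contains
  each residue at most once, and the end points drop out because the diagonals vanish.\<close>

lemma cyc_entry_mult:
  assumes x: "periodic N x" "vanishes_below 1 x" and y: "periodic N y" "vanishes_below 1 y"
    and ik: "i < N" "k < N"
  shows "cyc_entry N (x * y) i k =
    (\<Sum>l | l < N \<and> cyc_between i l k. cyc_entry N x i l * cyc_entry N y l k)"
proof -
  define K where "K = (if i < k then int k else int k + int N)"
  have "cyc_entry N (x * y) i k = (\<Sum>j\<in>{int i..K}. entry x (int i) j * entry y j K)"
    by (simp add: cyc_entry_def K_def entry_mult)
  also have "\<dots> = (\<Sum>j\<in>{int i<..<K}. entry x (int i) j * entry y j K)"
  proof (rule sum.mono_neutral_right)
    show "\<forall>j\<in>{int i..K} - {int i<..<K}. entry x (int i) j * entry y j K = 0"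
    proof
      fix j assume "j \<in> {int i..K} - {int i<..<K}"
      then have "j = int i \<or> j = K" by auto
      then show "entry x (int i) j * entry y j K = 0"
        using vanishes_belowD[OF x(2), of "int i" "int i"] vanishes_belowD[OF y(2), of K K] by auto
    qed
  qed auto
  also have "\<dots> = (\<Sum>l | l < N \<and> cyc_between i l k. cyc_entry N x i l * cyc_entry N y l k)"
  proof (rule sum.reindex_bij_witness[of _ "\<lambda>l. if i < l then int l else int l + int N"
        "\<lambda>j. if j < int N then nat j else nat (j - int N)"])
    fix j assume j: "j \<in> {int i<..<K}"
    show "(if i < (if j < int N then nat j else nat (j - int N))
      then int (if j < int N then nat j else nat (j - int N))
      else int (if j < int N then nat j else nat (j - int N)) + int N) = j"
      using j ik by (auto simp: K_def split: if_splits)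
    show "(if j < int N then nat j else nat (j - int N)) \<in> {l. l < N \<and> cyc_between i l k}"
      using j ik by (auto simp: K_def cyc_between_def split: if_splits)
    show "cyc_entry N x i (if j < int N then nat j else nat (j - int N)) *
        cyc_entry N y (if j < int N then nat j else nat (j - int N)) k =
        entry x (int i) j * entry y j K"
    proof (cases "j < int N")
      case True
      have "nat j < k \<longleftrightarrow> i < k" using True j ik by (auto simp: K_def split: if_splits)
      then show ?thesis using True j by (auto simp: cyc_entry_def K_def)
    next
      case False
      then have K: "K = int k + int N" "\<not> i < k" "nat (j - int N) < k"
        using j ik by (auto simp: K_def split: if_splits)
      then show ?thesis
        using False periodicD[OF y(1), of "j - int N" "int k"] by (auto simp: cyc_entry_def)
    qed
  next
    fix l assume l: "l \<in> {l. l < N \<and> cyc_between i l k}"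
    then show "(if (if i < l then int l else int l + int N) < int N
      then nat (if i < l then int l else int l + int N)
      else nat ((if i < l then int l else int l + int N) - int N)) = l" by auto
    show "(if i < l then int l else int l + int N) \<in> {int i<..<K}"
      using l ik by (auto simp: K_def cyc_between_def)
  qed
  finally show ?thesis .
qed

lemma vanishes_below_period_iff:
  assumes x: "periodic N x" and N: "N > 0"
  shows "vanishes_below (int N) x \<longleftrightarrow>
    (\<forall>i<N. entry x (int i) (int i) = 0) \<and> (\<forall>i<N. \<forall>k<N. i \<noteq> k \<longrightarrow> cyc_entry N x i k = 0)"
proof (intro iffI conjI allI impI)
  assume v: "vanishes_below (int N) x"
  fix i assume i: "i < N"
  show "entry x (int i) (int i) = 0" using v N by (intro vanishes_belowD[OF v]) auto
  fix k assume "k < N" "i \<noteq> k"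
  then show "cyc_entry N x i k = 0" unfolding cyc_entry_def using i by (intro vanishes_belowD[OF v]) auto
next
  assume *: "(\<forall>i<N. entry x (int i) (int i) = 0) \<and> (\<forall>i<N. \<forall>k<N. i \<noteq> k \<longrightarrow> cyc_entry N x i k = 0)"
  show "vanishes_below (int N) x"
    unfolding vanishes_below_def
  proof (intro allI impI)
    fix i j assume ij: "j < i + int N"
    define q where "q = i div int N"
    define a where "a = nat (i mod int N)"
    define d where "d = j - i"
    have a': "int a = i mod int N" using N by (simp add: a_def)
    have i: "int a + q * int N = i" unfolding a' q_def by (simp add: add.commute)
    have a: "a < N" using a' N pos_mod_bound[of "int N" i] by linarith
    have "int a + d + q * int N = j" using i by (simp add: d_def)
    then have e: "entry x i j = entry x (int a) (int a + d)"
      using entry_shift[OF x, of "int a" q "int a + d"] i by simp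
    have d: "d < int N" using ij by (simp add: d_def)
    consider "d < 0" | "d = 0" | "d > 0" "int a + d < int N" | "int a + d \<ge> int N" by linarith
    then have "entry x (int a) (int a + d) = 0"
    proof cases
      case 3
      define k where "k = nat (int a + d)"
      have k: "int k = int a + d" "k < N" "a < k" using 3 a by (auto simp: k_def nat_less_iff)
      then have "cyc_entry N x a k = 0" using * a by auto
      with k show ?thesis by (simp add: cyc_entry_def)
    next
      case 4
      define k where "k = nat (int a + d - int N)"
      have k: "int k + int N = int a + d" "k < N" "k < a" using 4 a d by (auto simp: k_def nat_less_iff)
      then have "cyc_entry N x a k = 0" using * a by auto
      with k show ?thesis by (simp add: cyc_entry_def)
    next
      case 2
      then show ?thesis using * a by auto
    qed (simp add: entry_lower)
    then show "entry x i j = 0" using e by simp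
  qed
qed

text \<open>Among the arrays with the same entries below distance \<open>N\<close>, this is the one
  that is zero from there on.\<close>

definition periodic_array :: "nat \<Rightarrow> (nat \<Rightarrow> nat \<Rightarrow> complex) \<Rightarrow> incidence" where
  "periodic_array N f = Abs_incidence (\<lambda>i k.
     if i < k \<and> k < i + int N then f (nat (i mod int N)) (nat (k mod int N)) else 0)"

lemma entry_periodic_array:
  "entry (periodic_array N f) i k =
    (if i < k \<and> k < i + int N then f (nat (i mod int N)) (nat (k mod int N)) else 0)"
  unfolding periodic_array_def by (subst entry_Abs) auto

lemma periodic_periodic_array: "periodic N (periodic_array N f)"
  by (auto simp: periodic_def entry_periodic_array)

lemma vanishes_below_periodic_array: "vanishes_below 1 (periodic_array N f)"
  by (auto simp: vanishes_below_def entry_periodic_array)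

lemma cyc_entry_periodic_array:
  "i < N \<Longrightarrow> k < N \<Longrightarrow> cyc_entry N (periodic_array N f) i k = (if i = k then 0 else f i k)"
  by (auto simp: cyc_entry_def entry_periodic_array)

lemma cyclically_ordered_three:
  "cyclically_ordered [i, j, k] \<longleftrightarrow>
    (if i = k then j = i else if i < k then i \<le> j \<and> j \<le> k else i \<le> j \<or> j \<le> k)"
proof -
  have "length [i, j, k] = Suc (Suc (Suc 0))" by simp
  then have "cyclically_ordered [i, j, k] \<longleftrightarrow>
      (sorted [i, j, k] \<or> sorted [j, k, i] \<or> sorted [k, i, j]) \<and> (i = k \<longrightarrow> j = i)"
    unfolding cyclically_ordered_def by (simp only: Ex_less_Suc) (auto simp: rotate_Suc)
  also have "\<dots> \<longleftrightarrow> (i \<le> j \<and> j \<le> k \<or> j \<le> k \<and> k \<le> i \<or> k \<le> i \<and> i \<le> j) \<and> (i = k \<longrightarrow> j = i)"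
    by (rule arg_cong2[of _ _ _ _ "(\<and>)"]) auto
  finally show ?thesis by (cases i k rule: linorder_cases) auto
qed

abbreviation array_of_mat :: "nat \<Rightarrow> complex mat \<Rightarrow> incidence" where
  "array_of_mat N M \<equiv> periodic_array N (\<lambda>i k. M $$ (i, k))"

lemma cyc_entry_array_of_mat_square:
  assumes "i < N" "k < N"
  shows "cyc_entry N (array_of_mat N M * array_of_mat N M) i k =
    (\<Sum>l | l < N \<and> cyc_between i l k. M $$ (i, l) * M $$ (l, k))"
proof -
  have "cyc_entry N (array_of_mat N M * array_of_mat N M) i k = (\<Sum>l | l < N \<and> cyc_between i l k.
      cyc_entry N (array_of_mat N M) i l * cyc_entry N (array_of_mat N M) l k)"
    by (intro cyc_entry_mult periodic_periodic_array vanishes_below_periodic_array assms)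
  also have "\<dots> = (\<Sum>l | l < N \<and> cyc_between i l k. M $$ (i, l) * M $$ (l, k))"
    by (rule sum.cong) (use assms in \<open>auto simp: cyc_entry_periodic_array cyc_between_def\<close>)
  finally show ?thesis .
qed

text \<open>Off the diagonal, the weak order of \<open>brauer_prod\<close> and the strict order of
  \<open>cyc_between\<close> differ only by terms with a factor \<open>M $$ (i, i)\<close> or
  \<open>M $$ (k, k)\<close>. On the diagonal, \<open>brauer_prod\<close> has only the term with
  \<open>j = i\<close>, whereas \<open>cyc_entry\<close> is already at distance \<open>N\<close>,
  where nothing is required.\<close>

lemma brauer_loop_scheme_iff:
  assumes "N > 0"
  shows "M \<in> brauer_loop_scheme N \<longleftrightarrow> M \<in> carrier_mat N N \<and> (\<forall>i<N. M $$ (i, i) = 0) \<and>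
    vanishes_below (int N) (array_of_mat N M * array_of_mat N M)"
proof -
  let ?x = "array_of_mat N M"
  have "brauer_prod N M M = 0\<^sub>m N N \<longleftrightarrow> vanishes_below (int N) (?x * ?x)"
    if diag: "\<forall>i<N. M $$ (i, i) = 0"
  proof -
    have diag': "entry (?x * ?x) (int i) (int i) = 0" for i
      using vanishes_below_mult[OF vanishes_below_periodic_array vanishes_below_periodic_array]
      by (intro vanishes_belowD[of "1 + 1"]) auto
    have e: "brauer_prod N M M $$ (i, k) = (if i = k then 0 else cyc_entry N (?x * ?x) i k)"
      if ik: "i < N" "k < N" for i k
    proof (cases "i = k")
      case True
      then show ?thesis
        using ik diag by (auto simp: brauer_prod_def cyclically_ordered_three intro!: sum.neutral)
    next
      case False
      have "(\<Sum>j | j < N \<and> cyclically_ordered [i, j, k]. M $$ (i, j) * M $$ (j, k)) =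
          (\<Sum>j | j < N \<and> cyc_between i j k. M $$ (i, j) * M $$ (j, k))"
      proof (rule sum.mono_neutral_right)
        show "\<forall>j\<in>{j. j < N \<and> cyclically_ordered [i, j, k]} - {j. j < N \<and> cyc_between i j k}.
            M $$ (i, j) * M $$ (j, k) = 0"
        proof
          fix j assume "j \<in> {j. j < N \<and> cyclically_ordered [i, j, k]} - {j. j < N \<and> cyc_between i j k}"
          then have "j = i \<or> j = k"
            using False by (auto simp: cyclically_ordered_three cyc_between_def split: if_splits)
          then show "M $$ (i, j) * M $$ (j, k) = 0" using diag ik by auto
        qed
      qed (use False in \<open>auto simp: cyclically_ordered_three cyc_between_def\<close>)
      then show ?thesis
        using False ik by (simp add: brauer_prod_def cyc_entry_array_of_mat_square)
    qed
    have "brauer_prod N M M = 0\<^sub>m N N \<longleftrightarrow> (\<forall>i<N. \<forall>k<N. brauer_prod N M M $$ (i, k) = 0)"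
      by (auto simp: mat_eq_iff brauer_prod_def)
    also have "\<dots> \<longleftrightarrow> vanishes_below (int N) (?x * ?x)"
      unfolding vanishes_below_period_iff[OF periodic_mult[OF periodic_periodic_array periodic_periodic_array] assms]
      using e diag' by auto
    finally show ?thesis .
  qed
  then show ?thesis unfolding brauer_loop_scheme_def by blast
qed

text \<open>Going once around the circle from \<open>i\<close> passes every other index exactly
  once.\<close>

lemma diagonal_square_eq_cyc_entry:
  assumes "M \<in> carrier_mat N N" "\<forall>i<N. M $$ (i, i) = 0" "i < N"
  shows "(M * M) $$ (i, i) = cyc_entry N (array_of_mat N M * array_of_mat N M) i i"
proof -
  have "(M * M) $$ (i, i) = (\<Sum>l\<in>{0..<N}. M $$ (i, l) * M $$ (l, i))"
    using assms by (auto simp: scalar_prod_def intro!: sum.cong)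
  also have "\<dots> = (\<Sum>l | l < N \<and> cyc_between i l i. M $$ (i, l) * M $$ (l, i))"
    by (rule sum.mono_neutral_right) (use assms in \<open>auto simp: cyc_between_def\<close>)
  finally show ?thesis using cyc_entry_array_of_mat_square[OF assms(3) assms(3)] by simp
qed

section \<open>Pairing of the diagonal values\<close>

text \<open>On the class \<open>B\<close> of indices with diagonal value \<open>c\<close>, the square of the matrix
  \<open>Q\<close> over \<open>\<complex>[t]\<close> is \<open>t * W\<close>, where \<open>W\<close> at \<open>t = 0\<close> is upper triangular with diagonal entries \<open>c\<close>.
  Hence \<open>(det Q)\<^sup>2\<close> has a zero of order exactly \<open>card B\<close> at \<open>0\<close>.\<close>

lemma even_card_nonzero_diagonal_value:
  assumes x: "periodic N x" "vanishes_below 1 x" "vanishes_below (int N) (x * x)" and c: "c \<noteq> 0"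
  shows "even (card {i. i < N \<and> cyc_entry N (x * x) i i = c})"
proof -
  define D where "D i = entry (x * x) i (i + int N)" for i
  obtain g h where g: "g * h = 1" "h * g = 1" "periodic N g" "periodic N h" "vanishes_below 1 (g - 1)"
    and diag: "\<And>i. entry ((g * x * h) * (g * x * h)) i (i + int N) = D i"
    and dec: "\<And>i j. j < i + int N \<Longrightarrow> D i \<noteq> D j \<Longrightarrow> entry (g * x * h) i j = 0"
    by (rule decouple[OF x(1,3) D_def]) (rule that)
  define A where "A = g * x * h"
  have A: "periodic N A" "vanishes_below 1 A"
    unfolding A_def by (intro periodic_mult g x) (rule vanishes_below_conjugate[OF x(2)])
  have "A * A = g * x * (h * g) * x * h" unfolding A_def by (simp only: mult.assoc)
  then have AA: "A * A = g * (x * x) * h" unfolding g(2) by (simp add: mult.assoc)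
  have AAv: "vanishes_below (int N) (A * A)" unfolding AA using x(3) by (rule vanishes_below_conjugate)
  have Dper: "D (i + int N) = D i" for i
    using periodicD[OF periodic_mult[OF x(1) x(1)], of i "i + int N"] by (simp add: D_def)
  define B where "B = {i. i < N \<and> D (int i) = c}"
  have Bcard: "{i. i < N \<and> cyc_entry N (x * x) i i = c} = B"
    unfolding B_def D_def cyc_entry_def by simp
  have BD: "i < N" "D (int i) = c" if "i \<in> B" for i using that by (simp_all add: B_def)
  \<comment> \<open>By decoupling, a row in \<open>B\<close> has entries only in columns of
    \<open>B\<close>, so products that start in \<open>B\<close> never leave it.\<close>
  have outside: "cyc_entry N A i l = 0" if i: "i \<in> B" and l: "l < N" "l \<notin> B" for i l
  proof -
    have il: "i \<noteq> l" using i l by blast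
    have Dl: "D (int i) \<noteq> D (int l)" using BD[OF i] l by (simp add: B_def)
    show ?thesis
    proof (cases "i < l")
      case True
      have "entry A (int i) (int l) = 0" unfolding A_def by (rule dec) (use l Dl in auto)
      with True show ?thesis by (simp add: cyc_entry_def)
    next
      case False
      have "entry A (int i) (int l + int N) = 0"
        unfolding A_def by (rule dec) (use il False Dl in \<open>auto simp: Dper\<close>)
      with False show ?thesis by (simp add: cyc_entry_def)
    qed
  qed
  have low: "cyc_entry N (A * A) i k = 0" if "i < N" "k < N" "i \<noteq> k" for i k
    unfolding cyc_entry_def by (rule vanishes_belowD[OF AAv]) (use that in auto)
  have cval: "cyc_entry N (A * A) i i = c" if "i \<in> B" for i
    using diag[of "int i"] BD[OF that] unfolding cyc_entry_def A_def by simp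
  define a where "a = cyc_entry N A"
  \<comment> \<open>The variable counts passages from one period to the next: an entry below the
    diagonal makes one. Unit rows outside \<open>B\<close> keep the size \<open>N\<close> without
    affecting the determinant.\<close>
  define Q where "Q = mat N N (\<lambda>(i, l). if i \<in> B \<and> l \<in> B
    then (if i < l then [:a i l:] else if l < i then [:0, a i l:] else 0)
    else if i = l then 1 else 0)"
  have Q: "Q \<in> carrier_mat N N" by (simp add: Q_def)
  have QQ: "(Q * Q) $$ (i, k) = (\<Sum>l<N. Q $$ (i, l) * Q $$ (l, k))" if "i < N" "k < N" for i k
    using that Q by (auto simp: scalar_prod_def atLeast0LessThan intro!: sum.cong)
  have QB: "Q $$ (i, l) = (if i < l then [:a i l:] else if l < i then [:0, a i l:] else 0)"
    if "i \<in> B" "l < N" for i l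
  proof (cases "l \<in> B")
    case False
    then have "a i l = 0" "i \<noteq> l" using outside[OF that] that by (auto simp: a_def)
    then show ?thesis using that BD(1)[OF that(1)] False by (simp add: Q_def)
  qed (use that BD(1) in \<open>simp add: Q_def\<close>)
  have QnB: "Q $$ (i, l) = (if i = l then 1 else 0)" if "i \<notin> B" "i < N" "l < N" for i l
    using that by (simp add: Q_def)
  have QQterm: "Q $$ (i, l) * Q $$ (l, k) =
      (if i < l then [:a i l:] else if l < i then [:0, a i l:] else 0) *
      (if l < k then [:a l k:] else if k < l then [:0, a l k:] else 0)"
    if "i \<in> B" "l < N" "k < N" for i k l
  proof (cases "l \<in> B")
    case True
    show ?thesis unfolding QB[OF that(1,2)] QB[OF True that(3)] ..
  next
    case False
    then have "a i l = 0" using outside that by (simp add: a_def)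
    then have 0: "(if i < l then [:a i l:] else if l < i then [:0, a i l:] else 0) = 0" by simp
    show ?thesis unfolding QB[OF that(1,2)] 0 by simp
  qed
  have aa: "cyc_entry N (A * A) i k = (\<Sum>l | l < N \<and> cyc_between i l k. a i l * a l k)"
    if "i < N" "k < N" for i k
    unfolding a_def by (rule cyc_entry_mult[OF A A that])
  \<comment> \<open>Products without a passage run over \<open>i < l < k\<close> and form an entry
    of \<open>A * A\<close> at distance below \<open>N\<close>.\<close>
  have coeff0: "coeff ((Q * Q) $$ (i, k)) 0 = 0" if i: "i \<in> B" and k: "k < N" for i k
  proof -
    have iN: "i < N" using i by (simp add: B_def)
    have "coeff ((Q * Q) $$ (i, k)) 0 = (\<Sum>l<N. if i < l \<and> l < k then a i l * a l k else 0)"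
      unfolding QQ[OF iN k] coeff_sum by (rule sum.cong) (use QQterm[OF i _ k] in \<open>auto simp: coeff_mult\<close>)
    also have "\<dots> = (\<Sum>l | l < N \<and> i < l \<and> l < k. a i l * a l k)"
      by (simp add: sum.If_cases Int_def)
    also have "\<dots> = 0"
    proof (cases "i < k")
      case True
      then have "{l. l < N \<and> i < l \<and> l < k} = {l. l < N \<and> cyc_between i l k}"
        by (auto simp: cyc_between_def)
      then show ?thesis using low[OF iN k] True aa[OF iN k] by simp
    next
      case False
      then have "{l. l < N \<and> i < l \<and> l < k} = {}" by auto
      then show ?thesis by (simp only: sum.empty)
    qed
    finally show ?thesis .
  qed
  \<comment> \<open>For \<open>k \<le> i\<close> the products with exactly one passage are those
    with \<open>l\<close> cyclically between \<open>i\<close> and \<open>k\<close>.\<close>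
  have coeff1: "coeff ((Q * Q) $$ (i, k)) 1 = (if i = k then c else 0)"
    if i: "i \<in> B" and k: "k \<le> i" for i k
  proof -
    have iN: "i < N" "k < N" using i k by (auto simp: B_def)
    have "coeff ((Q * Q) $$ (i, k)) 1 = (\<Sum>l<N. if cyc_between i l k then a i l * a l k else 0)"
      unfolding QQ[OF iN] coeff_sum
      by (rule sum.cong) (use QQterm[OF i _ iN(2)] k in \<open>auto simp: coeff_mult cyc_between_def\<close>)
    also have "\<dots> = cyc_entry N (A * A) i k"
      unfolding aa[OF iN] by (simp add: sum.If_cases Int_def)
    finally show ?thesis using low[OF iN] cval[OF i] by auto
  qed
  \<comment> \<open>The rows of \<open>B\<close> are divided by the variable, which
    \<open>coeff0\<close> allows.\<close>
  define W where "W = mat N N (\<lambda>(i, k). if i \<in> B then poly_shift 1 ((Q * Q) $$ (i, k)) else if i = k then 1 else 0)"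
  have W: "W \<in> carrier_mat N N" by (simp add: W_def)
  define P where "P = mat_diag N (\<lambda>i. if i \<in> B then [:0, 1:] else (1 :: complex poly))"
  have P: "P \<in> carrier_mat N N" by (simp add: P_def)
  have "Q * Q = P * W"
  proof (rule eq_matI)
    fix i k assume ik: "i < dim_row (P * W)" "k < dim_col (P * W)"
    then have ik: "i < N" "k < N" using P W by auto
    have "(P * W) $$ (i, k) = (if i \<in> B then [:0, 1:] else 1) * W $$ (i, k)"
      unfolding P_def mat_diag_mult_left[OF W] using ik by simp
    also have "\<dots> = (Q * Q) $$ (i, k)"
    proof (cases "i \<in> B")
      case True
      have "[:0, 1:] * poly_shift 1 p = p" if "coeff p 0 = 0" for p :: "complex poly"
        by (rule poly_eqI) (use that in \<open>auto simp: coeff_pCons coeff_poly_shift split: nat.split\<close>)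
      then show ?thesis using True coeff0[OF True ik(2)] ik by (simp add: W_def)
    next
      case False
      have "(Q * Q) $$ (i, k) = (\<Sum>l<N. if l = i then Q $$ (i, k) else 0)"
        unfolding QQ[OF ik] by (rule sum.cong) (use QnB[OF False ik(1)] in auto)
      then show ?thesis using False ik QnB[OF False ik] by (simp add: W_def)
    qed
    finally show "(Q * Q) $$ (i, k) = (P * W) $$ (i, k)" by simp
  qed (use P Q W in auto)
  then have "det Q * det Q = det P * det W" using det_mult[OF Q Q] det_mult[OF P W] by simp
  also have "det P = [:0, 1:] ^ card B"
  proof -
    have "det P = (\<Prod>i<N. if i \<in> B then [:0, 1:] else 1)"
      unfolding P_def by (subst det_upper_triangular[of _ N])
        (auto simp: mat_diag_def prod_list_diag_prod atLeast0LessThan)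
    also have "\<dots> = (\<Prod>i\<in>B. [:0, 1:])"
      by (rule prod.mono_neutral_cong_right) (auto simp: B_def)
    finally show ?thesis by simp
  qed
  finally have det: "det Q * det Q = [:0, 1:] ^ card B * det W" .
  interpret eval: comm_ring_hom "\<lambda>p :: complex poly. poly p 0" by unfold_locales auto
  have "poly (det W) 0 = det (map_mat (\<lambda>p. poly p 0) W)" by simp
  also have "\<dots> = (\<Prod>i<N. if i \<in> B then c else 1)"
  proof -
    have e: "map_mat (\<lambda>p. poly p 0) W $$ (i, k) = (if i = k then if i \<in> B then c else 1 else 0)"
      if "i < N" "k \<le> i" for i k
      using that coeff1[of i k] by (auto simp: W_def poly_0_coeff_0 coeff_poly_shift)
    have "det (map_mat (\<lambda>p. poly p 0) W) = prod_list (diag_mat (map_mat (\<lambda>p. poly p 0) W))"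
      by (rule det_upper_triangular[of _ N]) (use e W in \<open>auto simp: upper_triangular_def\<close>)
    then show ?thesis using W e by (simp add: prod_list_diag_prod atLeast0LessThan)
  qed
  finally have W0: "poly (det W) 0 \<noteq> 0" using c by auto
  then have "det W \<noteq> 0" by auto
  then have nz: "[:0, 1:] ^ card B * det W \<noteq> 0" by simp
  then have "2 * order 0 (det Q) = order 0 (det Q * det Q)"
    unfolding det[symmetric] by (simp add: order_mult)
  also have "\<dots> = card B"
    unfolding det order_mult[OF nz] using order_power_n_n[of "0 :: complex" "card B"] order_0I[OF W0] by simp
  finally show ?thesis unfolding Bcard by (metis dvd_triv_left)
qed

section \<open>Link patterns from classes of even size\<close>

lemma exists_involution_few_fixed_points:
  assumes "finite A"
  shows "\<exists>\<pi>. (\<forall>x\<in>A. \<pi> x \<in> A \<and> \<pi> (\<pi> x) = x) \<and> card {x \<in> A. \<pi> x = x} = card A mod 2"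
  using assms
proof (induction A rule: finite_psubset_induct)
  case (psubset A)
  show ?case
  proof (cases "\<exists>x\<in>A. \<exists>y\<in>A. x \<noteq> y")
    case False
    then have "A = {} \<or> (\<exists>x. A = {x})" by blast
    then show ?thesis by (intro exI[of _ id]) auto
  next
    case True
    then obtain x y where xy: "x \<in> A" "y \<in> A" "x \<noteq> y" by blast
    let ?A = "A - {x, y}"
    obtain \<pi> where \<pi>: "\<forall>z\<in>?A. \<pi> z \<in> ?A \<and> \<pi> (\<pi> z) = z" "card {z \<in> ?A. \<pi> z = z} = card ?A mod 2"
      using psubset.IH[of ?A] xy by blast
    let ?p = "\<pi>(x := y, y := x)"
    have "{z \<in> A. ?p z = z} = {z \<in> ?A. \<pi> z = z}" using xy by auto
    moreover have "card A = card ?A + 2"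
      using card_Diff_subset[of "{x, y}" A] card_mono[of A "{x, y}"] xy psubset.hyps by simp
    moreover have "\<forall>z\<in>A. ?p z \<in> A \<and> ?p (?p z) = z" using \<pi>(1) xy by auto
    ultimately show ?thesis using \<pi>(2) by (intro exI[of _ ?p]) simp
  qed
qed

text \<open>Each class is paired within itself. Only the class of \<open>0\<close> can have odd
  size, and its parity is then that of \<open>N\<close>, so the number of indices left unpaired is
  exactly \<open>N mod 2\<close>.\<close>

lemma link_pattern_of_even_classes:
  fixes v :: "nat \<Rightarrow> 'a :: zero"
  assumes "\<And>c. c \<noteq> 0 \<Longrightarrow> even (card {i. i < N \<and> v i = c})"
  shows "\<exists>\<pi>. link_pattern N \<pi> \<and> (\<forall>i<N. v i = v (\<pi> i) \<and> (\<pi> i = i \<longrightarrow> v i = 0))"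
proof -
  let ?C = "\<lambda>c. {i. i < N \<and> v i = c}"
  have "\<forall>c. \<exists>\<pi>. (\<forall>x\<in>?C c. \<pi> x \<in> ?C c \<and> \<pi> (\<pi> x) = x) \<and> card {x \<in> ?C c. \<pi> x = x} = card (?C c) mod 2"
    by (intro allI exists_involution_few_fixed_points) auto
  from choice[OF this] obtain p where "\<forall>c. (\<forall>x\<in>?C c. p c x \<in> ?C c \<and> p c (p c x) = x) \<and>
    card {x \<in> ?C c. p c x = x} = card (?C c) mod 2" ..
  then have p: "\<And>c x. x \<in> ?C c \<Longrightarrow> p c x \<in> ?C c \<and> p c (p c x) = x"
    "\<And>c. card {x \<in> ?C c. p c x = x} = card (?C c) mod 2"
    by blast+
  define \<pi> where "\<pi> i = p (v i) i" for i
  have \<pi>: "\<pi> i < N" "v (\<pi> i) = v i" "\<pi> (\<pi> i) = i" if "i < N" for i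
    using p(1)[of i "v i"] that by (auto simp: \<pi>_def)
  have nofix: "\<pi> i \<noteq> i" if "i < N" "v i \<noteq> 0" for i
  proof
    assume "\<pi> i = i"
    then have "i \<in> {x \<in> ?C (v i). p (v i) x = x}" using that by (simp add: \<pi>_def)
    moreover have "card {x \<in> ?C (v i). p (v i) x = x} = 0" using p(2) assms[OF that(2)] by presburger
    ultimately show False by auto
  qed
  have "\<pi> i = i \<longleftrightarrow> v i = 0 \<and> p 0 i = i" if "i < N" for i
    using nofix[OF that] by (cases "v i = 0") (simp_all add: \<pi>_def)
  then have "{i. i < N \<and> \<pi> i = i} = {x \<in> ?C 0. p 0 x = x}" by blast
  then have fixed: "card {i. i < N \<and> \<pi> i = i} = card (?C 0) mod 2" using p(2) by simp
  have "N = card {..<N}" by simp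
  also have "{..<N} = (\<Union>c\<in>v ` {..<N}. ?C c)" by auto
  also have "card \<dots> = (\<Sum>c\<in>v ` {..<N}. card (?C c))" by (rule card_UN_disjoint) auto
  also have "\<dots> = (\<Sum>c\<in>insert 0 (v ` {..<N}). card (?C c))"
  proof (rule sum.mono_neutral_left)
    show "\<forall>c\<in>insert 0 (v ` {..<N}) - v ` {..<N}. card (?C c) = 0"
    proof
      fix c assume "c \<in> insert 0 (v ` {..<N}) - v ` {..<N}"
      then have "?C c = {}" by auto
      then show "card (?C c) = 0" by (simp only: card.empty)
    qed
  qed auto
  also have "\<dots> = card (?C 0) + (\<Sum>c\<in>v ` {..<N} - {0}. card (?C c))"
    by (simp add: sum.insert_remove)
  finally have "N = card (?C 0) + (\<Sum>c\<in>v ` {..<N} - {0}. card (?C c))" .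
  moreover have "even (\<Sum>c\<in>v ` {..<N} - {0}. card (?C c))" using assms by (intro dvd_sum) auto
  moreover have "m mod 2 = a mod 2" if "m = a + b" "even b" for m a b :: nat
    using that by presburger
  ultimately have "N mod 2 = card (?C 0) mod 2" by blast
  then have "link_pattern N \<pi>" unfolding link_pattern_def using fixed \<pi> by auto
  moreover have "\<forall>i<N. v i = v (\<pi> i) \<and> (\<pi> i = i \<longrightarrow> v i = 0)" using \<pi> nofix by metis
  ultimately show ?thesis by blast
qed

lemma diagonal_square_pairing:
  assumes N: "N > 0" and M: "M \<in> brauer_loop_scheme N"
  shows "\<exists>\<pi>. link_pattern N \<pi> \<and> (\<forall>i<N. (M * M) $$ (i, i) = (M * M) $$ (\<pi> i, \<pi> i) \<and>
    (\<pi> i = i \<longrightarrow> (M * M) $$ (i, i) = 0))"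
proof (rule link_pattern_of_even_classes)
  fix c :: complex assume c: "c \<noteq> 0"
  let ?x = "array_of_mat N M"
  have *: "M \<in> carrier_mat N N" "\<forall>i<N. M $$ (i, i) = 0" "vanishes_below (int N) (?x * ?x)"
    using M by (auto simp: brauer_loop_scheme_iff[OF N])
  have "{i. i < N \<and> (M * M) $$ (i, i) = c} = {i. i < N \<and> cyc_entry N (?x * ?x) i i = c}"
    using diagonal_square_eq_cyc_entry[OF *(1,2)] by auto
  then show "even (card {i. i < N \<and> (M * M) $$ (i, i) = c})"
    using even_card_nonzero_diagonal_value[OF periodic_periodic_array vanishes_below_periodic_array *(3) c]
    by simp
qed

section \<open>Congruence modulo distance \<open>N\<close> from the diagonal\<close>

definition trunc_cong :: "nat \<Rightarrow> incidence \<Rightarrow> incidence \<Rightarrow> bool" where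
  "trunc_cong n x y \<longleftrightarrow> vanishes_below (int n) (x - y)"

lemma trunc_cong_refl: "trunc_cong n x x"
  by (simp add: trunc_cong_def vanishes_below_0)

lemma trunc_cong_sym: "trunc_cong n x y \<Longrightarrow> trunc_cong n y x"
  using vanishes_below_uminus[of "int n" "x - y"] by (simp add: trunc_cong_def)

lemma trunc_cong_trans: "trunc_cong n x y \<Longrightarrow> trunc_cong n y z \<Longrightarrow> trunc_cong n x z"
  using vanishes_below_add[of "int n" "x - y" "y - z"] by (simp add: trunc_cong_def)

lemma trunc_cong_add: "trunc_cong n x y \<Longrightarrow> trunc_cong n z w \<Longrightarrow> trunc_cong n (x + z) (y + w)"
  using vanishes_below_add[of "int n" "x - y" "z - w"] by (simp add: trunc_cong_def algebra_simps)

lemma trunc_cong_mult: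
  assumes "trunc_cong n x y" "trunc_cong n z w"
  shows "trunc_cong n (x * z) (y * w)"
proof -
  have eq: "x * z - y * w = (x - y) * z + y * (z - w)" by (simp add: algebra_simps)
  show ?thesis
    using assms unfolding trunc_cong_def eq
    by (intro vanishes_below_add vanishes_below_mult_left vanishes_below_mult_right)
qed

lemma trunc_cong_mono: "trunc_cong n x y \<Longrightarrow> m \<le> n \<Longrightarrow> trunc_cong m x y"
  unfolding trunc_cong_def by (rule vanishes_below_mono) auto

lemma cyc_entry_diff: "cyc_entry N (x - y) i k = cyc_entry N x i k - cyc_entry N y i k"
  and cyc_entry_add: "cyc_entry N (x + y) i k = cyc_entry N x i k + cyc_entry N y i k"
  by (simp_all add: cyc_entry_def)

lemma trunc_cong_period_iff:
  assumes "periodic N x" "periodic N y" "vanishes_below 1 x" "vanishes_below 1 y" "N > 0"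
  shows "trunc_cong N x y \<longleftrightarrow> (\<forall>i<N. \<forall>k<N. i \<noteq> k \<longrightarrow> cyc_entry N x i k = cyc_entry N y i k)"
proof -
  have "entry (x - y) (int i) (int i) = 0" for i
    by (rule vanishes_belowD[OF vanishes_below_diff[OF assms(3,4)]]) simp
  then show ?thesis
    unfolding trunc_cong_def vanishes_below_period_iff[OF periodic_diff[OF assms(1,2)] assms(5)]
    by (simp add: cyc_entry_diff)
qed

definition mat_of_array :: "nat \<Rightarrow> incidence \<Rightarrow> complex mat" where
  "mat_of_array N x = mat N N (\<lambda>(i, k). if i = k then 0 else cyc_entry N x i k)"

lemma mat_of_array_carrier [simp]: "mat_of_array N x \<in> carrier_mat N N"
  by (simp add: mat_of_array_def)

lemma mat_of_array_index:
  "i < N \<Longrightarrow> k < N \<Longrightarrow> mat_of_array N x $$ (i, k) = (if i = k then 0 else cyc_entry N x i k)"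
  by (simp add: mat_of_array_def)

lemma mat_of_array_eq_iff:
  assumes "periodic N x" "periodic N y" "vanishes_below 1 x" "vanishes_below 1 y" "N > 0"
  shows "mat_of_array N x = mat_of_array N y \<longleftrightarrow> trunc_cong N x y"
  unfolding trunc_cong_period_iff[OF assms] by (auto simp: mat_of_array_def mat_eq_iff)

lemma mat_of_array_of_mat:
  assumes "M \<in> carrier_mat N N" "\<forall>i<N. M $$ (i, i) = 0"
  shows "mat_of_array N (array_of_mat N M) = M"
  by (rule eq_matI) (use assms in \<open>auto simp: mat_of_array_def cyc_entry_periodic_array\<close>)

lemma array_of_mat_of_array:
  assumes "periodic N x" "vanishes_below 1 x" "N > 0"
  shows "trunc_cong N (array_of_mat N (mat_of_array N x)) x"
  unfolding trunc_cong_period_iff[OF periodic_periodic_array assms(1) vanishes_below_periodic_array assms(2,3)]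
  by (auto simp: cyc_entry_periodic_array mat_of_array_index)

text \<open>One step of precision is gained because the difference is always multiplied by an array
  with zero diagonal. Hence a matrix, which determines its array modulo \<open>N\<close>, also
  determines the entries of the square at distance \<open>N\<close>.\<close>

lemma trunc_cong_square:
  assumes "trunc_cong N x y" "vanishes_below 1 x" "vanishes_below 1 y"
  shows "trunc_cong (Suc N) (x * x) (y * y)"
proof -
  have eq: "x * x - y * y = (x - y) * x + y * (x - y)" by (simp add: algebra_simps)
  have "vanishes_below (int N + 1) ((x - y) * x)" "vanishes_below (1 + int N) (y * (x - y))"
    using assms unfolding trunc_cong_def by (intro vanishes_below_mult; simp)+
  then show ?thesis
    unfolding trunc_cong_def eq by (intro vanishes_below_add) (simp_all add: add.commute)
qed

lemma trunc_cong_Suc_cyc_entry: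
  assumes "trunc_cong (Suc N) x y" "i < N" "k < N"
  shows "cyc_entry N x i k = cyc_entry N y i k"
proof -
  have "cyc_entry N (x - y) i k = 0"
    unfolding cyc_entry_def by (rule vanishes_belowD[OF assms(1)[unfolded trunc_cong_def]]) (use assms in auto)
  then show ?thesis by (simp add: cyc_entry_diff)
qed

lemma trunc_cong_vanishes_below:
  "trunc_cong n x y \<Longrightarrow> vanishes_below (int n) y \<Longrightarrow> vanishes_below (int n) x"
  unfolding trunc_cong_def using vanishes_below_add[of "int n" "x - y" y] by simp

lemma mat_of_array_in_scheme:
  assumes x: "periodic N x" "vanishes_below 1 x" "vanishes_below (int N) (x * x)" and N: "N > 0"
  shows "mat_of_array N x \<in> brauer_loop_scheme N"
    and "\<And>i. i < N \<Longrightarrow> (mat_of_array N x * mat_of_array N x) $$ (i, i) = cyc_entry N (x * x) i i"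
proof -
  let ?M = "mat_of_array N x"
  have sq: "trunc_cong (Suc N) (array_of_mat N ?M * array_of_mat N ?M) (x * x)"
    by (intro trunc_cong_square array_of_mat_of_array x N vanishes_below_periodic_array)
  have diag: "\<forall>i<N. ?M $$ (i, i) = 0" by (simp add: mat_of_array_index)
  show "?M \<in> brauer_loop_scheme N"
    unfolding brauer_loop_scheme_iff[OF N]
    using diag trunc_cong_vanishes_below[OF trunc_cong_mono[OF sq] x(3)] by simp
  show "(?M * ?M) $$ (i, i) = cyc_entry N (x * x) i i" if "i < N" for i
    using diagonal_square_eq_cyc_entry[OF mat_of_array_carrier diag that]
      trunc_cong_Suc_cyc_entry[OF sq that that] by simp
qed

section \<open>Parametrization of the locus of a link pattern\<close>

locale link =
  fixes N :: nat and \<pi> :: "nat \<Rightarrow> nat"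
  assumes pos: "N > 0" and link_pattern: "link_pattern N \<pi>"
begin

lemma \<pi>_less [simp]: "i < N \<Longrightarrow> \<pi> i < N"
  and \<pi>_\<pi> [simp]: "i < N \<Longrightarrow> \<pi> (\<pi> i) = i"
  and card_fixed: "card {i. i < N \<and> \<pi> i = i} = N mod 2"
  using link_pattern unfolding link_pattern_def by blast+

lemma fixed_unique:
  assumes "i < N" "\<pi> i = i" "j < N" "\<pi> j = j"
  shows "i = j"
proof -
  have "card {i. i < N \<and> \<pi> i = i} \<le> Suc 0" using card_fixed by simp
  moreover have "finite {i. i < N \<and> \<pi> i = i}" by simp
  ultimately have "\<forall>i\<in>{i. i < N \<and> \<pi> i = i}. \<forall>j\<in>{i. i < N \<and> \<pi> i = i}. i = j"
    using card_le_Suc0_iff_eq by blast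
  then show ?thesis using assms by blast
qed

definition chord_array :: "(nat \<Rightarrow> complex) \<Rightarrow> incidence" where
  "chord_array a = periodic_array N (\<lambda>i k. if k = \<pi> i then a i else 0)"

lemma periodic_chord_array: "periodic N (chord_array a)"
  and vanishes_below_chord_array: "vanishes_below 1 (chord_array a)"
  unfolding chord_array_def by (rule periodic_periodic_array vanishes_below_periodic_array)+

lemma cyc_entry_chord_array:
  "i < N \<Longrightarrow> k < N \<Longrightarrow> cyc_entry N (chord_array a) i k = (if k \<noteq> i \<and> k = \<pi> i then a i else 0)"
  by (simp add: chord_array_def cyc_entry_periodic_array)

lemma cyc_entry_mult_chord_array:
  assumes x: "periodic N x" "vanishes_below 1 x" and ik: "i < N" "k < N"
  shows "cyc_entry N (x * chord_array a) i k =
    (if \<pi> k \<noteq> k \<and> cyc_between i (\<pi> k) k then cyc_entry N x i (\<pi> k) * a (\<pi> k) else 0)"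
proof -
  have "cyc_entry N (x * chord_array a) i k = (\<Sum>l | l < N \<and> cyc_between i l k.
      cyc_entry N x i l * cyc_entry N (chord_array a) l k)"
    by (intro cyc_entry_mult x ik periodic_chord_array vanishes_below_chord_array)
  also have "\<dots> = (\<Sum>l | l < N \<and> cyc_between i l k.
      if l = \<pi> k then (if \<pi> k \<noteq> k then cyc_entry N x i l * a l else 0) else 0)"
    by (rule sum.cong) (use ik in \<open>auto simp: cyc_entry_chord_array\<close>)
  also have "\<dots> = (if \<pi> k \<noteq> k \<and> cyc_between i (\<pi> k) k then cyc_entry N x i (\<pi> k) * a (\<pi> k) else 0)"
    using ik by (simp add: sum.delta)
  finally show ?thesis .
qed

lemma cyc_entry_chord_array_mult:
  assumes x: "periodic N x" "vanishes_below 1 x" and ik: "i < N" "k < N"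
  shows "cyc_entry N (chord_array a * x) i k =
    (if \<pi> i \<noteq> i \<and> cyc_between i (\<pi> i) k then a i * cyc_entry N x (\<pi> i) k else 0)"
proof -
  have "cyc_entry N (chord_array a * x) i k = (\<Sum>l | l < N \<and> cyc_between i l k.
      cyc_entry N (chord_array a) i l * cyc_entry N x l k)"
    by (intro cyc_entry_mult x ik periodic_chord_array vanishes_below_chord_array)
  also have "\<dots> = (\<Sum>l | l < N \<and> cyc_between i l k.
      if l = \<pi> i then (if \<pi> i \<noteq> i then a i * cyc_entry N x l k else 0) else 0)"
    by (rule sum.cong) (use ik in \<open>auto simp: cyc_entry_chord_array\<close>)
  also have "\<dots> = (if \<pi> i \<noteq> i \<and> cyc_between i (\<pi> i) k then a i * cyc_entry N x (\<pi> i) k else 0)"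
    using ik by (simp add: sum.delta)
  finally show ?thesis .
qed

definition chord_value :: "(nat \<Rightarrow> complex) \<Rightarrow> nat \<Rightarrow> complex" where
  "chord_value a i = (if \<pi> i = i then 0 else a i * a (\<pi> i))"

lemma chord_value_\<pi>: "i < N \<Longrightarrow> chord_value a (\<pi> i) = chord_value a i"
  by (auto simp: chord_value_def)

text \<open>From \<open>i\<close> the only step leads to \<open>\<pi> i\<close>, and from there the
  only step leads back to \<open>i\<close>; together they go around the circle once.\<close>

lemma cyc_entry_chord_array_square:
  assumes "i < N" "k < N"
  shows "cyc_entry N (chord_array a * chord_array a) i k = (if i = k then chord_value a i else 0)"
  unfolding cyc_entry_chord_array_mult[OF periodic_chord_array vanishes_below_chord_array assms]
  using assms by (auto simp: cyc_entry_chord_array chord_value_def cyc_between_def)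

lemma vanishes_below_chord_array_square: "vanishes_below (int N) (chord_array a * chord_array a)"
proof -
  have "entry (chord_array a * chord_array a) i i = 0" for i
    using vanishes_below_mult[OF vanishes_below_chord_array vanishes_below_chord_array]
    by (intro vanishes_belowD[of "1 + 1"]) auto
  then show ?thesis
    by (subst vanishes_below_period_iff)
      (auto simp: pos periodic_mult periodic_chord_array cyc_entry_chord_array_square)
qed

text \<open>The parameters form an \<open>N \<times> N\<close> array \<open>y\<close>: the diagonal of \<open>y\<close> contains the entries of the
  chord array, the other entries of \<open>y\<close> those of the unipotent conjugating array.\<close>

definition unipotent_part :: "(nat \<times> nat \<Rightarrow> complex) \<Rightarrow> incidence" where
  "unipotent_part y = periodic_array N (\<lambda>i k. y (i, k))"

definition chord_part :: "(nat \<times> nat \<Rightarrow> complex) \<Rightarrow> incidence" where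
  "chord_part y = chord_array (\<lambda>i. y (i, i))"

text \<open>The Neumann series is cut off so that it is polynomial in the parameters. The error
  starts at distance \<open>N + 1\<close>, which even the diagonal of the matrix square does not
  see.\<close>

definition truncated_inverse :: "(nat \<times> nat \<Rightarrow> complex) \<Rightarrow> incidence" where
  "truncated_inverse y = (\<Sum>m<Suc N. (- unipotent_part y) ^ m)"

definition conjugate :: "(nat \<times> nat \<Rightarrow> complex) \<Rightarrow> incidence" where
  "conjugate y = (1 + unipotent_part y) * chord_part y * truncated_inverse y"

definition param :: "(nat \<times> nat \<Rightarrow> complex) \<Rightarrow> complex mat" where
  "param y = mat_of_array N (conjugate y)"

lemma periodic_unipotent_part: "periodic N (unipotent_part y)"
  and vanishes_below_unipotent_part: "vanishes_below 1 (unipotent_part y)"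
  unfolding unipotent_part_def by (rule periodic_periodic_array vanishes_below_periodic_array)+

lemma cyc_entry_unipotent_part:
  "i < N \<Longrightarrow> k < N \<Longrightarrow> cyc_entry N (unipotent_part y) i k = (if i = k then 0 else y (i, k))"
  by (simp add: unipotent_part_def cyc_entry_periodic_array)

lemma periodic_conjugate: "periodic N (conjugate y)"
  unfolding conjugate_def truncated_inverse_def chord_part_def
  by (intro periodic_mult periodic_add periodic_1 periodic_unipotent_part periodic_chord_array
      periodic_sum periodic_power periodic_uminus)

lemma vanishes_below_conjugate_param: "vanishes_below 1 (conjugate y)"
  unfolding conjugate_def chord_part_def
  by (rule vanishes_below_conjugate) (rule vanishes_below_chord_array)

lemma truncated_inverse:
  "trunc_cong (Suc N) ((1 + unipotent_part y) * truncated_inverse y) 1"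
  "trunc_cong (Suc N) (truncated_inverse y * (1 + unipotent_part y)) 1"
proof -
  let ?u = "unipotent_part y"
  have v: "vanishes_below (int (Suc N)) ((- ?u) ^ Suc N)"
    by (intro vanishes_below_power vanishes_below_uminus vanishes_below_unipotent_part)
  have "(1 + ?u) * truncated_inverse y = 1 - (- ?u) ^ Suc N"
    using geometric_sum_left[of "- ?u" "Suc N"] unfolding truncated_inverse_def by (simp only: diff_minus_eq_add)
  then show "trunc_cong (Suc N) ((1 + ?u) * truncated_inverse y) 1"
    using vanishes_below_uminus[OF v] unfolding trunc_cong_def by (simp only: diff_diff_eq2 diff_add_cancel) simp
  have "truncated_inverse y * (1 + ?u) = 1 - (- ?u) ^ Suc N"
    using geometric_sum_right[of "- ?u" "Suc N"] unfolding truncated_inverse_def by (simp only: diff_minus_eq_add)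
  then show "trunc_cong (Suc N) (truncated_inverse y * (1 + ?u)) 1"
    using vanishes_below_uminus[OF v] unfolding trunc_cong_def by (simp only: diff_diff_eq2 diff_add_cancel) simp
qed

lemma conjugate_intertwines:
  "trunc_cong (Suc N) (conjugate y * (1 + unipotent_part y)) ((1 + unipotent_part y) * chord_part y)"
  using trunc_cong_mult[OF trunc_cong_refl[of "Suc N" "(1 + unipotent_part y) * chord_part y"] truncated_inverse(2)]
  unfolding conjugate_def by (simp add: mult.assoc)

text \<open>To recognize a matrix as a value of \<open>param\<close> it suffices to check an
  intertwining relation, which involves no inverse.\<close>

lemma conjugate_unique:
  assumes "trunc_cong N (x * (1 + unipotent_part y)) ((1 + unipotent_part y) * chord_part y)"
  shows "trunc_cong N x (conjugate y)"
proof -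
  have "trunc_cong N (x * ((1 + unipotent_part y) * truncated_inverse y)) (x * 1)"
    by (intro trunc_cong_mult trunc_cong_refl trunc_cong_mono[OF truncated_inverse(1)]) simp
  then have "trunc_cong N x (x * (1 + unipotent_part y) * truncated_inverse y)"
    by (simp add: mult.assoc trunc_cong_sym)
  moreover have "trunc_cong N (x * (1 + unipotent_part y) * truncated_inverse y) (conjugate y)"
    unfolding conjugate_def by (intro trunc_cong_mult assms trunc_cong_refl)
  ultimately show ?thesis by (rule trunc_cong_trans)
qed

text \<open>Unipotent factors do not change the leading entries of an array that starts at distance
  \<open>N\<close>. This is applied first to the square of the chord array and, once
  \<open>?X * ?X\<close> is known to start at distance \<open>N\<close>, also to that
  square.\<close>

lemma conjugate_square:
  "trunc_cong (Suc N) (conjugate y * conjugate y) (chord_part y * chord_part y)"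
proof -
  let ?X = "conjugate y" and ?u = "unipotent_part y" and ?m = "chord_part y"
  define e where "e = ?X * (1 + ?u) - (1 + ?u) * ?m"
  have e: "vanishes_below (int (Suc N)) e" using conjugate_intertwines unfolding e_def trunc_cong_def .
  have mm: "vanishes_below (int N) (?m * ?m)"
    unfolding chord_part_def by (rule vanishes_below_chord_array_square)
  have "?X * (1 + ?u) = (1 + ?u) * ?m + e" by (simp add: e_def)
  then have "?X * ?X * (1 + ?u) = ?X * ((1 + ?u) * ?m + e)" by (simp add: mult.assoc)
  also have "\<dots> = ?X * ((1 + ?u) * ?m) + ?X * e" by (rule distrib_left)
  also have "?X * ((1 + ?u) * ?m) = ?X * (1 + ?u) * ?m" by (rule mult.assoc[symmetric])
  also have "?X * (1 + ?u) = (1 + ?u) * ?m + e" by (simp add: e_def)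
  finally have eq: "?X * ?X * (1 + ?u) = ?m * ?m + ?u * (?m * ?m) + (e * ?m + ?X * e)"
    by (simp add: distrib_right mult.assoc add.assoc)
  have small: "vanishes_below (int (Suc N)) (e * ?m + ?X * e)"
    by (intro vanishes_below_add vanishes_below_mult_left vanishes_below_mult_right e)
  have umm: "vanishes_below (int (Suc N)) (?u * (?m * ?m))"
    using vanishes_below_mult[OF vanishes_below_unipotent_part mm] by simp
  have "vanishes_below (int N) (?X * ?X * (1 + ?u))"
    unfolding eq
    by (intro vanishes_below_add[OF vanishes_below_add] mm vanishes_below_mono[OF umm] vanishes_below_mono[OF small])
      simp_all
  then have "vanishes_below (int N) (?X * ?X * (1 + ?u) * truncated_inverse y)"
    by (rule vanishes_below_mult_left)
  moreover have "trunc_cong N (?X * ?X * 1) (?X * ?X * ((1 + ?u) * truncated_inverse y))"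
    by (intro trunc_cong_mult trunc_cong_refl trunc_cong_sym[OF trunc_cong_mono[OF truncated_inverse(1)]]) simp
  ultimately have XX: "vanishes_below (int N) (?X * ?X)"
    using trunc_cong_vanishes_below by (simp add: mult.assoc)
  have "?X * ?X - ?m * ?m = ?u * (?m * ?m) + (e * ?m + ?X * e) - ?X * ?X * ?u"
    using eq by (simp add: distrib_left algebra_simps)
  moreover have "vanishes_below (int (Suc N)) (?X * ?X * ?u)"
    using vanishes_below_mult[OF XX vanishes_below_unipotent_part] by (simp add: add.commute)
  ultimately show ?thesis
    unfolding trunc_cong_def using small umm by (simp add: vanishes_below_add vanishes_below_diff)
qed

lemma param_in_scheme: "param y \<in> brauer_loop_scheme N"
  and param_diagonal_square: "i < N \<Longrightarrow> (param y * param y) $$ (i, i) = chord_value (\<lambda>i. y (i, i)) i"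
proof -
  have v: "vanishes_below (int N) (conjugate y * conjugate y)"
    using trunc_cong_vanishes_below[OF trunc_cong_mono[OF conjugate_square]] vanishes_below_chord_array_square
    by (simp add: chord_part_def)
  note x = periodic_conjugate vanishes_below_conjugate_param v pos
  show "param y \<in> brauer_loop_scheme N"
    unfolding param_def by (rule mat_of_array_in_scheme[OF x])
  assume i: "i < N"
  show "(param y * param y) $$ (i, i) = chord_value (\<lambda>i. y (i, i)) i"
    unfolding param_def mat_of_array_in_scheme(2)[OF x i]
      trunc_cong_Suc_cyc_entry[OF conjugate_square i i]
    by (simp add: chord_part_def cyc_entry_chord_array_square i)
qed

section \<open>The locus as the complement of a discriminant\<close>

definition discriminant :: "(nat \<Rightarrow> complex) \<Rightarrow> complex" where
  "discriminant v = (\<Prod>(i, j)\<in>{(i, j). i < N \<and> j < N \<and> j \<notin> {i, \<pi> i}}. v i - v j)"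

lemma finite_pairs: "finite {(i, j). i < N \<and> j < N \<and> P i j}"
  by (rule finite_subset[of _ "{..<N} \<times> {..<N}"]) auto

lemma discriminant_nonzero_iff:
  "discriminant v \<noteq> 0 \<longleftrightarrow> (\<forall>i<N. \<forall>j<N. j \<notin> {i, \<pi> i} \<longrightarrow> v i \<noteq> v j)"
  unfolding discriminant_def by (subst prod_zero_iff[OF finite_pairs]) auto

text \<open>The equalities along the chords come for free. When values on different chords differ,
  any pairing \<open>\<pi>'\<close> of equal values has \<open>\<pi>' i \<in> {i, \<pi> i}\<close>,
  and the equal numbers of fixed points force it to be \<open>\<pi>\<close>. So inequations alone
  cut out the locus, which is why it is open.\<close>

lemma link_pattern_locus_iff:
  "M \<in> link_pattern_locus N \<pi> \<longleftrightarrow>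
    M \<in> brauer_loop_scheme N \<and> discriminant (\<lambda>i. (M * M) $$ (i, i)) \<noteq> 0"
proof
  assume "M \<in> link_pattern_locus N \<pi>"
  then show "M \<in> brauer_loop_scheme N \<and> discriminant (\<lambda>i. (M * M) $$ (i, i)) \<noteq> 0"
    unfolding discriminant_nonzero_iff link_pattern_locus_def by blast
next
  assume M: "M \<in> brauer_loop_scheme N \<and> discriminant (\<lambda>i. (M * M) $$ (i, i)) \<noteq> 0"
  define v where "v i = (M * M) $$ (i, i)" for i
  have ne: "v i \<noteq> v j" if "i < N" "j < N" "j \<notin> {i, \<pi> i}" for i j
    using M that unfolding discriminant_nonzero_iff v_def by blast
  obtain \<pi>' where \<pi>': "link_pattern N \<pi>'" "\<And>i. i < N \<Longrightarrow> v i = v (\<pi>' i)"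
    using diagonal_square_pairing[OF pos] M unfolding v_def by blast
  have less: "\<pi>' i < N" if "i < N" for i using \<pi>'(1) that by (simp add: link_pattern_def)
  have in': "\<pi>' i \<in> {i, \<pi> i}" if "i < N" for i using ne[OF that less[OF that]] \<pi>'(2)[OF that] by blast
  have "{i. i < N \<and> \<pi> i = i} \<subseteq> {i. i < N \<and> \<pi>' i = i}" using in' by force
  moreover have "card {i. i < N \<and> \<pi> i = i} = card {i. i < N \<and> \<pi>' i = i}"
    using card_fixed \<pi>'(1) by (simp add: link_pattern_def)
  ultimately have fixed: "{i. i < N \<and> \<pi> i = i} = {i. i < N \<and> \<pi>' i = i}"
    by (intro card_subset_eq) auto
  have "v i = v (\<pi> i)" if "i < N" for i
  proof (cases "\<pi>' i = i")
    case True
    then have "\<pi> i = i" using fixed that by blast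
    then show ?thesis by simp
  next
    case False
    then show ?thesis using in'[OF that] \<pi>'(2)[OF that] by simp
  qed
  then have "v i = v j \<longleftrightarrow> j \<in> {i, \<pi> i}" if "i < N" "j < N" for i j
    using ne[OF that] that(1) by blast
  then show "M \<in> link_pattern_locus N \<pi>"
    using M unfolding link_pattern_locus_def v_def by blast
qed

lemma param_in_locus_iff:
  "param y \<in> link_pattern_locus N \<pi> \<longleftrightarrow> discriminant (chord_value (\<lambda>i. y (i, i))) \<noteq> 0"
  unfolding link_pattern_locus_iff discriminant_nonzero_iff
  by (simp add: param_in_scheme param_diagonal_square)

text \<open>In the locus of \<open>\<pi>\<close>, decoupling the diagonal values leaves a chord array.\<close>

lemma locus_subset_range_param:
  assumes M: "M \<in> link_pattern_locus N \<pi>"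
  shows "\<exists>y. M = param y"
proof -
  define x where "x = array_of_mat N M"
  have MS: "M \<in> carrier_mat N N" "\<forall>i<N. M $$ (i, i) = 0" "vanishes_below (int N) (x * x)"
    using M by (auto simp: link_pattern_locus_iff brauer_loop_scheme_iff[OF pos] x_def)
  have x: "periodic N x" "vanishes_below 1 x"
    unfolding x_def by (rule periodic_periodic_array vanishes_below_periodic_array)+
  define D where "D i = entry (x * x) i (i + int N)" for i
  have Dper: "D (i + int N) = D i" for i
    using periodicD[OF periodic_mult[OF x(1) x(1)], of i "i + int N"] by (simp add: D_def)
  have DM: "D (int i) = (M * M) $$ (i, i)" if "i < N" for i
    using diagonal_square_eq_cyc_entry[OF MS(1,2) that] by (simp add: D_def cyc_entry_def x_def)
  obtain g h where g: "g * h = 1" "h * g = 1" "periodic N g" "periodic N h" "vanishes_below 1 (g - 1)"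
    and "\<And>i. entry ((g * x * h) * (g * x * h)) i (i + int N) = D i"
    and dec: "\<And>i j. j < i + int N \<Longrightarrow> D i \<noteq> D j \<Longrightarrow> entry (g * x * h) i j = 0"
    by (rule decouple[OF x(1) MS(3) D_def]) (rule that)
  define A where "A = g * x * h"
  have A: "periodic N A" "vanishes_below 1 A"
    unfolding A_def by (intro periodic_mult g x) (rule vanishes_below_conjugate[OF x(2)])
  define a where "a i = cyc_entry N A i (\<pi> i)" for i
  have Aa: "trunc_cong N A (chord_array a)"
    unfolding trunc_cong_period_iff[OF A(1) periodic_chord_array A(2) vanishes_below_chord_array pos]
  proof (intro allI impI)
    fix i k assume ik: "i < N" "k < N" "i \<noteq> k"
    show "cyc_entry N A i k = cyc_entry N (chord_array a) i k"
    proof (cases "k = \<pi> i")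
      case True
      with ik show ?thesis by (simp add: cyc_entry_chord_array a_def)
    next
      case False
      then have "D (int i) \<noteq> D (int k)"
        using M ik by (simp add: DM link_pattern_locus_def)
      then have "cyc_entry N A i k = 0"
        unfolding cyc_entry_def A_def by (intro dec) (use ik Dper in auto)
      with False ik show ?thesis by (simp add: cyc_entry_chord_array)
    qed
  qed
  \<comment> \<open>The conjugating array is \<open>h\<close> and not \<open>g\<close>, since
    \<open>x * h = h * A\<close>.\<close>
  define y where "y = (\<lambda>(i, k). if i = k then a i else cyc_entry N (h - 1) i k)"
  have "h - 1 = - (h * (g - 1))" using g by (simp add: right_diff_distrib)
  then have "vanishes_below 1 (h - 1)"
    using vanishes_below_uminus[OF vanishes_below_mult_right[OF g(5), of h]] by simp
  moreover have "periodic N (h - 1)" by (rule periodic_diff[OF g(4) periodic_1])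
  ultimately have h: "vanishes_below 1 (h - 1)" "periodic N (h - 1)" by blast+
  have "trunc_cong N (unipotent_part y) (h - 1)"
    unfolding trunc_cong_period_iff[OF periodic_unipotent_part h(2) vanishes_below_unipotent_part h(1) pos]
    by (auto simp: cyc_entry_unipotent_part y_def)
  then have uh: "trunc_cong N (1 + unipotent_part y) h"
    using trunc_cong_add[OF trunc_cong_refl[of N 1]] by (metis add.commute diff_add_cancel)
  have m: "chord_part y = chord_array a" by (simp add: chord_part_def y_def)
  have "h * A = h * g * (x * h)" unfolding A_def by (simp only: mult.assoc)
  then have xh: "x * h = h * A" by (simp add: g(2))
  have "trunc_cong N (x * (1 + unipotent_part y)) (h * A)"
    unfolding xh[symmetric] by (intro trunc_cong_mult trunc_cong_refl uh)
  moreover have "trunc_cong N (h * A) ((1 + unipotent_part y) * chord_part y)"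
    unfolding m by (intro trunc_cong_mult trunc_cong_sym[OF uh] Aa)
  ultimately have "trunc_cong N x (conjugate y)"
    by (intro conjugate_unique) (rule trunc_cong_trans)
  then have "mat_of_array N x = param y"
    unfolding param_def mat_of_array_eq_iff[OF x(1) periodic_conjugate x(2) vanishes_below_conjugate_param pos] .
  then show ?thesis using mat_of_array_of_mat[OF MS(1,2)] by (auto simp: x_def)
qed

lemma locus_eq_param_image:
  "link_pattern_locus N \<pi> = param ` {y. discriminant (chord_value (\<lambda>i. y (i, i))) \<noteq> 0}"
proof (intro equalityI subsetI)
  fix M assume M: "M \<in> link_pattern_locus N \<pi>"
  then obtain y where y: "M = param y" using locus_subset_range_param by blast
  then show "M \<in> param ` {y. discriminant (chord_value (\<lambda>i. y (i, i))) \<noteq> 0}"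
    using M param_in_locus_iff by blast
next
  fix M assume "M \<in> param ` {y. discriminant (chord_value (\<lambda>i. y (i, i))) \<noteq> 0}"
  then show "M \<in> link_pattern_locus N \<pi>" using param_in_locus_iff by blast
qed

lemma locus_subset_carrier: "link_pattern_locus N \<pi> \<subseteq> carrier_mat N N"
  by (auto simp: link_pattern_locus_def brauer_loop_scheme_def)

lemma openin_locus:
  "openin (subtopology (zariski N) (brauer_loop_scheme N)) (link_pattern_locus N \<pi>)"
proof -
  define s where "s i M = (\<Sum>l<N. M $$ (i, l) * M $$ (l, i))" for i and M :: "complex mat"
  have s: "(M * M) $$ (i, i) = s i M" if "M \<in> carrier_mat N N" "i < N" for M i
    using that by (auto simp: s_def scalar_prod_def atLeast0LessThan intro!: sum.cong)
  let ?h = "\<lambda>M. discriminant (\<lambda>i. s i M)"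
  have minus: "poly_fun N (\<lambda>M. f M - g M)" if "poly_fun N f" "poly_fun N g" for f g
    using poly_fun.add[OF that(1) poly_fun.mult[OF poly_fun.const[of N "-1"] that(2)]] by simp
  have prod: "poly_fun N (\<lambda>M. \<Prod>a\<in>A. f a M)" if "\<And>a. a \<in> A \<Longrightarrow> poly_fun N (f a)"
    for A :: "(nat \<times> nat) set" and f
    using that by (induction A rule: infinite_finite_induct) (auto intro: poly_fun.intros)
  have "poly_fun N (s i)" if "i < N" for i
    unfolding s_def using that by (intro poly_fun_sum poly_fun.mult poly_fun.entry) auto
  then have h: "poly_fun N ?h"
    unfolding discriminant_def case_prod_unfold by (intro prod minus) auto
  have iff: "M \<in> link_pattern_locus N \<pi> \<longleftrightarrow> M \<in> brauer_loop_scheme N \<and> ?h M \<noteq> 0" for M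
  proof -
    have "discriminant (\<lambda>i. (M * M) $$ (i, i)) = ?h M" if "M \<in> brauer_loop_scheme N"
    proof -
      have "M \<in> carrier_mat N N" using that by (simp add: brauer_loop_scheme_def)
      then show ?thesis unfolding discriminant_def by (intro prod.cong) (auto simp: s simp del: index_mult_mat)
    qed
    then show ?thesis unfolding link_pattern_locus_iff by (simp cong: conj_cong del: index_mult_mat)
  qed
  have sub: "M \<in> carrier_mat N N" if "M \<in> brauer_loop_scheme N" for M
    using that by (simp add: brauer_loop_scheme_def)
  have "link_pattern_locus N \<pi> = (carrier_mat N N - zero_locus N {?h}) \<inter> brauer_loop_scheme N"
    by (rule Set.set_eqI) (use sub in \<open>auto simp: iff zero_locus_def\<close>)
  moreover have "openin (zariski N) (carrier_mat N N - zero_locus N {?h})"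
    unfolding openin_zariski by (rule exI[of _ "{?h}"]) (simp add: h)
  ultimately show ?thesis unfolding openin_subtopology by (intro exI conjI)
qed

end

lemma polynomial_in_if:
  "polynomial_in I f \<Longrightarrow> polynomial_in I g \<Longrightarrow> polynomial_in I (\<lambda>y. if b then f y else g y)"
  by (cases b) auto

section \<open>Dimension of the locus\<close>

definition polynomial_array :: "'i set \<Rightarrow> (('i \<Rightarrow> complex) \<Rightarrow> incidence) \<Rightarrow> bool" where
  "polynomial_array I F \<longleftrightarrow> (\<forall>i j. polynomial_in I (\<lambda>y. entry (F y) i j))"

lemma polynomial_array_const: "polynomial_array I (\<lambda>y. x)"
  by (simp add: polynomial_array_def polynomial_in.const)

lemma polynomial_array_add:
  "polynomial_array I F \<Longrightarrow> polynomial_array I G \<Longrightarrow> polynomial_array I (\<lambda>y. F y + G y)"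
  by (simp add: polynomial_array_def polynomial_in.add)

lemma polynomial_array_uminus: "polynomial_array I F \<Longrightarrow> polynomial_array I (\<lambda>y. - F y)"
  by (simp add: polynomial_array_def polynomial_in_uminus)

lemma polynomial_array_mult:
  "polynomial_array I F \<Longrightarrow> polynomial_array I G \<Longrightarrow> polynomial_array I (\<lambda>y. F y * G y)"
  unfolding polynomial_array_def entry_mult by (intro allI polynomial_in_sum polynomial_in.mult) auto

lemma polynomial_array_power: "polynomial_array I F \<Longrightarrow> polynomial_array I (\<lambda>y. F y ^ n)"
  by (induction n) (simp_all add: polynomial_array_const polynomial_array_mult)

lemma polynomial_array_sum:
  "(\<And>a. a \<in> A \<Longrightarrow> polynomial_array I (F a)) \<Longrightarrow> polynomial_array I (\<lambda>y. \<Sum>a\<in>A. F a y)"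
  by (induction A rule: infinite_finite_induct) (auto simp: polynomial_array_const polynomial_array_add)

lemma polynomial_array_periodic_array:
  assumes "\<And>i k. i < N \<Longrightarrow> k < N \<Longrightarrow> polynomial_in I (\<lambda>y. f y i k)" "N > 0"
  shows "polynomial_array I (\<lambda>y. periodic_array N (f y))"
  unfolding polynomial_array_def entry_periodic_array
proof (intro allI)
  fix i k :: int
  have "nat (i mod int N) < N" "nat (k mod int N) < N" using assms(2) by (simp_all add: nat_less_iff)
  then show "polynomial_in I (\<lambda>y. if i < k \<and> k < i + int N then f y (nat (i mod int N)) (nat (k mod int N)) else 0)"
    using assms(1) by (cases "i < k \<and> k < i + int N") (auto simp: polynomial_in.const)
qed

lemma cyc_between_neq: "i \<noteq> k \<Longrightarrow> cyc_between i l k \<Longrightarrow> l \<noteq> i \<and> l \<noteq> k"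
  by (auto simp: cyc_between_def)

text \<open>Three distinct points are in exactly one of two cyclic orders, and exchanging two of
  them switches between these.\<close>

lemma cyc_between_swap: "i \<noteq> k \<Longrightarrow> i \<noteq> l \<Longrightarrow> l \<noteq> k \<Longrightarrow> cyc_between l i k \<longleftrightarrow> \<not> cyc_between i l k"
  by (auto simp: cyc_between_def)

lemma cyc_between_flip: "i \<noteq> k \<Longrightarrow> i \<noteq> l \<Longrightarrow> l \<noteq> k \<Longrightarrow> cyc_between i k l \<longleftrightarrow> \<not> cyc_between i l k"
  by (auto simp: cyc_between_def)

context link
begin

abbreviation square :: "(nat \<times> nat) set" where
  "square \<equiv> {..<N} \<times> {..<N}"

lemma polynomial_in_param:
  assumes "i < N" "k < N"
  shows "polynomial_in square (\<lambda>y. param y $$ (i, k))"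
proof -
  have "polynomial_array square unipotent_part" "polynomial_array square chord_part"
    unfolding unipotent_part_def chord_part_def chord_array_def
    by (rule polynomial_array_periodic_array[OF _ pos]; auto intro!: polynomial_in_if intro: polynomial_in.intros)+
  then have "polynomial_array square conjugate"
    unfolding conjugate_def truncated_inverse_def
    by (intro polynomial_array_mult polynomial_array_add polynomial_array_const polynomial_array_sum
        polynomial_array_power polynomial_array_uminus)
  then show ?thesis
    using assms by (cases "i = k")
      (simp_all add: param_def mat_of_array_index polynomial_in.const cyc_entry_def polynomial_array_def)
qed

lemma polynomial_in_discriminant:
  "polynomial_in square (\<lambda>y. discriminant (chord_value (\<lambda>i. y (i, i))))"
proof -
  have "polynomial_in square (\<lambda>y. chord_value (\<lambda>i. y (i, i)) i)" if "i < N" for i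
    using that by (cases "\<pi> i = i") (auto simp: chord_value_def intro!: polynomial_in.intros)
  then show ?thesis
    unfolding discriminant_def case_prod_unfold by (intro polynomial_in_prod polynomial_in_diff) auto
qed

text \<open>The value on a chord becomes \<open>Suc\<close> of its larger end. Different chords thus
  have different non-zero values, and the fixed point has value \<open>0\<close>.\<close>

definition base_chord :: "nat \<Rightarrow> complex" where
  "base_chord i = (if i < \<pi> i then 1 else of_nat i + 1)"

lemma base_chord_nonzero: "base_chord i \<noteq> 0"
proof -
  have "of_nat (Suc i) \<noteq> (0 :: complex)" by (simp only: of_nat_eq_0_iff)
  then show ?thesis by (simp add: base_chord_def add.commute)
qed

lemma chord_value_base_chord:
  assumes "i < N"
  shows "chord_value base_chord i = (if \<pi> i = i then 0 else of_nat (Suc (max i (\<pi> i))))"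
  using assms by (auto simp: chord_value_def base_chord_def max_def)

lemma discriminant_base_chord: "discriminant (chord_value base_chord) \<noteq> 0"
  unfolding discriminant_nonzero_iff
proof (intro allI impI)
  fix i j assume ij: "i < N" "j < N" "j \<notin> {i, \<pi> i}"
  show "chord_value base_chord i \<noteq> chord_value base_chord j"
  proof (cases "\<pi> i = i \<or> \<pi> j = j")
    case True
    then have "\<not> (\<pi> i = i \<and> \<pi> j = j)" using fixed_unique ij by blast
    then show ?thesis
      using True ij by (auto simp: chord_value_base_chord simp del: of_nat_Suc)
  next
    case False
    have "\<pi> i \<noteq> j" "\<pi> i \<noteq> \<pi> j" "\<pi> j \<noteq> i" using ij by (auto dest: arg_cong[of _ _ \<pi>])
    then have "max i (\<pi> i) \<noteq> max j (\<pi> j)" using ij by (auto simp: max_def)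
    then show ?thesis using False ij by (simp add: chord_value_base_chord del: of_nat_Suc)
  qed
qed

text \<open>The entries \<open>(i, k)\<close> of a matrix that serve as coordinates near a chord array: \<open>chord_coords\<close>
  for the entries of the chord array itself, \<open>slots\<close> for the directions tangent to its orbit. The
  entry at a slot \<open>(i, k)\<close> is moved by the entry \<open>mirror (i, k)\<close> of the conjugating array.\<close>

definition slots :: "(nat \<times> nat) set" where
  "slots = {(i, k). i < N \<and> k < N \<and> i \<noteq> k \<and>
     (if \<pi> i = i then cyc_between i (\<pi> k) k else cyc_between i (\<pi> i) k)}"

definition chord_coords :: "(nat \<times> nat) set" where
  "chord_coords = {(i, k). i < N \<and> k = \<pi> i \<and> k \<noteq> i}"

definition coords :: "(nat \<times> nat) set" where
  "coords = slots \<union> chord_coords"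

text \<open>Let \<open>m\<close> be a chord array and \<open>u\<close> a conjugating array. In entry
  \<open>(i, k)\<close> of the commutator, \<open>u (\<pi> i, k)\<close> comes from
  \<open>m * u\<close> and \<open>u (i, \<pi> k)\<close> from \<open>u * m\<close>. The former is
  chosen unless \<open>i\<close> is fixed, when row \<open>i\<close> of \<open>m\<close> is zero.
  The cyclic condition in \<open>slots\<close> says that the chosen term is present.\<close>

definition mirror :: "nat \<times> nat \<Rightarrow> nat \<times> nat" where
  "mirror = (\<lambda>(i, k). if \<pi> i = i then (i, \<pi> k) else (\<pi> i, k))"

lemma mirror_fixed: "\<pi> i = i \<Longrightarrow> mirror (i, k) = (i, \<pi> k)"
  and mirror_nonfixed: "\<pi> i \<noteq> i \<Longrightarrow> mirror (i, k) = (\<pi> i, k)"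
  by (simp_all add: mirror_def)

lemma mirror_mirror: "p \<in> square \<Longrightarrow> mirror (mirror p) = p"
  by (auto simp: mirror_def split: prod.splits if_splits)

lemma mirror_in_square: "p \<in> square \<Longrightarrow> mirror p \<in> square"
  by (auto simp: mirror_def split: prod.splits)

lemma slots_fixed:
  "i < N \<Longrightarrow> k < N \<Longrightarrow> \<pi> i = i \<Longrightarrow> (i, k) \<in> slots \<longleftrightarrow> i \<noteq> k \<and> cyc_between i (\<pi> k) k"
  and slots_nonfixed:
  "i < N \<Longrightarrow> k < N \<Longrightarrow> \<pi> i \<noteq> i \<Longrightarrow> (i, k) \<in> slots \<longleftrightarrow> i \<noteq> k \<and> cyc_between i (\<pi> i) k"
  by (simp_all add: slots_def)

lemma coords_subset: "coords \<subseteq> square"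
  by (auto simp: slots_def coords_def chord_coords_def)

lemma finite_coords: "finite coords"
  using coords_subset by (rule finite_subset) simp

lemma slots_not_chord: "(i, k) \<in> slots \<Longrightarrow> k \<noteq> \<pi> i"
  by (auto simp: slots_def cyc_between_def split: if_splits)

lemma coords_fixed:
  assumes "i < N" "k < N" "\<pi> i = i"
  shows "(i, k) \<in> coords \<longleftrightarrow> i \<noteq> k \<and> cyc_between i (\<pi> k) k"
  using assms unfolding coords_def chord_coords_def by (simp add: slots_fixed)

lemma coords_nonfixed:
  assumes "i < N" "k < N" "\<pi> i \<noteq> i"
  shows "(i, k) \<in> coords \<longleftrightarrow> k = \<pi> i \<or> i \<noteq> k \<and> cyc_between i (\<pi> i) k"
  using assms unfolding coords_def chord_coords_def by (auto simp: slots_nonfixed)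

text \<open>Exchanging \<open>i\<close> with \<open>\<pi> i\<close>, or \<open>k\<close> with
  \<open>\<pi> k\<close> when \<open>i\<close> is fixed, reverses the cyclic order that membership
  depends on. The degenerate case \<open>k = \<pi> i\<close> is exchanged with
  \<open>k = i\<close>.\<close>

lemma coords_mirror:
  assumes "i < N" "k < N" "\<not> (i = k \<and> \<pi> i = i)"
  shows "mirror (i, k) \<in> coords \<longleftrightarrow> (i, k) \<notin> coords"
proof (cases "\<pi> i = i")
  case True
  then have ik: "i \<noteq> k" using assms by blast
  have kk: "\<pi> k \<noteq> k" using fixed_unique[OF assms(1) True assms(2)] ik by blast
  have ki: "\<pi> k \<noteq> i" using True ik \<pi>_\<pi>[OF assms(2)] by auto
  have "(i, \<pi> k) \<in> coords \<longleftrightarrow> i \<noteq> \<pi> k \<and> cyc_between i k (\<pi> k)"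
    using coords_fixed[OF assms(1) \<pi>_less[OF assms(2)] True] unfolding \<pi>_\<pi>[OF assms(2)] .
  also have "\<dots> \<longleftrightarrow> \<not> (i \<noteq> k \<and> cyc_between i (\<pi> k) k)"
    using cyc_between_flip[of i k "\<pi> k"] ik kk ki by blast
  finally show ?thesis unfolding mirror_fixed[OF True] coords_fixed[OF assms(1,2) True] .
next
  case False
  have ii: "\<pi> (\<pi> i) \<noteq> \<pi> i" using False \<pi>_\<pi>[OF assms(1)] by metis
  have L: "(\<pi> i, k) \<in> coords \<longleftrightarrow> k = i \<or> \<pi> i \<noteq> k \<and> cyc_between (\<pi> i) i k"
    using coords_nonfixed[OF \<pi>_less[OF assms(1)] assms(2) ii] unfolding \<pi>_\<pi>[OF assms(1)] .
  have "k = i \<or> \<pi> i \<noteq> k \<and> cyc_between (\<pi> i) i k \<longleftrightarrow>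
      \<not> (k = \<pi> i \<or> i \<noteq> k \<and> cyc_between i (\<pi> i) k)"
    using cyc_between_swap[of i k "\<pi> i"] False by metis
  then show ?thesis unfolding mirror_nonfixed[OF False] L coords_nonfixed[OF assms(1,2) False] .
qed

text \<open>\<open>mirror\<close> exchanges \<open>coords\<close> with its complement in the square
  without \<open>F\<close>, so \<open>card coords\<close> is half of
  \<open>N * N - N mod 2\<close>.\<close>

lemma card_coords: "card coords = N\<^sup>2 div 2"
proof -
  define F where "F = (\<lambda>i. (i, i)) ` {i. i < N \<and> \<pi> i = i}"
  have F_iff: "(i, k) \<in> F \<longleftrightarrow> i = k \<and> i < N \<and> \<pi> i = i" for i k
    unfolding F_def image_iff by simp metis
  have F: "F \<subseteq> square" using F_iff by (intro subrelI) simp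
  have finF: "finite F" unfolding F_def by simp
  have notF: "p \<notin> F" if "p \<in> coords" for p
  proof (cases p)
    case (Pair i k)
    have "(i, i) \<notin> coords" by (simp add: coords_def slots_def chord_coords_def)
    then show ?thesis using that F_iff[of i k] unfolding Pair by metis
  qed
  have mF: "mirror p \<notin> F" if "p \<in> square" "p \<notin> F" for p
  proof
    assume mp: "mirror p \<in> F"
    obtain i k where ik: "mirror p = (i, k)" by fastforce
    then have i: "i = k" "i < N" "\<pi> i = i" using mp F_iff[of i k] unfolding ik by blast+
    have "p = mirror (i, k)" using mirror_mirror[OF that(1)] ik by simp
    then have "p = (i, i)" using i by (simp add: mirror_fixed)
    then show False using that(2) F_iff[of i i] i by simp
  qed
  have m: "mirror p \<in> coords \<longleftrightarrow> p \<notin> coords" if p: "p \<in> square" "p \<notin> F" for p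
  proof -
    obtain i k where ik: "p = (i, k)" by fastforce
    have "\<not> (i = k \<and> \<pi> i = i)" using p F_iff[of i k] unfolding ik by simp
    then show ?thesis using coords_mirror[of i k] p(1) unfolding ik by simp
  qed
  have inF: "p \<in> square - F" if "p \<in> coords" for p using that notF coords_subset by blast
  have bij: "bij_betw mirror coords (square - F - coords)"
  proof (rule bij_betw_byWitness[where f' = mirror])
    show "\<forall>a\<in>coords. mirror (mirror a) = a" 
      by (intro ballI mirror_mirror) (rule DiffD1[OF inF])
    show "\<forall>a'\<in>square - F - coords. mirror (mirror a') = a'"
      by (intro ballI mirror_mirror) (elim DiffE)
    show "mirror ` coords \<subseteq> square - F - coords"
    proof (intro image_subsetI DiffI)
      fix p assume p: "p \<in> coords"
      have p': "p \<in> square" "p \<notin> F" using inF[OF p] by blast+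
      show "mirror p \<in> square" by (rule mirror_in_square[OF p'(1)])
      show "mirror p \<notin> F" by (rule mF[OF p'])
      show "mirror p \<notin> coords" using m[OF p'] p by blast
    qed
    show "mirror ` (square - F - coords) \<subseteq> coords"
    proof (intro image_subsetI)
      fix p assume p: "p \<in> square - F - coords"
      then have "p \<in> square" "p \<notin> F" "p \<notin> coords" by blast+
      then show "mirror p \<in> coords" using m by blast
    qed
  qed
  note 1 = bij_betw_same_card[OF bij]
  have sub: "coords \<subseteq> square - F" by (rule subsetI) (rule inF)
  have fin: "finite (square - F)" by (intro finite_Diff finite_SigmaI finite_lessThan)
  have le: "card coords \<le> card (square - F)" by (rule card_mono[OF fin sub])
  have "card coords = card (square - F) - card coords"
    using 1 card_Diff_subset[OF finite_coords sub] by (rule trans)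
  then have 2: "card (square - F) = 2 * card coords" using le by linarith
  have "card F = N mod 2"
    using card_fixed unfolding F_def by (subst card_image) (rule inj_onI, simp)
  moreover have "card square = N * N" by (simp add: card_cartesian_product)
  ultimately have 3: "card (square - F) = N * N - N mod 2"
    using card_Diff_subset[OF finF F] by (simp only:)
  have "(N * N) mod 2 = N mod 2" unfolding mod_2_eq_odd by simp
  then have "N * N - N mod 2 = 2 * (N * N div 2)"
    using minus_mod_eq_mult_div[of "N * N" 2] by (simp only:)
  then show ?thesis using 2 3 unfolding power2_eq_square by linarith
qed

text \<open>The slice transversal to the centralizer: conjugating entries are allowed at mirrored
  slots only, and a chord coordinate \<open>(i, \<pi> i)\<close> is stored at
  \<open>(i, i)\<close>.\<close>

definition embed :: "(nat \<times> nat \<Rightarrow> complex) \<Rightarrow> nat \<times> nat \<Rightarrow> complex" where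
  "embed t = (\<lambda>(i, k). if i = k then if \<pi> i = i then 0 else t (i, \<pi> i)
     else if mirror (i, k) \<in> slots then t (mirror (i, k)) else 0)"

lemma polynomial_in_embed:
  assumes "p \<in> square"
  shows "polynomial_in coords (\<lambda>t. embed t p)"
proof (cases p)
  case (Pair i k)
  then have i: "i < N" using assms by simp
  consider "i = k" "\<pi> i = i" | "i = k" "\<pi> i \<noteq> i" | "i \<noteq> k" "mirror (i, k) \<in> slots"
    | "i \<noteq> k" "mirror (i, k) \<notin> slots" by blast
  then show ?thesis
  proof cases
    case 2
    then have "(i, \<pi> i) \<in> coords" using i by (simp add: coords_def chord_coords_def)
    then show ?thesis using 2 by (simp add: Pair embed_def polynomial_in.var)
  next
    case 3
    then have "mirror (i, k) \<in> coords" by (simp add: coords_def)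
    then show ?thesis using 3 by (simp add: Pair embed_def polynomial_in.var)
  qed (simp_all add: Pair embed_def polynomial_in.const)
qed

text \<open>An array \<open>w\<close> is split into a part supported on the mirrored slots and a part that commutes with
  the chord array modulo distance \<open>N\<close>. When \<open>i, \<pi> i, k, \<pi> k\<close> are in cyclic order, \<open>w (i, k)\<close> is
  compensated by a multiple of \<open>w (\<pi> i, \<pi> k)\<close>.\<close>

definition centralizer_part :: "(nat \<Rightarrow> complex) \<Rightarrow> (nat \<times> nat \<Rightarrow> complex) \<Rightarrow> nat \<times> nat \<Rightarrow> complex" where
  "centralizer_part a w = (\<lambda>(p, q). if mirror (p, q) \<in> slots
     then if \<pi> p \<noteq> p \<and> cyc_between (\<pi> p) (\<pi> q) q \<and> cyc_between (\<pi> p) p (\<pi> q)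
       then a (\<pi> q) / a (\<pi> p) * w (\<pi> p, \<pi> q) else 0
     else w (p, q))"

lemma centralizer_part_scale:
  "centralizer_part a (\<lambda>p. t * w p) q = t * centralizer_part a w q"
  by (simp add: centralizer_part_def case_prod_unfold)

text \<open>The cases are which of the two terms of the commutator are present. If both are and
  \<open>i, \<pi> i, \<pi> k, k\<close> are in cyclic order, then \<open>z (\<pi> i, k)\<close> is
  the multiple of \<open>w (i, \<pi> k)\<close> that makes them cancel. If instead the chords cross,
  both entries of \<open>z\<close> are zero.\<close>

lemma centralizer_part_entries:
  fixes w :: "nat \<times> nat \<Rightarrow> complex"
  assumes ik: "i < N" "k < N" "i \<noteq> k" and a: "\<And>i. i < N \<Longrightarrow> \<pi> i \<noteq> i \<Longrightarrow> a i \<noteq> 0"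
  defines "z \<equiv> centralizer_part a w"
  shows "(if \<pi> k \<noteq> k \<and> cyc_between i (\<pi> k) k then z (i, \<pi> k) * a (\<pi> k) else 0) =
    (if \<pi> i \<noteq> i \<and> cyc_between i (\<pi> i) k then a i * z (\<pi> i, k) else 0)"
proof -
  have R: "z (\<pi> i, k) = (if cyc_between i (\<pi> k) k \<and> cyc_between i (\<pi> i) (\<pi> k)
      then a (\<pi> k) / a i * w (i, \<pi> k) else 0)" if i: "\<pi> i \<noteq> i" "cyc_between i (\<pi> i) k"
  proof -
    have "\<pi> (\<pi> i) \<noteq> \<pi> i" using i ik by auto
    moreover have "(i, k) \<in> slots" using i ik by (simp add: slots_nonfixed)
    ultimately show ?thesis using i ik by (simp add: z_def centralizer_part_def mirror_nonfixed)
  qed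
  consider (both) "\<pi> k \<noteq> k" "cyc_between i (\<pi> k) k" "\<pi> i \<noteq> i" "cyc_between i (\<pi> i) k"
    | (left) "\<pi> k \<noteq> k" "cyc_between i (\<pi> k) k" "\<not> (\<pi> i \<noteq> i \<and> cyc_between i (\<pi> i) k)"
    | (right) "\<not> (\<pi> k \<noteq> k \<and> cyc_between i (\<pi> k) k)" "\<pi> i \<noteq> i" "cyc_between i (\<pi> i) k"
    | (none) "\<not> (\<pi> k \<noteq> k \<and> cyc_between i (\<pi> k) k)" "\<not> (\<pi> i \<noteq> i \<and> cyc_between i (\<pi> i) k)" by blast
  then show ?thesis
  proof cases
    case both
    have ne: "\<pi> i \<noteq> \<pi> k" "\<pi> k \<noteq> i" "\<pi> i \<noteq> k"
      using ik both cyc_between_neq[OF ik(3)] by (metis \<pi>_\<pi>)+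
    show ?thesis
    proof (cases "cyc_between i (\<pi> i) (\<pi> k)")
      case True
      then have "\<not> cyc_between (\<pi> i) i (\<pi> k)" using ne both by (subst cyc_between_swap) auto
      then have "mirror (i, \<pi> k) \<notin> slots" using both ik by (simp add: mirror_nonfixed slots_nonfixed)
      then have "z (i, \<pi> k) = w (i, \<pi> k)" by (simp add: z_def centralizer_part_def)
      then show ?thesis using both True R a ik by simp
    next
      case False
      then have "cyc_between (\<pi> i) i (\<pi> k)" using ne both by (subst cyc_between_swap) auto
      then have "mirror (i, \<pi> k) \<in> slots"
        using both ik ne by (simp add: mirror_nonfixed slots_nonfixed)
      moreover have "\<not> cyc_between (\<pi> i) i k" using both ik ne by (subst cyc_between_swap) auto
      ultimately have "z (i, \<pi> k) = 0" using ik by (simp add: z_def centralizer_part_def)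
      then show ?thesis using both False R by simp
    qed
  next
    case left
    have "z (i, \<pi> k) = 0"
    proof (cases "\<pi> i = i")
      case True
      then have "mirror (i, \<pi> k) \<in> slots" using left ik by (simp add: mirror_fixed slots_fixed)
      then show ?thesis using True by (simp add: z_def centralizer_part_def)
    next
      case False
      have ne: "\<pi> i \<noteq> \<pi> k" "\<pi> k \<noteq> i" "\<pi> i \<noteq> k"
        using ik left cyc_between_neq[OF ik(3)] by (metis \<pi>_\<pi>)+
      have c: "cyc_between (\<pi> i) i k" using left False ne ik by (subst cyc_between_swap) auto
      have "cyc_between (\<pi> i) i (\<pi> k) \<and> \<not> cyc_between (\<pi> i) k (\<pi> k)"
        using c left(2) ne ik(3) left(1) False by (auto simp: cyc_between_def)
      then show ?thesis using left False ik ne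
        by (simp add: z_def centralizer_part_def mirror_nonfixed slots_nonfixed)
    qed
    then show ?thesis using left by auto
  next
    case right
    have "\<not> cyc_between i (\<pi> k) k" using right(1) ik by (cases "\<pi> k = k") (auto simp: cyc_between_def)
    then show ?thesis using right R by auto
  next
    case none
    show ?thesis unfolding if_not_P[OF none(1)] if_not_P[OF none(2)] ..
  qed
qed

lemma centralizer_part_commutes:
  assumes a: "\<And>i. i < N \<Longrightarrow> \<pi> i \<noteq> i \<Longrightarrow> a i \<noteq> 0"
  shows "trunc_cong N (unipotent_part (centralizer_part a w) * chord_array a)
    (chord_array a * unipotent_part (centralizer_part a w))"
proof -
  let ?Z = "unipotent_part (centralizer_part a w)"
  note Z = periodic_unipotent_part[of "centralizer_part a w"]
    vanishes_below_unipotent_part[of "centralizer_part a w"]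
  show ?thesis
  proof (subst trunc_cong_period_iff; (intro allI impI)?)
    fix i k assume ik: "i < N" "k < N" "i \<noteq> k"
    have 1: "cyc_entry N ?Z i (\<pi> k) = centralizer_part a w (i, \<pi> k)" if "cyc_between i (\<pi> k) k"
      using ik that cyc_between_neq[OF ik(3) that] by (simp add: cyc_entry_unipotent_part)
    have 2: "cyc_entry N ?Z (\<pi> i) k = centralizer_part a w (\<pi> i, k)" if "cyc_between i (\<pi> i) k"
      using ik that cyc_between_neq[OF ik(3) that] by (simp add: cyc_entry_unipotent_part)
    show "cyc_entry N (?Z * chord_array a) i k = cyc_entry N (chord_array a * ?Z) i k"
      unfolding cyc_entry_mult_chord_array[OF Z ik(1,2)] cyc_entry_chord_array_mult[OF Z ik(1,2)]
      using 1 2 centralizer_part_entries[OF ik, of a w, OF a] by (auto split: if_splits)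
  qed (auto intro: periodic_mult periodic_unipotent_part periodic_chord_array pos
      vanishes_below_mult_left vanishes_below_unipotent_part vanishes_below_chord_array)
qed

end

lemma cyc_entry_mult_scale:
  assumes "periodic N x" "vanishes_below 1 x" "periodic N y" "vanishes_below 1 y"
    "periodic N x'" "vanishes_below 1 x'" "periodic N y'" "vanishes_below 1 y'"
    and ik: "i < N" "k < N" "i \<noteq> k"
    and s: "\<And>i k. i < N \<Longrightarrow> k < N \<Longrightarrow> i \<noteq> k \<Longrightarrow> cyc_entry N x' i k = t * cyc_entry N x i k"
      "\<And>i k. i < N \<Longrightarrow> k < N \<Longrightarrow> i \<noteq> k \<Longrightarrow> cyc_entry N y' i k = t * cyc_entry N y i k"
  shows "cyc_entry N (x' * y') i k = t\<^sup>2 * cyc_entry N (x * y) i k"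
proof -
  have "cyc_entry N (x' * y') i k = (\<Sum>l | l < N \<and> cyc_between i l k. cyc_entry N x' i l * cyc_entry N y' l k)"
    by (rule cyc_entry_mult[OF assms(5-8) ik(1,2)])
  also have "\<dots> = (\<Sum>l | l < N \<and> cyc_between i l k. t\<^sup>2 * (cyc_entry N x i l * cyc_entry N y l k))"
  proof (rule sum.cong[OF refl])
    fix l assume "l \<in> {l. l < N \<and> cyc_between i l k}"
    then have l: "l < N" "l \<noteq> i" "l \<noteq> k" using cyc_between_neq[OF ik(3)] by blast+
    show "cyc_entry N x' i l * cyc_entry N y' l k = t\<^sup>2 * (cyc_entry N x i l * cyc_entry N y l k)"
      unfolding s(1)[OF ik(1) l(1) l(2)[symmetric]] s(2)[OF l(1) ik(2) l(3)] by (simp add: power2_eq_square)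
  qed
  also have "\<dots> = t\<^sup>2 * cyc_entry N (x * y) i k"
    unfolding cyc_entry_mult[OF assms(1-4) ik(1,2)] by (simp add: sum_distrib_left)
  finally show ?thesis .
qed

lemma cyc_between_crossing:
  assumes "cyc_between i k' i'" "cyc_between i i' k" "i \<noteq> k" "i \<noteq> i'"
  shows "k' \<noteq> k" "cyc_between i k' k" "cyc_between i' i k'" "cyc_between i' k i"
  using assms unfolding cyc_between_def by linarith+

context link
begin

lemma trunc_cong_chord_array:
  assumes "\<And>i. i < N \<Longrightarrow> \<pi> i \<noteq> i \<Longrightarrow> a i = b i"
  shows "trunc_cong N (chord_array a) (chord_array b)"
  unfolding trunc_cong_period_iff[OF periodic_chord_array periodic_chord_array
      vanishes_below_chord_array vanishes_below_chord_array pos]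
  using assms by (auto simp: cyc_entry_chord_array)

text \<open>Conjugation by \<open>(1 + C) (1 + Z)\<close> with \<open>Z\<close> commuting with the chord array is conjugation by
  \<open>1 + C\<close>.\<close>

lemma param_eq_of_factorization:
  assumes Z: "trunc_cong N (Z * chord_part y) (chord_part y * Z)"
    and u: "trunc_cong N (1 + unipotent_part y) ((1 + unipotent_part y') * (1 + Z))"
    and m: "trunc_cong N (chord_part y') (chord_part y)"
  shows "param y' = param y"
proof -
  let ?X = "conjugate y'" and ?C = "unipotent_part y'" and ?m = "chord_part y"
  have 1: "trunc_cong N (?X * (1 + unipotent_part y)) (?X * ((1 + ?C) * (1 + Z)))"
    by (rule trunc_cong_mult[OF trunc_cong_refl u])
  have 2: "trunc_cong N (?X * ((1 + ?C) * (1 + Z))) ((1 + ?C) * ?m * (1 + Z))"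
  proof -
    have "trunc_cong N (?X * (1 + ?C)) ((1 + ?C) * ?m)"
      by (rule trunc_cong_trans[OF trunc_cong_mono[OF conjugate_intertwines]])
        (simp, rule trunc_cong_mult[OF trunc_cong_refl m])
    then have "trunc_cong N (?X * (1 + ?C) * (1 + Z)) ((1 + ?C) * ?m * (1 + Z))"
      by (rule trunc_cong_mult[OF _ trunc_cong_refl])
    then show ?thesis by (simp only: mult.assoc)
  qed
  have 3: "trunc_cong N ((1 + ?C) * ?m * (1 + Z)) ((1 + ?C) * (1 + Z) * ?m)"
  proof -
    have "trunc_cong N (?m + ?m * Z) (?m + Z * ?m)"
      by (intro trunc_cong_add trunc_cong_refl trunc_cong_sym[OF Z])
    then have "trunc_cong N (?m * (1 + Z)) ((1 + Z) * ?m)"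
      by (simp only: distrib_left distrib_right mult_1_left mult_1_right)
    then have "trunc_cong N ((1 + ?C) * (?m * (1 + Z))) ((1 + ?C) * ((1 + Z) * ?m))"
      by (rule trunc_cong_mult[OF trunc_cong_refl])
    then show ?thesis by (simp only: mult.assoc)
  qed
  have 4: "trunc_cong N ((1 + ?C) * (1 + Z) * ?m) ((1 + unipotent_part y) * ?m)"
    by (rule trunc_cong_mult[OF trunc_cong_sym[OF u] trunc_cong_refl])
  from trunc_cong_trans[OF trunc_cong_trans[OF trunc_cong_trans[OF 1 2] 3] 4] have "trunc_cong N ?X (conjugate y)" by (rule conjugate_unique)
  then show ?thesis
    unfolding param_def mat_of_array_eq_iff[OF periodic_conjugate periodic_conjugate
        vanishes_below_conjugate_param vanishes_below_conjugate_param pos] .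
qed

text \<open>The tangent directions of the restricted parametrization at the chord array, together with those
  of the centralizer, exhaust all directions.\<close>

lemma embed_dense:
  assumes F: "polynomial_in square F" and inv: "\<And>y y'. param y = param y' \<Longrightarrow> F y = F y'"
    and zero: "\<And>t. F (embed t) = 0"
  shows "F y = 0"
proof -
  \<comment> \<open>The chord entries are kept from \<open>y\<close> and only the conjugating
    entries vary, around the unconjugated chord array at \<open>w = 0\<close>.\<close>
  define on_diag where "on_diag y w = (\<lambda>p. if fst p = snd p then y p else w p)"
    for y w :: "nat \<times> nat \<Rightarrow> complex"
  have nonzero: "F y = 0" if a: "\<And>i. i < N \<Longrightarrow> \<pi> i \<noteq> i \<Longrightarrow> y (i, i) \<noteq> 0" for y
  proof -
    let ?a = "\<lambda>i. y (i, i)"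
    let ?z = "centralizer_part ?a"
    have G: "polynomial_in square (\<lambda>w. F (on_diag y w))"
      unfolding on_diag_def
      by (rule polynomial_in_compose[OF F]) (intro polynomial_in_if polynomial_in.const polynomial_in.var)
    have "F (on_diag y w0) = 0" for w0
    proof (rule polynomial_in_zero_of_curves[OF G, where c = "\<lambda>_. 0"])
      fix w :: "nat \<times> nat \<Rightarrow> complex"
      define c where "c p = w p - ?z w p" for p
      \<comment> \<open>The quadratic correction that makes the conjugating array equal to the
        product of \<open>1 + t c\<close> and \<open>1 + t z\<close> modulo distance
        \<open>N\<close>, with \<open>z\<close> the centralizer part.\<close>
      define \<kappa> where "\<kappa> = (\<lambda>(i, k). cyc_entry N (unipotent_part c * unipotent_part (?z w)) i k)"
      define \<gamma> where "\<gamma> t = (\<lambda>p. t * w p + t\<^sup>2 * \<kappa> p)" for t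
      have "F (on_diag y (\<gamma> t)) = 0" for t
      proof -
        \<comment> \<open>Parameters of the slice with chord entries \<open>y (i, i)\<close> and
          conjugating entries \<open>t * c\<close>. The latter vanish outside the mirrored slots
          because \<open>c\<close> does.\<close>
        define s where "s = (\<lambda>(i, k). if k = \<pi> i then y (i, i) else t * c (mirror (i, k)))"
        define yt where "yt = on_diag y (\<gamma> t)"
        let ?C = "unipotent_part (embed s)" and ?Z = "unipotent_part (?z (\<lambda>p. t * w p))"
        have off: "embed s (i, k) = t * c (i, k)" if ik: "i < N" "k < N" "i \<noteq> k" for i k
        proof (cases "mirror (i, k) \<in> slots")
          case True
          obtain i' k' where m: "mirror (i, k) = (i', k')" by fastforce
          then have "k' \<noteq> \<pi> i'" using True slots_not_chord by simp
          then have "s (mirror (i, k)) = t * c (mirror (mirror (i, k)))" by (simp add: m s_def)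
          then show ?thesis using True ik mirror_mirror[of "(i, k)"] by (simp add: embed_def)
        next
          case False
          then have "?z w (i, k) = w (i, k)" by (simp add: centralizer_part_def)
          then show ?thesis using False ik by (simp add: embed_def c_def)
        qed
        have diag: "embed s (i, i) = y (i, i)" if "i < N" "\<pi> i \<noteq> i" for i
          using that by (simp add: embed_def s_def)
        have cp: "chord_part yt = chord_array ?a"
          by (simp add: chord_part_def yt_def on_diag_def)
        have "param (embed s) = param yt"
        proof (rule param_eq_of_factorization[where Z = ?Z])
          show "trunc_cong N (?Z * chord_part yt) (chord_part yt * ?Z)"
            unfolding cp by (rule centralizer_part_commutes) (rule a)
          show "trunc_cong N (chord_part (embed s)) (chord_part yt)"
            unfolding cp unfolding chord_part_def by (rule trunc_cong_chord_array) (rule diag)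
          have CZ: "periodic N (?C + ?Z + ?C * ?Z)" "vanishes_below 1 (?C + ?Z + ?C * ?Z)"
            by (intro periodic_add periodic_mult periodic_unipotent_part)
              (intro vanishes_below_add vanishes_below_mult_left vanishes_below_unipotent_part)
          have "trunc_cong N (unipotent_part yt) (?C + ?Z + ?C * ?Z)"
            unfolding trunc_cong_period_iff[OF periodic_unipotent_part CZ(1) vanishes_below_unipotent_part CZ(2) pos]
          proof (intro allI impI)
            fix i k assume ik: "i < N" "k < N" "i \<noteq> k"
            have "cyc_entry N (?C * ?Z) i k = t\<^sup>2 * cyc_entry N (unipotent_part c * unipotent_part (?z w)) i k"
              by (rule cyc_entry_mult_scale[OF _ _ _ _ _ _ _ _ ik])
                (simp_all add: periodic_unipotent_part vanishes_below_unipotent_part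
                  cyc_entry_unipotent_part off centralizer_part_scale)
            then show "cyc_entry N (unipotent_part yt) i k = cyc_entry N (?C + ?Z + ?C * ?Z) i k"
              using ik by (simp add: cyc_entry_add cyc_entry_unipotent_part off centralizer_part_scale
                  yt_def on_diag_def \<gamma>_def \<kappa>_def c_def algebra_simps)
          qed
          then have "trunc_cong N (1 + unipotent_part yt) (1 + (?C + ?Z + ?C * ?Z))"
            by (intro trunc_cong_add trunc_cong_refl)
          moreover have "1 + (?C + ?Z + ?C * ?Z) = (1 + ?C) * (1 + ?Z)"
            by (simp add: distrib_left distrib_right add.assoc add.left_commute)
          ultimately show "trunc_cong N (1 + unipotent_part yt) ((1 + ?C) * (1 + ?Z))" by simp
        qed
        then show ?thesis using inv[of "embed s" yt] zero[of s] by (simp add: yt_def)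
      qed
      moreover have "\<gamma> 0 p = 0" "((\<lambda>t. \<gamma> t p) has_field_derivative w p) (at 0)" for p
        unfolding \<gamma>_def by (auto intro!: derivative_eq_intros)
      ultimately show "\<exists>\<gamma>. (\<forall>p\<in>square. \<gamma> 0 p = 0 \<and> ((\<lambda>t. \<gamma> t p) has_field_derivative w p) (at 0)) \<and>
          (\<forall>\<^sub>F t in at 0. F (on_diag y (\<gamma> t)) = 0)"
        by (intro exI[of _ \<gamma>]) simp
    qed
    from this[of y] show ?thesis by (simp add: on_diag_def)
  qed
  \<comment> \<open>Vanishing chord entries were excluded so far. Multiplying \<open>F\<close> by
    the product of the chord entries gives a polynomial that vanishes everywhere.\<close>
  have "(\<forall>y. F y = 0) \<or> (\<forall>y :: nat \<times> nat \<Rightarrow> complex. (\<Prod>i\<in>{i. i < N \<and> \<pi> i \<noteq> i}. y (i, i)) = 0)"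
  proof (rule polynomial_in_no_zero_divisors[OF F])
    show "polynomial_in square (\<lambda>y. \<Prod>i\<in>{i. i < N \<and> \<pi> i \<noteq> i}. y (i, i))"
      by (intro polynomial_in_prod polynomial_in.var) auto
    show "F y * (\<Prod>i\<in>{i. i < N \<and> \<pi> i \<noteq> i}. y (i, i)) = 0" for y
    proof (cases "\<forall>i. i < N \<longrightarrow> \<pi> i \<noteq> i \<longrightarrow> y (i, i) \<noteq> 0")
      case True
      then show ?thesis using nonzero[of y] by simp
    next
      case False
      then have "(\<Prod>i\<in>{i. i < N \<and> \<pi> i \<noteq> i}. y (i, i)) = 0" by (intro prod_zero) auto
      then show ?thesis by simp
    qed
  qed
  moreover have "\<not> (\<forall>y :: nat \<times> nat \<Rightarrow> complex. (\<Prod>i\<in>{i. i < N \<and> \<pi> i \<noteq> i}. y (i, i)) = 0)"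
    by (rule notI, drule spec[of _ "\<lambda>_. 1"]) simp
  ultimately show ?thesis by blast
qed

text \<open>On the slice, more than \<open>card coords\<close> functions satisfy a polynomial
  relation; by density of the slice this relation holds on the whole locus.\<close>

lemma krull_dim_locus_le:
  "krull_dim (subtopology (zariski N) (link_pattern_locus N \<pi>)) \<le> enat (N\<^sup>2 div 2)"
proof (rule krull_dim_zariski_le[OF locus_subset_carrier], rule ccontr)
  fix k and f :: "nat \<Rightarrow> complex mat \<Rightarrow> complex"
  assume f: "\<And>i. i < k \<Longrightarrow> poly_fun N (f i)"
    and indep: "algebraically_independent_on {..<k} f (link_pattern_locus N \<pi>)"
    and "\<not> k \<le> N\<^sup>2 div 2"
  then have card: "card coords < card {..<k}" by (simp add: card_coords)
  have param_embed: "polynomial_in coords (\<lambda>t. param (embed t) $$ (i, j))" if "i < N" "j < N" for i j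
    by (rule polynomial_in_compose[OF polynomial_in_param[OF that]]) (rule polynomial_in_embed)
  have pf: "polynomial_in coords (\<lambda>t. f i (param (embed t)))" if "i \<in> {..<k}" for i
    by (rule polynomial_in_compose_poly_fun[OF f param_embed]) (use that in simp_all)
  from algebraically_dependent[OF finite_coords finite_lessThan card pf]
  obtain P where "polynomial_in {..<k} P \<and> (\<exists>y. P y \<noteq> 0) \<and> (\<forall>t. P (\<lambda>i. f i (param (embed t))) = 0)" ..
  then have P: "polynomial_in {..<k} P" "\<exists>y. P y \<noteq> 0" "\<And>t. P (\<lambda>i. f i (param (embed t))) = 0"
    by blast+
  have "P (\<lambda>i. f i (param y)) = 0" for y
  proof (rule embed_dense[where F = "\<lambda>y. P (\<lambda>i. f i (param y))"])
    show "polynomial_in square (\<lambda>y. P (\<lambda>i. f i (param y)))"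
      by (rule polynomial_in_compose[OF P(1)])
        (rule polynomial_in_compose_poly_fun[OF f polynomial_in_param], simp_all)
  qed (simp_all add: P(3))
  then have "\<forall>M\<in>link_pattern_locus N \<pi>. P (\<lambda>i. f i M) = 0"
    using locus_subset_range_param by auto
  moreover have "(\<forall>M\<in>link_pattern_locus N \<pi>. P (\<lambda>i. f i M) = 0) \<longrightarrow> (\<forall>y. P y = 0)"
    using indep P(1) unfolding algebraically_independent_on_def by blast
  ultimately show False using P(2) by blast
qed

text \<open>The linear change of coordinates that makes the derivative of the restricted parametrization at
  \<open>base_chord\<close> the identity. It couples the slots \<open>(i, k)\<close> and \<open>(\<pi> i, \<pi> k)\<close> when the two chords
  cross, by a system with determinant \<open>\<plusminus>(chord_value k - chord_value i)\<close>.\<close>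

definition crossing :: "nat \<Rightarrow> nat \<Rightarrow> bool" where
  "crossing i k \<longleftrightarrow> cyc_between i (\<pi> k) (\<pi> i) \<and> cyc_between i (\<pi> i) k"

definition straightened :: "(nat \<times> nat \<Rightarrow> complex) \<Rightarrow> nat \<times> nat \<Rightarrow> complex" where
  "straightened z = (\<lambda>(p, q).
     if p = q then base_chord p + (if \<pi> p = p then 0 else z (p, \<pi> p))
     else if mirror (p, q) \<notin> slots then 0
     else if \<pi> p = p then z (p, \<pi> q) / base_chord q
     else if crossing (\<pi> p) q
       then (base_chord p * z (\<pi> p, q) + base_chord (\<pi> q) * z (p, \<pi> q)) /
         (chord_value base_chord q - chord_value base_chord (\<pi> p))
       else - z (\<pi> p, q) / base_chord (\<pi> p))"

text \<open>Crossing is preserved when both chords are reversed, so the coupled positions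
  \<open>(i, k)\<close> and \<open>(\<pi> i, \<pi> k)\<close> are slots together.\<close>

lemma crossing_slots:
  assumes "i < N" "k < N" "i \<noteq> k" "\<pi> i \<noteq> i" "crossing i k"
  shows "\<pi> k \<noteq> k" "\<pi> k \<noteq> i" "\<pi> i \<noteq> k" "\<pi> i \<noteq> \<pi> k" "(\<pi> i, \<pi> k) \<in> slots" "mirror (i, \<pi> k) \<in> slots"
    "crossing (\<pi> i) (\<pi> k)" "cyc_between i (\<pi> k) k"
proof -
  have c: "cyc_between i (\<pi> k) (\<pi> i)" "cyc_between i (\<pi> i) k" using assms by (simp_all add: crossing_def)
  show ne: "\<pi> k \<noteq> i" "\<pi> i \<noteq> k" "\<pi> i \<noteq> \<pi> k"
    using cyc_between_neq[OF _ c(1)] cyc_between_neq[OF assms(3) c(2)] assms(4) by metis+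
  note x = cyc_between_crossing[OF c assms(3) assms(4)[symmetric]]
  show "\<pi> k \<noteq> k" "cyc_between i (\<pi> k) k" by (rule x)+
  have ii: "\<pi> (\<pi> i) = i" "\<pi> (\<pi> k) = k" using assms by simp_all
  show s: "(\<pi> i, \<pi> k) \<in> slots"
    using slots_nonfixed[of "\<pi> i" "\<pi> k"] x ne assms(1,2,4) unfolding ii by simp
  show "mirror (i, \<pi> k) \<in> slots" unfolding mirror_nonfixed[OF assms(4)] by (rule s)
  show "crossing (\<pi> i) (\<pi> k)" unfolding crossing_def ii using x by blast
qed

end

section \<open>Derivatives of curves of arrays at the origin\<close>

definition array_derivative :: "(complex \<Rightarrow> incidence) \<Rightarrow> incidence \<Rightarrow> bool" where
  "array_derivative F F' \<longleftrightarrow>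
    (\<forall>i j. ((\<lambda>t. entry (F t) i j) has_field_derivative entry F' i j) (at 0))"

lemma array_derivative_const: "array_derivative (\<lambda>t. x) 0"
  by (simp add: array_derivative_def)

lemma array_derivative_add:
  "array_derivative F F' \<Longrightarrow> array_derivative G G' \<Longrightarrow> array_derivative (\<lambda>t. F t + G t) (F' + G')"
  by (simp add: array_derivative_def DERIV_add)

lemma array_derivative_uminus: "array_derivative F F' \<Longrightarrow> array_derivative (\<lambda>t. - F t) (- F')"
  by (simp add: array_derivative_def DERIV_minus)

lemma array_derivative_sum:
  "(\<And>a. a \<in> A \<Longrightarrow> array_derivative (F a) (F' a)) \<Longrightarrow>
    array_derivative (\<lambda>t. \<Sum>a\<in>A. F a t) (\<Sum>a\<in>A. F' a)"
  by (induction A rule: infinite_finite_induct) (auto intro: array_derivative_const array_derivative_add)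

lemma array_derivative_mult:
  assumes "array_derivative F F'" "array_derivative G G'"
  shows "array_derivative (\<lambda>t. F t * G t) (F' * G 0 + F 0 * G')"
  unfolding array_derivative_def entry_mult entry_add sum.distrib[symmetric]
proof (intro allI DERIV_sum)
  fix i k j
  show "((\<lambda>t. entry (F t) i j * entry (G t) j k) has_field_derivative
      entry F' i j * entry (G 0) j k + entry (F 0) i j * entry G' j k) (at 0)"
    using DERIV_mult[OF assms(1)[unfolded array_derivative_def, rule_format, of i j]
        assms(2)[unfolded array_derivative_def, rule_format, of j k]]
    by (simp add: ac_simps)
qed

lemma array_derivative_power:
  assumes "array_derivative F F'" "F 0 = 0"
  shows "array_derivative (\<lambda>t. F t ^ m) (if m = 1 then F' else 0)"
proof (induction m)
  case (Suc m)
  have "array_derivative (\<lambda>t. F t ^ Suc m) (F' * F 0 ^ m + F 0 * (if m = 1 then F' else 0))"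
    using array_derivative_mult[OF assms(1) Suc] by simp
  then show ?case using assms(2) by (cases m) auto
qed (simp add: array_derivative_const)

lemma nat_mod_neq:
  assumes "N > 0" "i < k" "k < i + int N"
  shows "nat (i mod int N) \<noteq> nat (k mod int N)"
proof
  assume "nat (i mod int N) = nat (k mod int N)"
  then have "k mod int N = i mod int N" using assms(1) by (simp add: eq_nat_nat_iff)
  then have "int N dvd k - i" by (simp only: mod_eq_dvd_iff)
  then show False using assms zdvd_imp_le[of "int N" "k - i"] by linarith
qed

context link
begin

lemma straightened_scale:
  "p \<noteq> q \<Longrightarrow> straightened (\<lambda>r. t * z r) (p, q) = t * straightened z (p, q)"
  by (simp add: straightened_def distrib_left)

text \<open>By the product rule at \<open>u = 0\<close>, conjugation contributes a commutator and
  the chord array its own derivative; of the Neumann series only the linear term counts.\<close>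

lemma array_derivative_conjugate_straightened:
  fixes z :: "nat \<times> nat \<Rightarrow> complex"
  defines "U \<equiv> \<lambda>z. unipotent_part (straightened z)" and "m \<equiv> chord_array base_chord"
  shows "array_derivative (\<lambda>t. conjugate (straightened (\<lambda>p. t * z p)))
    (U z * m + chord_array (\<lambda>i. if \<pi> i = i then 0 else z (i, \<pi> i)) - m * U z)"
proof -
  let ?y = "\<lambda>t. straightened (\<lambda>p. t * z p)"
  let ?b = "chord_array (\<lambda>i. if \<pi> i = i then 0 else z (i, \<pi> i))"
  have u: "array_derivative (\<lambda>t. unipotent_part (?y t)) (U z)"
    unfolding array_derivative_def
  proof (intro allI)
    fix i k :: int
    show "((\<lambda>t. entry (unipotent_part (?y t)) i k) has_field_derivative entry (U z) i k) (at 0)"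
    proof (cases "i < k \<and> k < i + int N")
      case True
      then have "(\<lambda>t. entry (unipotent_part (?y t)) i k) = (\<lambda>t. t * entry (U z) i k)"
        using nat_mod_neq[OF pos, of i k] unfolding U_def unipotent_part_def entry_periodic_array
        by (simp add: straightened_scale)
      then show ?thesis by (auto intro!: derivative_eq_intros)
    next
      case False
      then show ?thesis unfolding U_def unipotent_part_def entry_periodic_array by auto
    qed
  qed
  have u0: "unipotent_part (?y 0) = 0"
  proof (rule incidence_eqI)
    fix i j
    have s: "straightened (\<lambda>p. 0) (a, b) = 0" if "a \<noteq> b" for a b using that by (simp add: straightened_def)
    show "entry (unipotent_part (?y 0)) i j = entry 0 i j"
    proof (cases "i < j \<and> j < i + int N")
      case True
      then show ?thesis
        using nat_mod_neq[OF pos, of i j] by (simp add: unipotent_part_def entry_periodic_array s)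
    next
      case False
      then show ?thesis unfolding unipotent_part_def entry_periodic_array by auto
    qed
  qed
  have c: "array_derivative (\<lambda>t. chord_part (?y t)) ?b"
    unfolding array_derivative_def
  proof (intro allI)
    fix i k
    define a where "a = nat (i mod int N)"
    have "((\<lambda>t. ?y t (a, a)) has_field_derivative (if \<pi> a = a then 0 else z (a, \<pi> a))) (at 0)"
      by (cases "\<pi> a = a") (auto simp: straightened_def intro!: derivative_eq_intros)
    then show "((\<lambda>t. entry (chord_part (?y t)) i k) has_field_derivative entry ?b i k) (at 0)"
      unfolding chord_part_def chord_array_def entry_periodic_array a_def[symmetric]
      by (cases "i < k \<and> k < i + int N"; cases "nat (k mod int N) = \<pi> a") auto
  qed
  have c0: "chord_part (?y 0) = m"
    by (simp add: chord_part_def m_def straightened_def)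
  have v: "array_derivative (\<lambda>t. truncated_inverse (?y t)) (- U z)"
  proof -
    have "array_derivative (\<lambda>t. truncated_inverse (?y t)) (\<Sum>j<Suc N. if j = 1 then - U z else 0)"
      unfolding truncated_inverse_def
      by (intro array_derivative_sum array_derivative_power array_derivative_uminus u) (use u0 in simp)
    then show ?thesis using pos by (cases "N = Suc 0") simp_all
  qed
  have v0: "truncated_inverse (?y 0) = 1"
  proof -
    have "(\<Sum>j<Suc N. (0 :: incidence) ^ j) = 1" unfolding sum.lessThan_Suc_shift by simp
    then show ?thesis unfolding truncated_inverse_def u0 by simp
  qed
  have "array_derivative (\<lambda>t. conjugate (?y t))
      (((0 + U z) * chord_part (?y 0) + (1 + unipotent_part (?y 0)) * ?b) * truncated_inverse (?y 0) +
        (1 + unipotent_part (?y 0)) * chord_part (?y 0) * (- U z))"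
    unfolding conjugate_def
    by (rule array_derivative_mult[OF array_derivative_mult[OF array_derivative_add[OF array_derivative_const u] c] v])
  then show ?thesis unfolding u0 c0 v0 by simp
qed

lemma straightened_mirror_slot:
  assumes i: "i < N" "k < N" "\<pi> i \<noteq> i" and s: "(i, k) \<in> slots"
  shows "straightened z (\<pi> i, k) = (if crossing i k
    then (base_chord (\<pi> i) * z (i, k) + base_chord (\<pi> k) * z (\<pi> i, \<pi> k)) /
      (chord_value base_chord k - chord_value base_chord i)
    else - z (i, k) / base_chord i)"
proof -
  have ii: "\<pi> (\<pi> i) = i" using i by simp
  have ne: "\<pi> i \<noteq> k" using slots_not_chord[OF s] by simp
  have m: "mirror (\<pi> i, k) = (i, k)" using mirror_nonfixed[of "\<pi> i" k] i(3) unfolding ii by metis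
  have "i \<noteq> \<pi> i" using i(3) by simp
  then show ?thesis unfolding straightened_def using ne m s by (simp add: ii)
qed

text \<open>For \<open>k = \<pi> i\<close> only the chord term contributes. At a slot only the
  commutator does, and \<open>straightened\<close> comes from solving the resulting equations for
  the conjugating entries.\<close>

lemma straightened_entries:
  fixes z :: "nat \<times> nat \<Rightarrow> complex"
  assumes ik: "(i, k) \<in> coords"
  defines "U \<equiv> unipotent_part (straightened z)" and "m \<equiv> chord_array base_chord"
  shows "cyc_entry N (U * m + chord_array (\<lambda>i. if \<pi> i = i then 0 else z (i, \<pi> i)) - m * U) i k = z (i, k)"
proof -
  have N: "i < N" "k < N" "i \<noteq> k" using ik by (auto simp: coords_def slots_def chord_coords_def)
  note U = periodic_unipotent_part[of "straightened z"] vanishes_below_unipotent_part[of "straightened z"]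
  let ?L = "if \<pi> k \<noteq> k \<and> cyc_between i (\<pi> k) k then straightened z (i, \<pi> k) * base_chord (\<pi> k) else 0"
  let ?R = "if \<pi> i \<noteq> i \<and> cyc_between i (\<pi> i) k then base_chord i * straightened z (\<pi> i, k) else 0"
  let ?B = "if k \<noteq> i \<and> k = \<pi> i then if \<pi> i = i then 0 else z (i, \<pi> i) else 0"
  have 1: "cyc_entry N U i (\<pi> k) = straightened z (i, \<pi> k)" if "cyc_between i (\<pi> k) k"
    using N cyc_between_neq[OF N(3) that] by (simp add: U_def cyc_entry_unipotent_part)
  have 2: "cyc_entry N U (\<pi> i) k = straightened z (\<pi> i, k)" if "cyc_between i (\<pi> i) k"
    using N cyc_between_neq[OF N(3) that] by (simp add: U_def cyc_entry_unipotent_part)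
  have L: "cyc_entry N (U * m) i k = ?L"
    unfolding U_def m_def cyc_entry_mult_chord_array[OF U N(1,2)] using 1 by (simp add: U_def)
  have R: "cyc_entry N (m * U) i k = ?R"
    unfolding U_def m_def cyc_entry_chord_array_mult[OF U N(1,2)] using 2 by (simp add: U_def)
  have B: "cyc_entry N (chord_array (\<lambda>i. if \<pi> i = i then 0 else z (i, \<pi> i))) i k = ?B"
    by (rule cyc_entry_chord_array[OF N(1,2)])
  have "?L + ?B - ?R = z (i, k)"
  proof (cases "k = \<pi> i")
    case True
    then have "\<pi> k = i" using N by simp
    then have "\<not> cyc_between i (\<pi> k) k" "\<not> cyc_between i (\<pi> i) k"
      using cyc_between_neq[OF N(3)] True by metis+
    then show ?thesis using True N(3) by simp
  next
    case False
    then have s: "(i, k) \<in> slots" using ik by (simp add: coords_def chord_coords_def)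
    show ?thesis
    proof (cases "\<pi> i = i")
      case True
      then have c: "cyc_between i (\<pi> k) k" using s N by (simp add: slots_fixed)
      then have k: "\<pi> k \<noteq> k" "\<pi> k \<noteq> i" using cyc_between_neq[OF N(3)] by blast+
      have "straightened z (i, \<pi> k) = z (i, k) / base_chord (\<pi> k)"
        using True k s N by (simp add: straightened_def mirror_fixed)
      then show ?thesis using True c k False base_chord_nonzero[of "\<pi> k"] by simp
    next
      case nf: False
      then have c: "cyc_between i (\<pi> i) k" using s N by (simp add: slots_nonfixed)
      note R' = straightened_mirror_slot[OF N(1,2) nf s, of z]
      show ?thesis
      proof (cases "crossing i k")
        case True
        note x = crossing_slots[OF N nf True]
        have ii: "\<pi> (\<pi> i) = i" "\<pi> (\<pi> k) = k" using N by simp_all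
        define D where "D = chord_value base_chord k - chord_value base_chord i"
        have D: "D = base_chord k * base_chord (\<pi> k) - base_chord i * base_chord (\<pi> i)"
          using nf x(1) by (simp add: D_def chord_value_def)
        have "discriminant (chord_value base_chord) \<noteq> 0" by (rule discriminant_base_chord)
        then have D0: "D \<noteq> 0"
          using N False unfolding discriminant_nonzero_iff D_def by (metis eq_iff_diff_eq_0 insertE singletonD)
        have "\<pi> i < N" "\<pi> k < N" "\<pi> (\<pi> i) \<noteq> \<pi> i" using N nf by simp_all
        from straightened_mirror_slot[OF this x(5), of z]
        have L': "straightened z (i, \<pi> k) = (base_chord i * z (\<pi> i, \<pi> k) + base_chord k * z (i, k)) / D"
          using x(7) N unfolding ii by (simp add: D_def chord_value_\<pi>)
        have R'': "straightened z (\<pi> i, k) = (base_chord (\<pi> i) * z (i, k) + base_chord (\<pi> k) * z (\<pi> i, \<pi> k)) / D"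
          using R' True by (simp add: D_def)
        \<comment> \<open>The two conjugating entries solve a system of two equations: in this
          difference \<open>z (\<pi> i, \<pi> k)\<close> cancels and the factor of
          \<open>z (i, k)\<close> is \<open>D / D\<close>.\<close>
        have "?L + ?B - ?R = straightened z (i, \<pi> k) * base_chord (\<pi> k) - base_chord i * straightened z (\<pi> i, k)"
          using x(1,8) c nf False by simp
        also have "\<dots> = ((base_chord i * z (\<pi> i, \<pi> k) + base_chord k * z (i, k)) * base_chord (\<pi> k)
            - base_chord i * (base_chord (\<pi> i) * z (i, k) + base_chord (\<pi> k) * z (\<pi> i, \<pi> k))) / D"
          unfolding L' R'' by (simp add: diff_divide_distrib)
        also have "\<dots> = z (i, k) * D / D" unfolding D by (simp add: algebra_simps)
        finally show ?thesis using D0 by simp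
      next
        case nc: False
        \<comment> \<open>If the term from \<open>U * m\<close> is present although the chords do
          not cross, then \<open>(\<pi> i, \<pi> k)\<close> is not a slot and the conjugating entry
          in that term is zero.\<close>
        have "?L = 0"
        proof (cases "\<pi> k \<noteq> k \<and> cyc_between i (\<pi> k) k")
          case True
          have ne: "\<pi> k \<noteq> i" "\<pi> i \<noteq> \<pi> k" "i \<noteq> \<pi> i"
            using cyc_between_neq[OF N(3)] True c nf N by (metis \<pi>_\<pi>)+
          have "\<not> cyc_between i (\<pi> k) (\<pi> i)" using nc c by (simp add: crossing_def)
          then have "\<not> cyc_between (\<pi> i) i (\<pi> k)"
            using ne cyc_between_flip[of i "\<pi> k" "\<pi> i"] cyc_between_swap[of i "\<pi> k" "\<pi> i"] by metis
          then have "mirror (i, \<pi> k) \<notin> slots"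
            unfolding mirror_nonfixed[OF nf] using N nf slots_nonfixed[of "\<pi> i" "\<pi> k"] by simp
          then have "straightened z (i, \<pi> k) = 0" using ne by (simp add: straightened_def)
          then show ?thesis by simp
        next
          case False
          then show ?thesis by (rule if_not_P)
        qed
        then show ?thesis using R' nc c nf False base_chord_nonzero[of i] by simp
      qed
    qed
  qed
  then show ?thesis by (simp add: cyc_entry_add cyc_entry_diff L R B)
qed

lemma param_straightened_derivative:
  assumes "(i, k) \<in> coords"
  shows "((\<lambda>t. param (straightened (\<lambda>p. t * z p)) $$ (i, k)) has_field_derivative z (i, k)) (at 0)"
proof -
  have N: "i < N" "k < N" "i \<noteq> k" using assms by (auto simp: coords_def slots_def chord_coords_def)
  have "((\<lambda>t. cyc_entry N (conjugate (straightened (\<lambda>p. t * z p))) i k) has_field_derivative z (i, k)) (at 0)"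
    using array_derivative_conjugate_straightened[of z, unfolded array_derivative_def]
    unfolding straightened_entries[OF assms, of z, symmetric] cyc_entry_def by blast
  then show ?thesis using N by (simp add: param_def mat_of_array_index)
qed

lemma polynomial_in_straightened:
  assumes "p \<in> square"
  shows "polynomial_in coords (\<lambda>z. straightened z p)"
proof -
  obtain i k where p: "p = (i, k)" by fastforce
  have ik: "i < N" "k < N" using assms by (simp_all add: p)
  have scale: "polynomial_in coords (\<lambda>z. f z / c)" if "polynomial_in coords f" for f c
    using polynomial_in.mult[OF that polynomial_in.const[of _ "inverse c"]] by (simp add: field_simps)
  have var: "polynomial_in coords (\<lambda>z. z q)" if "q \<in> slots" for q
    using that by (intro polynomial_in.var) (simp add: coords_def)
  consider "i = k" "\<pi> i = i" | "i = k" "\<pi> i \<noteq> i" | "i \<noteq> k" "mirror (i, k) \<notin> slots"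
    | "i \<noteq> k" "mirror (i, k) \<in> slots" "\<pi> i = i"
    | "i \<noteq> k" "mirror (i, k) \<in> slots" "\<pi> i \<noteq> i" "\<not> crossing (\<pi> i) k"
    | "i \<noteq> k" "mirror (i, k) \<in> slots" "\<pi> i \<noteq> i" "crossing (\<pi> i) k" by blast
  then show ?thesis
  proof cases
    case 2
    then have "(i, \<pi> i) \<in> coords" using ik by (simp add: coords_def chord_coords_def)
    then have "polynomial_in coords (\<lambda>z. base_chord i + z (i, \<pi> i))"
      by (intro polynomial_in.intros)
    then show ?thesis using 2 by (simp add: p straightened_def)
  next
    case 4
    then show ?thesis using scale[OF var, of "mirror (i, k)" "base_chord k"]
      by (simp add: p straightened_def mirror_fixed)
  next
    case 5
    then have "(\<pi> i, k) \<in> slots" by (simp add: mirror_nonfixed)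
    then show ?thesis using 5 scale[OF polynomial_in_uminus[OF var], of "(\<pi> i, k)" "base_chord (\<pi> i)"]
      by (simp add: p straightened_def)
  next
    case 6
    then have s: "(\<pi> i, k) \<in> slots" by (simp add: mirror_nonfixed)
    have ii: "\<pi> (\<pi> i) = i" using ik by simp
    have "(i, \<pi> k) \<in> slots"
    proof -
      have "\<pi> i \<noteq> k" using s by (simp add: slots_def)
      moreover have "\<pi> (\<pi> i) \<noteq> \<pi> i" using 6(3) unfolding ii by metis
      ultimately show ?thesis
        using crossing_slots(5)[OF \<pi>_less[OF ik(1)] ik(2) _ _ 6(4)] unfolding ii by blast
    qed
    then have "polynomial_in coords (\<lambda>z. (base_chord i * z (\<pi> i, k) + base_chord (\<pi> k) * z (i, \<pi> k)) /
         (chord_value base_chord k - chord_value base_chord (\<pi> i)))"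
      by (intro scale polynomial_in.add polynomial_in.mult polynomial_in.const var s)
    then show ?thesis using 6 by (simp add: p straightened_def)
  qed (simp_all add: p straightened_def polynomial_in.const)
qed

lemma polynomial_in_param_straightened:
  "i < N \<Longrightarrow> k < N \<Longrightarrow> polynomial_in coords (\<lambda>z. param (straightened z) $$ (i, k))"
  by (rule polynomial_in_compose[OF polynomial_in_param]) (assumption+, rule polynomial_in_straightened)

text \<open>On \<open>Y n\<close> the \<open>n + 1\<close> entries at \<open>I (Suc n)\<close> are
  polynomials in \<open>n\<close> parameters, hence satisfy a relation \<open>P\<close>. On
  \<open>Y (Suc n)\<close> they satisfy none, because there they have the identity as derivative at
  the origin.\<close>

lemma krull_dim_locus_ge:
  "enat (N\<^sup>2 div 2) \<le> krull_dim (subtopology (zariski N) (link_pattern_locus N \<pi>))"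
proof -
  let ?d = "N\<^sup>2 div 2"
  obtain e where e: "bij_betw e {..<?d} coords"
    using ex_bij_betw_nat_finite[OF finite_coords] unfolding card_coords atLeast0LessThan by blast
  define I where "I n = e ` {..<n}" for n
  have I: "I n \<subseteq> coords" "finite (I n)" "card (I n) = n" if "n \<le> ?d" for n
  proof -
    have sub: "{..<n} \<subseteq> {..<?d}" using that by auto
    show "I n \<subseteq> coords" unfolding I_def using e sub by (auto simp: bij_betw_def)
    show "finite (I n)" by (simp add: I_def)
    have "inj_on e {..<n}" using e sub by (auto simp: bij_betw_def intro: inj_on_subset)
    then show "card (I n) = n" by (simp add: I_def card_image)
  qed
  have Imono: "I n \<subseteq> I (Suc n)" for n unfolding I_def by (intro image_mono) auto
  define cut where "cut n z = (\<lambda>p. if p \<in> I n then z p else 0)" for n and z :: "nat \<times> nat \<Rightarrow> complex"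
  define h where "h z = discriminant (chord_value (\<lambda>i. straightened z (i, i)))" for z
  have polh: "polynomial_in coords h"
    unfolding h_def
    by (rule polynomial_in_compose[OF polynomial_in_discriminant]) (rule polynomial_in_straightened)
  have h0: "h (\<lambda>_. 0) \<noteq> 0"
    using discriminant_base_chord by (simp add: h_def straightened_def)
  have polcut: "polynomial_in (I n) (\<lambda>z. f (cut n z))" if "polynomial_in coords f" for f n
    unfolding cut_def
  proof (rule polynomial_in_compose[OF that])
    fix i assume "i \<in> coords"
    show "polynomial_in (I n) (\<lambda>y. if i \<in> I n then y i else 0)"
      by (cases "i \<in> I n") (simp_all add: polynomial_in.intros)
  qed
  define Y where "Y n = (\<lambda>z. param (straightened (cut n z))) ` {z. h (cut n z) \<noteq> 0}" for n
  show ?thesis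
  proof (rule krull_dim_zariski_ge[OF locus_subset_carrier])
    fix n assume n: "n \<le> ?d"
    show "Y n \<subseteq> link_pattern_locus N \<pi>"
      unfolding Y_def h_def by (auto simp: param_in_locus_iff)
    show "zariski_irreducible N (Y n)"
      unfolding Y_def
    proof (rule zariski_irreducible_image)
      fix i j assume "i < N" "j < N"
      then show "polynomial_in (I n) (\<lambda>z. param (straightened (cut n z)) $$ (i, j))"
        by (rule polcut[OF polynomial_in_param_straightened])
    next
      show "polynomial_in (I n) (\<lambda>z. h (cut n z))" by (rule polcut[OF polh])
      have "cut n (\<lambda>_. 0) = (\<lambda>_. 0)" by (simp add: cut_def fun_eq_iff)
      then show "h (cut n (\<lambda>_. 0)) \<noteq> 0" using h0 by simp
    qed
  next
    fix n assume n: "n < ?d"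
    have cc: "cut (Suc n) (cut n z) = cut n z" for z
      using Imono[of n] by (auto simp: cut_def fun_eq_iff)
    show "Y n \<subseteq> Y (Suc n)"
    proof
      fix M assume "M \<in> Y n"
      then obtain z where "M = param (straightened (cut n z))" "h (cut n z) \<noteq> 0" unfolding Y_def by blast
      then show "M \<in> Y (Suc n)" unfolding Y_def by (intro image_eqI[of _ _ "cut n z"]) (simp_all add: cc)
    qed
    let ?f = "\<lambda>p (M :: complex mat). M $$ p"
    have "card (I n) < card (I (Suc n))" using I(3)[of n] I(3)[of "Suc n"] n by simp
    moreover have "polynomial_in (I n) (\<lambda>z. param (straightened (cut n z)) $$ p)" if "p \<in> I (Suc n)" for p
    proof -
      obtain i k where p: "p = (i, k)" by fastforce
      have "(i, k) \<in> square" using that I(1)[of "Suc n"] n coords_subset unfolding p by auto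
      then show ?thesis unfolding p by (intro polcut[OF polynomial_in_param_straightened]) auto
    qed
    ultimately have "\<exists>P. polynomial_in (I (Suc n)) P \<and> (\<exists>y. P y \<noteq> 0) \<and>
        (\<forall>z. P (\<lambda>p. param (straightened (cut n z)) $$ p) = 0)"
      by (intro algebraically_dependent) (use I(2) n in auto)
    then obtain P where P: "polynomial_in (I (Suc n)) P" "\<exists>y. P y \<noteq> 0"
      "\<And>z. P (\<lambda>p. param (straightened (cut n z)) $$ p) = 0" by blast
    show "\<exists>h. poly_fun N h \<and> (\<forall>M\<in>Y n. h M = 0) \<and> (\<exists>M\<in>Y (Suc n). h M \<noteq> 0)"
    proof (intro exI conjI)
      show "poly_fun N (\<lambda>M. P (\<lambda>p. M $$ p))"
      proof (rule poly_fun_compose_polynomial_in[OF P(1)])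
        fix p assume "p \<in> I (Suc n)"
        then have "p \<in> square" using I(1)[of "Suc n"] n coords_subset by auto
        then show "poly_fun N (\<lambda>M. M $$ p)" by (cases p) (simp add: poly_fun.entry)
      qed
      show "\<forall>M\<in>Y n. P (\<lambda>p. M $$ p) = 0" unfolding Y_def using P(3) by auto
      show "\<exists>M\<in>Y (Suc n). P (\<lambda>p. M $$ p) \<noteq> 0"
      proof (rule ccontr)
        assume no: "\<not> ?thesis"
        have "P x = 0" for x
        \<comment> \<open>The images of lines through the origin have every prescribed tangent
          direction in the entries at \<open>I (Suc n)\<close>.\<close>
        proof (rule polynomial_in_zero_of_curves[OF P(1), where c = "\<lambda>p. param (straightened (\<lambda>_. 0)) $$ p"])
          fix z :: "nat \<times> nat \<Rightarrow> complex"
          let ?c = "cut (Suc n) z"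
          have cs: "(\<lambda>p. t * ?c p) = cut (Suc n) (\<lambda>p. t * z p)" for t by (auto simp: cut_def)
          let ?\<gamma> = "\<lambda>t p. param (straightened (\<lambda>p. t * ?c p)) $$ p"
          \<comment> \<open>Near the origin these curves stay in the locus, since \<open>h\<close>
            is non-zero there.\<close>
          have "((\<lambda>t. h (\<lambda>p. t * ?c p)) \<longlongrightarrow> h (\<lambda>_. 0)) (at 0)"
            by (rule polynomial_in_tendsto[OF polh]) (auto intro!: tendsto_eq_intros)
          then have "\<forall>\<^sub>F t in at 0. h (\<lambda>p. t * ?c p) \<noteq> 0" using h0 by (rule tendsto_imp_eventually_ne)
          then have "\<forall>\<^sub>F t in at 0. P (?\<gamma> t) = 0"
          proof eventually_elim
            case (elim t)
            then have "param (straightened (\<lambda>p. t * ?c p)) \<in> Y (Suc n)" unfolding cs Y_def by blast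
            then show ?case using no by blast
          qed
          moreover have "?\<gamma> 0 p = param (straightened (\<lambda>_. 0)) $$ p" for p by simp
          moreover have "((\<lambda>t. ?\<gamma> t p) has_field_derivative z p) (at 0)" if "p \<in> I (Suc n)" for p
          proof -
            obtain i k where p: "p = (i, k)" by fastforce
            have "(i, k) \<in> coords" using that I(1)[of "Suc n"] n unfolding p by auto
            from param_straightened_derivative[OF this, of ?c] show ?thesis using that by (simp add: p cut_def)
          qed
          ultimately show "\<exists>\<gamma>. (\<forall>p\<in>I (Suc n). \<gamma> 0 p = param (straightened (\<lambda>_. 0)) $$ p \<and>
              ((\<lambda>t. \<gamma> t p) has_field_derivative z p) (at 0)) \<and> (\<forall>\<^sub>F t in at 0. P (\<gamma> t) = 0)"
            by (intro exI[of _ ?\<gamma>]) simp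
        qed
        then show False using P(2) by blast
      qed
    qed
  qed
qed

lemma irreducible_space_locus:
  "irreducible_space (subtopology (zariski N) (link_pattern_locus N \<pi>))"
proof -
  have "zariski_irreducible N (link_pattern_locus N \<pi>)"
    unfolding locus_eq_param_image
  proof (rule zariski_irreducible_image[OF polynomial_in_param polynomial_in_discriminant])
    show "discriminant (chord_value (\<lambda>i. (\<lambda>p. base_chord (fst p)) (i, i))) \<noteq> 0"
      using discriminant_base_chord by simp
  qed
  then show ?thesis using irreducible_space_zariski_iff[OF locus_subset_carrier] by blast
qed

lemma locus_nonempty: "link_pattern_locus N \<pi> \<noteq> {}"
  using irreducible_space_locus
  unfolding irreducible_space_def topspace_subtopology_zariski[OF locus_subset_carrier] by blast

end

theorem mainTheorem1:
  fixes N :: nat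
  assumes "N \<ge> 1"
  shows "(\<forall>M \<in> brauer_loop_scheme N. \<exists>\<pi>. link_pattern N \<pi> \<and>
            (\<forall>i<N. (M * M) $$ (i, i) = (M * M) $$ (\<pi> i, \<pi> i) \<and>
                   (\<pi> i = i \<longrightarrow> (M * M) $$ (i, i) = 0))) \<and>
         (\<forall>\<pi>. link_pattern N \<pi> \<longrightarrow>
            openin (subtopology (zariski N) (brauer_loop_scheme N)) (link_pattern_locus N \<pi>) \<and>
            link_pattern_locus N \<pi> \<noteq> {} \<and>
            irreducible_space (subtopology (zariski N) (link_pattern_locus N \<pi>)) \<and>
            krull_dim (subtopology (zariski N) (link_pattern_locus N \<pi>)) = enat (N\<^sup>2 div 2))"
proof (intro conjI ballI allI impI)
  have N: "N > 0" using assms by simp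
  fix M assume "M \<in> brauer_loop_scheme N"
  then show "\<exists>\<pi>. link_pattern N \<pi> \<and>
            (\<forall>i<N. (M * M) $$ (i, i) = (M * M) $$ (\<pi> i, \<pi> i) \<and>
                   (\<pi> i = i \<longrightarrow> (M * M) $$ (i, i) = 0))"
    by (rule diagonal_square_pairing[OF N])
next
  fix \<pi> assume "link_pattern N \<pi>"
  then interpret link N \<pi> using assms by unfold_locales simp_all
  show "openin (subtopology (zariski N) (brauer_loop_scheme N)) (link_pattern_locus N \<pi>)"
    by (rule openin_locus)
  show "link_pattern_locus N \<pi> \<noteq> {}" by (rule locus_nonempty)
  show "irreducible_space (subtopology (zariski N) (link_pattern_locus N \<pi>))"
    by (rule irreducible_space_locus)
  show "krull_dim (subtopology (zariski N) (link_pattern_locus N \<pi>)) = enat (N\<^sup>2 div 2)"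
    by (rule antisym[OF krull_dim_locus_le krull_dim_locus_ge])
qed

end
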